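(* Let $X_1,\ldots,X_n$ be a stationary, time homogeneous, $\phi$-irreducible, aperiodic Markov chain (not assumed reversible) with Polish state space $\Omega$ and unique stationary distribution $\pi$ (so $X_1\sim\pi$), with pseudo spectral gap $\gamma_{\mathrm{ps}}$. Let $f\in L^2(\pi)$ be real valued with $|f(x)-\mathbb{E}_\pi(f)|\le C$ for every $x\in\Omega$, and let $V_f:=\mathrm{Var}_\pi(f)$. Let $S:=\sum_{i=1}^nf(X_i)$. Then for every $t\ge0$, $$\mathbb{P}_\pi(|S-\mathbb{E}_\pi(S)|\ge t)\le2\exp\left(-\frac{t^2\cdot\gamma_{\mathrm{ps}}}{8(n+1/\gamma_{\mathrm{ps}})V_f+20tC}\right).$$ More generally, let $f_1,\ldots,f_n$ be real valued $L^2(\pi)$ functions satisfying $|f_i(x)-\mathbb{E}_\pi(f_i)|\le C$ for every $x\in\Omega$. Let $S':=\sum_{i=1}^nf_i(X_i)$ and $V_{S'}:=\sum_{i=1}^n\mathrm{Var}_\pi(f_i)$. Let $k_{\mathrm{ps}}$ be the smallest positive integer such that $$\gamma_{\mathrm{ps}}=\gamma\left((\boldsymbol{P}^* )^{k_{\mathrm{ps}}}\boldsymbol{P}^{k_{\mathrm{ps}}}\right)/k_{\mathrm{ps}}.$$ For $1\le i\le k_{\mathrm{ps}}$, let $V_i:=\sum_{j=0}^{\lfloor(n-i)/k_{\mathrm{ps}}\rfloor}\mathrm{Var}_\pi(f_{i+jk_{\mathrm{ps}}})$, and let $$M:=\left(\sum_{1\le i\le k_{\mathrm{ps}}}V_i^{1/2}\right)\bigg/\min_{1\le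 i\le k_{\mathrm{ps}}}V_i^{1/2}.$$ Then for every $t\ge0$, $$\mathbb{P}_\pi(|S'-\mathbb{E}_\pi(S')|\ge t)\le2\exp\left(-\frac{t^2\cdot\gamma_{\mathrm{ps}}}{8V_{S'}+20tC\cdot M/k_{\mathrm{ps}}}\right).$$
   Context: $\mathbb{P}_\pi$, $\mathbb{E}_\pi$, $\mathrm{Var}_\pi$ refer to the chain started from $X_1\sim\pi$. $L^2(\pi)$ is the Hilbert space of square integrable functions on $\Omega$ with $\langle f,g\rangle_\pi=\int f g^*\,d\pi$. For the Markov kernel $P(x,dy)$, $(\boldsymbol{P}f)(x)=\int f(y)P(x,dy)$, with adjoint $\boldsymbol{P}^*$ on $L^2(\pi)$. For a self-adjoint Markov operator $\boldsymbol{Q}$ on (complex) $L^2(\pi)$ with spectrum $S_2\subset\mathbb{R}$, $\gamma(\boldsymbol{Q}):=1-\sup\{\lambda\in S_2:\lambda\ne1\}$ if the eigenvalue $1$ has multiplicity $1$, and $0$ otherwise. The pseudo spectral gap is $\gamma_{\mathrm{ps}}:=\max_{k\ge1}\{\gamma((\boldsymbol{P}^* )^k\boldsymbol{P}^k)/k\}$. Degenerate cases: if $\gamma_{\mathrm{ps}}=0$, or (in the second bound) if $\min_iV_i=0$ so that $M=+\infty$, the right hand sides are read as $2$. Empty sums are $0$. $\phi$-irreducible: there is a non-zero $\sigma$-finite measure $\phi$ on $\Omega$ such that for all $A$ with $\phi(A)>0$ and all $x\in\Omega$ there is $n\ge1$ with $P^n(x,A)>0$. Aperiodic: there are no $d\ge2$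 and disjoint $\Omega_1,\ldots,\Omega_d\subset\Omega$ with $\pi(\Omega_1)>0$, $P(x,\Omega_{i+1})=1$ for $x\in\Omega_i$ ($i\le d-1$), and $P(x,\Omega_1)=1$ for $x\in\Omega_d$. *)

theory Defs
  imports "HOL-Probability.Probability"
begin

section \<open>Markov kernels and Markov chains\<close>

text \<open>A Markov kernel is an element of \<^term>\<open>borel \<rightarrow>\<^sub>M prob_algebra borel\<close>.\<close>

primrec kernel_pow :: "('a::topological_space \<Rightarrow> 'a measure) \<Rightarrow> nat \<Rightarrow> 'a \<Rightarrow> 'a measure" where
  "kernel_pow P 0 x = return borel x"
| "kernel_pow P (Suc n) x = P x \<bind> kernel_pow P n"

definition stationary_distribution ::
  "('a::topological_space \<Rightarrow> 'a measure) \<Rightarrow> 'a measure \<Rightarrow> bool" where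
  "stationary_distribution P \<nu> \<longleftrightarrow>
     prob_space \<nu> \<and> sets \<nu> = sets borel \<and> \<nu> \<bind> P = \<nu>"

text \<open>The \<open>\<sigma>\<close>-algebra generated by \<open>X\<^sub>1, \<dots>, X\<^sub>i\<close>.\<close>

definition past :: "'w measure \<Rightarrow> (nat \<Rightarrow> 'w \<Rightarrow> 'a::topological_space) \<Rightarrow> nat \<Rightarrow> 'w measure" where
  "past W X i =
     vimage_algebra (space W) (\<lambda>\<omega>. \<lambda>j\<in>{1..i}. X j \<omega>) (PiM {1..i} (\<lambda>_. borel))"

definition markov_chain ::
  "'w measure \<Rightarrow> (nat \<Rightarrow> 'w \<Rightarrow> 'a::topological_space) \<Rightarrow> nat \<Rightarrow> ('a \<Rightarrow> 'a measure) \<Rightarrow> bool" where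
  "markov_chain W X n P \<longleftrightarrow>
     prob_space W \<and>
     (\<forall>i\<in>{1..n}. X i \<in> W \<rightarrow>\<^sub>M borel) \<and>
     (\<forall>i\<in>{1..<n}. \<forall>A\<in>sets borel.
        AE \<omega> in W. real_cond_exp W (past W X i) (\<lambda>\<omega>. indicator A (X (Suc i) \<omega>)) \<omega>
                    = measure (P (X i \<omega>)) A)"

definition phi_irreducible :: "('a::topological_space \<Rightarrow> 'a measure) \<Rightarrow> bool" where
  "phi_irreducible P \<longleftrightarrow>
     (\<exists>\<phi>. sets \<phi> = sets borel \<and> sigma_finite_measure \<phi> \<and> emeasure \<phi> (space \<phi>) \<noteq> 0 \<and>
        (\<forall>A\<in>sets borel. emeasure \<phi> A > 0 \<longrightarrow>
           (\<forall>x. \<exists>n\<ge>1. emeasure (kernel_pow P n x) A > 0)))"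

definition aperiodic :: "('a::topological_space \<Rightarrow> 'a measure) \<Rightarrow> 'a measure \<Rightarrow> bool" where
  "aperiodic P \<pi> \<longleftrightarrow>
     \<not> (\<exists>d D. d \<ge> (2::nat) \<and> (\<forall>i\<in>{1..d}. D i \<in> sets borel) \<and> disjoint_family_on D {1..d} \<and>
          emeasure \<pi> (D 1) > 0 \<and>
          (\<forall>i\<in>{1..d-1}. \<forall>x\<in>D i. emeasure (P x) (D (i + 1)) = 1) \<and>
          (\<forall>x\<in>D d. emeasure (P x) (D 1) = 1))"

section \<open>Operators on \<open>L\<^sup>2(\<pi>)\<close>\<close>

text \<open>
  Elements of \<open>L\<^sup>2(\<pi>)\<close> are represented by functions, and equality in \<open>L\<^sup>2(\<pi>)\<close> is
  \<open>\<pi>\<close>-almost everywhere equality.  Operators act on representatives.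
\<close>

definition L2 :: "'a measure \<Rightarrow> ('a \<Rightarrow> 'b::{banach, second_countable_topology}) set" where
  "L2 \<pi> = {f \<in> borel_measurable \<pi>. integrable \<pi> (\<lambda>x. (norm (f x))\<^sup>2)}"

definition L2_inner :: "'a measure \<Rightarrow> ('a \<Rightarrow> complex) \<Rightarrow> ('a \<Rightarrow> complex) \<Rightarrow> complex" where
  "L2_inner \<pi> f g = (\<integral>x. f x * cnj (g x) \<partial>\<pi>)"

definition L2_norm :: "'a measure \<Rightarrow> ('a \<Rightarrow> complex) \<Rightarrow> real" where
  "L2_norm \<pi> f = sqrt (\<integral>x. (norm (f x))\<^sup>2 \<partial>\<pi>)"

type_synonym 'a operator = "('a \<Rightarrow> complex) \<Rightarrow> ('a \<Rightarrow> complex)"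

text \<open>
  Compatibility with almost everywhere equality is not listed because additivity and
  boundedness imply it.
\<close>

definition L2_bounded_linear :: "'a measure \<Rightarrow> 'a operator \<Rightarrow> bool" where
  "L2_bounded_linear \<pi> T \<longleftrightarrow>
     (\<forall>f\<in>L2 \<pi>. T f \<in> L2 \<pi>) \<and>
     (\<forall>f\<in>L2 \<pi>. \<forall>g\<in>L2 \<pi>. AE x in \<pi>. T (\<lambda>y. f y + g y) x = T f x + T g x) \<and>
     (\<forall>c. \<forall>f\<in>L2 \<pi>. AE x in \<pi>. T (\<lambda>y. c * f y) x = c * T f x) \<and>
     (\<exists>B. \<forall>f\<in>L2 \<pi>. L2_norm \<pi> (T f) \<le> B * L2_norm \<pi> f)"

text \<open>
  For \<open>f \<in> L\<^sup>2(\<pi>)\<close> with \<open>\<pi>\<close> stationary, \<open>f\<close> is \<open>P(x,\<sqdot>)\<close>-integrable for \<open>\<pi>\<close>-almost every \<open>x\<close>;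
  at the remaining points the integral is \<open>0\<close> by the library's convention.
\<close>

definition markov_op :: "('a \<Rightarrow> 'a measure) \<Rightarrow> 'a operator" where
  "markov_op P f = (\<lambda>x. \<integral>y. f y \<partial>P x)"

text \<open>The adjoint is determined by its defining identity up to almost everywhere equality.\<close>

definition L2_adjoint :: "'a measure \<Rightarrow> 'a operator \<Rightarrow> 'a operator" where
  "L2_adjoint \<pi> T g =
     (SOME h. h \<in> L2 \<pi> \<and> (\<forall>f\<in>L2 \<pi>. L2_inner \<pi> (T f) g = L2_inner \<pi> f h))"

definition L2_spectrum :: "'a measure \<Rightarrow> 'a operator \<Rightarrow> complex set" where
  "L2_spectrum \<pi> Q =
     {z. \<not> (\<exists>R. L2_bounded_linear \<pi> R \<and>
            (\<forall>f\<in>L2 \<pi>. (AE x in \<pi>. R (\<lambda>y. z * f y - Q f y) x = f x) \<and>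
                       (AE x in \<pi>. z * R f x - Q (R f) x = f x)))}"

definition eigenvalue_one_simple :: "'a measure \<Rightarrow> 'a operator \<Rightarrow> bool" where
  "eigenvalue_one_simple \<pi> Q \<longleftrightarrow>
     (\<exists>v\<in>L2 \<pi>. \<not> (AE x in \<pi>. v x = 0) \<and> (AE x in \<pi>. Q v x = v x) \<and>
        (\<forall>f\<in>L2 \<pi>. (AE x in \<pi>. Q f x = f x) \<longrightarrow> (\<exists>c. AE x in \<pi>. f x = c * v x)))"

text \<open>
  The spectrum is \<open>{1}\<close> with \<open>1\<close> simple only if \<open>L\<^sup>2(\<pi>)\<close> is one-dimensional, i.e. \<open>\<pi>\<close> is a
  point mass.  The supremum of the empty set is then read as \<open>0\<close>, so that the gap is \<open>1\<close>, the
  value of every other chain of independent variables.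
\<close>

definition spectral_gap :: "'a measure \<Rightarrow> 'a operator \<Rightarrow> real" where
  "spectral_gap \<pi> Q =
     (let S = {r::real. complex_of_real r \<in> L2_spectrum \<pi> Q \<and> r \<noteq> 1}
      in if eigenvalue_one_simple \<pi> Q then 1 - (if S = {} then 0 else Sup S) else 0)"

definition gap_pow :: "'a measure \<Rightarrow> ('a \<Rightarrow> 'a measure) \<Rightarrow> nat \<Rightarrow> real" where
  "gap_pow \<pi> P k = spectral_gap \<pi> ((L2_adjoint \<pi> (markov_op P) ^^ k) \<circ> (markov_op P ^^ k))"

definition pseudo_spectral_gap :: "'a measure \<Rightarrow> ('a \<Rightarrow> 'a measure) \<Rightarrow> real" where
  "pseudo_spectral_gap \<pi> P = (GREATEST g. \<exists>k\<ge>1. g = gap_pow \<pi> P k / real k)"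

definition k_ps :: "'a measure \<Rightarrow> ('a \<Rightarrow> 'a measure) \<Rightarrow> nat" where
  "k_ps \<pi> P = (LEAST k. k \<ge> 1 \<and> pseudo_spectral_gap \<pi> P = gap_pow \<pi> P k / real k)"

section \<open>Quantities in the bounds\<close>

text \<open>
  The floor is taken on integers: for \<open>i > n\<close> it is negative and the sum is empty.
\<close>

definition block_variance :: "'a measure \<Rightarrow> (nat \<Rightarrow> 'a \<Rightarrow> real) \<Rightarrow> nat \<Rightarrow> nat \<Rightarrow> nat \<Rightarrow> real" where
  "block_variance \<pi> f n k i =
     (\<Sum>j | int j \<le> \<lfloor>(real n - real i) / real k\<rfloor>. prob_space.variance \<pi> (f (i + j * k)))"

text \<open>
  \<open>2 exp (- a / b)\<close> for \<open>a, b \<ge> 0\<close>, where \<open>a / 0 = \<infinity>\<close> for \<open>a > 0\<close> and \<open>0 / 0 = 0\<close>.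
  The case \<open>b = 0\<close> occurs for \<open>V\<^sub>f = 0\<close> with \<open>t C = 0\<close>; division in the library would yield \<open>2\<close>
  instead of \<open>0\<close> for \<open>a > 0\<close>.
\<close>

definition exp_bound :: "real \<Rightarrow> real \<Rightarrow> real" where
  "exp_bound a b = (if b = 0 \<and> a > 0 then 0 else 2 * exp (- (a / b)))"

end

theory Submission
  imports Defs "HOL-Library.Function_Algebras"
begin

text \<open>
  Let \<open>k\<close> be the exponent attaining the pseudo spectral gap, \<open>\<gamma>\<close> the gap of \<open>(P\<^sup>*)\<^sup>k P\<^sup>k\<close> and
  \<open>g = \<gamma> / 2\<close>.  The hypotheses on spectrum and eigenvalue \<open>1\<close> give
  \<open>\<parallel>P\<^sup>k f\<parallel>\<^sup>2 \<le> (1 - \<gamma>) \<parallel>f\<parallel>\<^sup>2 \<le> (1 - g)\<^sup>2 \<parallel>f\<parallel>\<^sup>2\<close> for centred \<open>f\<close>, and hence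
  \<open>\<bar>\<langle>u, P\<^sup>k v\<rangle>\<bar> \<le> N(u) N(v)\<close> with \<open>N(u)\<^sup>2 = g (E u)\<^sup>2 + (1 - g) E u\<^sup>2\<close>.  This replaces \<open>P\<^sup>k\<close> by a
  mixture of the identity and the expectation, for which the relevant norms are explicit: if
  \<open>\<bar>f\<bar> \<le> C\<close> and \<open>E f = 0\<close>, then each factor \<open>exp (t f)\<close> along the skeleton \<open>i, i + k, i + 2 k, \<dots>\<close>
  costs at most \<open>exp (t\<^sup>2 Var f / (g - t C))\<close>.  The \<open>k\<close> skeletons are combined by convexity of the
  exponential function with weights \<open>p\<^sub>i\<close>, namely \<open>1 / k\<close> or those proportional to \<open>V\<^sub>i\<^sup>1\<^sup>/\<^sup>2\<close>, and
  Chernoff's bound gives the claim, even with \<open>12\<close> in place of \<open>20\<close>.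
\<close>

section \<open>Symmetric operators on a semi-Hilbert space\<close>

text \<open>\<open>P\<close> need not be symmetric, so the gap of \<open>sq_op k\<close> controls
  only the norm of the \<open>k\<close>-th power of \<open>P\<close> on centred functions and says
  nothing about fewer than \<open>k\<close> steps. This forces the passage to skeletons of step
  \<open>k\<close>, on which every transition contracts. The contraction factor is a square root,
  and \<surd>(1 - \<gamma>) \<le> 1 - \<gamma> / 2 is the origin of \<open>g\<close>.

  The gap is defined by invertibility, not by an inequality. The inequality for the quadratic form
  is obtained without functional calculus: invertibility of \<open>s - Q\<close> for
  \<open>s\<close> between 1 - \<gamma> and 1 yields (1 - Q) (1 - \<gamma> - Q) \<ge> 0, and
  simplicity of the eigenvalue 1 removes the fixed vectors.

  Convexity runs skeleton \<open>i\<close> at the parameter \<open>t / p i\<close>. This inflates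
  the variance by \<open>1 / (p i)\<^sup>2\<close> and the restriction on \<open>t\<close> by
  \<open>1 / p i\<close>. Equal weights keep the second factor at \<open>k\<close>; weights
  proportional to the roots of the variances balance the first and pay with \<open>M\<close> in the
  second.\<close>

lemma nonneg_quadratic_imp_discriminant:
  fixes A B C :: real
  assumes "\<And>t. 0 \<le> A + 2 * t * B + t\<^sup>2 * C"
  shows "B\<^sup>2 \<le> A * C"
proof (cases "C = 0")
  case True
  have "B = 0"
  proof (rule ccontr)
    assume "B \<noteq> 0"
    then show False
      using assms[of "- (A + 1) / (2 * B)"] True by (simp add: field_simps)
  qed
  then show ?thesis using True by simp
next
  case False
  have C: "C > 0"
  proof (rule ccontr)
    assume "\<not> C > 0"
    with False have "C < 0" by simp
    define r where "r = 1 + \<bar>A\<bar> / (- C)"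
    have r: "r \<ge> 1" unfolding r_def using \<open>C < 0\<close> by (simp add: divide_nonneg_neg)
    have "0 \<le> A + r\<^sup>2 * C"
      using assms[of r] assms[of "- r"] by simp
    moreover have "r\<^sup>2 \<ge> r" using r by (simp add: power2_eq_square)
    then have "r\<^sup>2 * C \<le> r * C" using \<open>C < 0\<close> by (simp add: mult_right_mono_neg)
    moreover have "r * C = C - \<bar>A\<bar>" unfolding r_def using \<open>C < 0\<close> by (simp add: field_simps)
    ultimately show False using \<open>C < 0\<close> by linarith
  qed
  have "0 \<le> A + 2 * (- B / C) * B + (- B / C)\<^sup>2 * C"
    by (rule assms)
  also have "\<dots> = A - B\<^sup>2 / C"
    using C by (simp add: field_simps power2_eq_square)
  finally show ?thesis using C by (simp add: field_simps)
qed

text \<open>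
  The spaces are spaces of functions and the form is only positive semidefinite, so that
  \<open>ip (x - y) (x - y) = 0\<close> plays the role of almost everywhere equality.
\<close>

locale semi_inner =
  fixes H :: "'v::real_vector set" and ip :: "'v \<Rightarrow> 'v \<Rightarrow> real"
  assumes subspace_H: "subspace H"
    and ip_add: "\<lbrakk>x \<in> H; y \<in> H; z \<in> H\<rbrakk> \<Longrightarrow> ip (x + y) z = ip x z + ip y z"
    and ip_scale: "\<lbrakk>x \<in> H; z \<in> H\<rbrakk> \<Longrightarrow> ip (c *\<^sub>R x) z = c * ip x z"
    and ip_sym: "\<lbrakk>x \<in> H; y \<in> H\<rbrakk> \<Longrightarrow> ip x y = ip y x"
    and ip_nonneg: "x \<in> H \<Longrightarrow> 0 \<le> ip x x"
begin

lemma H_mem [simp]: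
  "0 \<in> H" "\<lbrakk>x \<in> H; y \<in> H\<rbrakk> \<Longrightarrow> x + y \<in> H" "x \<in> H \<Longrightarrow> c *\<^sub>R x \<in> H"
  "\<lbrakk>x \<in> H; y \<in> H\<rbrakk> \<Longrightarrow> x - y \<in> H" "x \<in> H \<Longrightarrow> - x \<in> H"
  using subspace_H by (auto simp: subspace_neg subspace_0 subspace_add subspace_scale subspace_diff)

lemma ip_diff: "\<lbrakk>x \<in> H; y \<in> H; z \<in> H\<rbrakk> \<Longrightarrow> ip (x - y) z = ip x z - ip y z"
  using ip_add[of x "(-1) *\<^sub>R y" z] ip_scale[of y z "-1"] H_mem(3)[of y "-1"] by simp

lemma ip_add_right: "\<lbrakk>x \<in> H; y \<in> H; z \<in> H\<rbrakk> \<Longrightarrow> ip z (x + y) = ip z x + ip z y"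
  using ip_add[of x y z] ip_sym by simp

lemma ip_diff_right: "\<lbrakk>x \<in> H; y \<in> H; z \<in> H\<rbrakk> \<Longrightarrow> ip z (x - y) = ip z x - ip z y"
  using ip_diff[of x y z] ip_sym by simp

lemma ip_scale_right: "\<lbrakk>x \<in> H; z \<in> H\<rbrakk> \<Longrightarrow> ip z (c *\<^sub>R x) = c * ip z x"
  using ip_scale[of x z c] ip_sym by simp

lemmas ip_simps = ip_add ip_diff ip_scale ip_add_right ip_diff_right ip_scale_right

lemma Cauchy_Schwarz:
  assumes "x \<in> H" "y \<in> H"
  shows "(ip x y)\<^sup>2 \<le> ip x x * ip y y"
proof (rule nonneg_quadratic_imp_discriminant)
  fix t
  have "0 \<le> ip (x + t *\<^sub>R y) (x + t *\<^sub>R y)" using assms by (intro ip_nonneg) simp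
  also have "\<dots> = ip x x + 2 * t * ip x y + t\<^sup>2 * ip y y"
    using assms by (simp add: ip_simps ip_sym[of y x] power2_eq_square algebra_simps)
  finally show "0 \<le> ip x x + 2 * t * ip x y + t\<^sup>2 * ip y y" .
qed

definition nrm where "nrm x = sqrt (ip x x)"

lemma nrm_nonneg [simp]: "x \<in> H \<Longrightarrow> 0 \<le> nrm x"
  by (simp add: nrm_def ip_nonneg)

lemma nrm_sq: "x \<in> H \<Longrightarrow> (nrm x)\<^sup>2 = ip x x"
  by (simp add: nrm_def ip_nonneg)

lemma ip_le_nrm: "\<lbrakk>x \<in> H; y \<in> H\<rbrakk> \<Longrightarrow> \<bar>ip x y\<bar> \<le> nrm x * nrm y"
  using Cauchy_Schwarz[of x y]
  by (intro power2_le_imp_le[of "\<bar>ip x y\<bar>"]) (auto simp: power_mult_distrib nrm_sq)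

lemma nrm_triangle: "\<lbrakk>x \<in> H; y \<in> H\<rbrakk> \<Longrightarrow> nrm (x + y) \<le> nrm x + nrm y"
proof (rule power2_le_imp_le)
  assume xy: "x \<in> H" "y \<in> H"
  have "(nrm (x + y))\<^sup>2 = (nrm x)\<^sup>2 + 2 * ip x y + (nrm y)\<^sup>2"
    using xy by (simp add: nrm_sq ip_simps ip_sym[of y x])
  also have "\<dots> \<le> (nrm x + nrm y)\<^sup>2"
    using ip_le_nrm[OF xy] by (simp add: power2_sum)
  finally show "(nrm (x + y))\<^sup>2 \<le> (nrm x + nrm y)\<^sup>2" .
qed (auto simp: add_nonneg_nonneg)

lemma nrm_minus_commute: "\<lbrakk>x \<in> H; y \<in> H\<rbrakk> \<Longrightarrow> nrm (x - y) = nrm (y - x)"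
  by (simp add: nrm_def ip_simps)

lemma ip_minus_minus: "x \<in> H \<Longrightarrow> ip (- x) (- x) = ip x x"
  using ip_diff[of 0 x "- x"] ip_diff_right[of 0 x x] ip_diff[of x x "- x"] ip_diff_right[of x x x] by simp

lemma ip_eq_0: "\<lbrakk>x \<in> H; y \<in> H; ip x x = 0\<rbrakk> \<Longrightarrow> ip x y = 0"
  using Cauchy_Schwarz[of x y] by simp

lemma tendsto_ip_left:
  assumes "\<And>n. s n \<in> H" "h \<in> H" "x \<in> H" "(\<lambda>n. ip (s n - h) (s n - h)) \<longlonglongrightarrow> 0"
  shows "(\<lambda>n. ip (s n) x) \<longlonglongrightarrow> ip h x"
proof -
  have "(\<lambda>n. sqrt (ip (s n - h) (s n - h)) * nrm x) \<longlonglongrightarrow> sqrt 0 * nrm x"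
    using assms(4) by (intro tendsto_intros)
  then have "(\<lambda>n. sqrt (ip (s n - h) (s n - h)) * nrm x) \<longlonglongrightarrow> 0" by simp
  then have "(\<lambda>n. ip (s n - h) x) \<longlonglongrightarrow> 0"
    by (rule Lim_null_comparison[rotated])
      (use assms ip_le_nrm in \<open>auto intro!: always_eventually simp flip: nrm_def\<close>)
  then show ?thesis
    using assms by (simp add: ip_diff LIM_zero_iff)
qed

end

text \<open>Completeness is expressed through \<open>ip\<close> alone, so that it can be transferred
  to an equivalent form on the same space, as in \<open>coercive_surj\<close>, and to the subspace
  of centred functions. Limits are determined only up to vectors of norm 0.\<close>

locale semi_hilbert = semi_inner +
  assumes complete: "\<lbrakk>\<And>n. s n \<in> H; \<And>e. e > 0 \<Longrightarrow> \<exists>N. \<forall>m\<ge>N. \<forall>n\<ge>N. ip (s m - s n) (s m - s n) < e\<rbrakk>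
    \<Longrightarrow> \<exists>h\<in>H. (\<lambda>n::nat. ip (s n - h) (s n - h)) \<longlonglongrightarrow> 0"
begin

text \<open>The representing vector minimises \<open>ip x x - 2 * \<phi> x\<close>.\<close>

theorem riesz_representation:
  assumes add: "\<And>x y. \<lbrakk>x \<in> H; y \<in> H\<rbrakk> \<Longrightarrow> \<phi> (x + y) = \<phi> x + \<phi> y"
    and scale: "\<And>x c. x \<in> H \<Longrightarrow> \<phi> (c *\<^sub>R x) = c * \<phi> x"
    and bound: "\<And>x. x \<in> H \<Longrightarrow> (\<phi> x)\<^sup>2 \<le> B * ip x x" and "B \<ge> 0"
  obtains h where "h \<in> H" "\<And>x. x \<in> H \<Longrightarrow> \<phi> x = ip h x"
proof -
  define J where "J x = ip x x - 2 * \<phi> x" for x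
  have J_ge: "J x \<ge> - B" if "x \<in> H" for x
  proof -
    have "(2 * \<phi> x)\<^sup>2 \<le> 4 * (B * ip x x)" using bound[OF that] by (simp add: power_mult_distrib)
    also have "\<dots> \<le> (B + ip x x)\<^sup>2"
      using zero_le_power2[of "B - ip x x"] by (simp add: power2_sum power2_diff)
    finally have "2 * \<phi> x \<le> B + ip x x"
      by (rule power2_le_imp_le) (use ip_nonneg[OF that] \<open>B \<ge> 0\<close> in simp)
    then show ?thesis by (simp add: J_def)
  qed
  define m where "m = Inf (J ` H)"
  have bdd: "bdd_below (J ` H)" using J_ge by (intro bdd_belowI2) auto
  have m_le: "m \<le> J x" if "x \<in> H" for x
    unfolding m_def using bdd that by (intro cInf_lower) auto
  have "\<exists>x\<in>H. J x < m + 1 / Suc n" for n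
  proof -
    have "Inf (J ` H) < m + 1 / Suc n" by (simp add: m_def)
    from cInf_lessD[OF _ this] show ?thesis using H_mem(1) by blast
  qed
  then obtain s where s: "\<And>n. s n \<in> H" and J_s: "\<And>n. J (s n) < m + 1 / Suc n"
    by metis
  \<comment> \<open>Parallelogram identity: \<open>J\<close> is at least \<open>m\<close> at the
    midpoint of \<open>x\<close> and \<open>y\<close>, so two vectors that almost minimise
    \<open>J\<close> are close to each other.\<close>
  have cau: "ip (x - y) (x - y) \<le> 2 * (J x - m) + 2 * (J y - m)" if "x \<in> H" "y \<in> H" for x y
  proof -
    have "ip ((1/2) *\<^sub>R (x + y)) ((1/2) *\<^sub>R (x + y)) = (ip x x + 2 * ip x y + ip y y) / 4"
      using that by (simp add: ip_simps ip_sym[of y x] add_divide_distrib del: scaleR_add_right)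
    then have "4 * J ((1/2) *\<^sub>R (x + y)) = 2 * J x + 2 * J y - ip (x - y) (x - y)"
      using that by (simp add: J_def add scale ip_simps ip_sym[of y x] field_simps del: scaleR_add_right)
    with m_le[of "(1/2) *\<^sub>R (x + y)"] that show ?thesis by simp
  qed
  have "\<exists>h\<in>H. (\<lambda>n. ip (s n - h) (s n - h)) \<longlonglongrightarrow> 0"
  proof (rule complete)
    fix e :: real assume "e > 0"
    obtain N :: nat where N: "4 / e < N" using reals_Archimedean2 by blast
    have "ip (s i - s j) (s i - s j) < e" if "i \<ge> N" "j \<ge> N" for i j
    proof -
      have "ip (s i - s j) (s i - s j) \<le> 2 * (1 / Suc i) + 2 * (1 / Suc j)"
        using cau[OF s s, of i j] J_s[of i] J_s[of j] by argo
      also have "\<dots> \<le> 2 * (1 / Suc N) + 2 * (1 / Suc N)"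
        using that by (intro add_mono mult_left_mono divide_left_mono) auto
      also have "\<dots> = 4 / Suc N" by simp
      also have "\<dots> < e" using N \<open>e > 0\<close> by (simp add: field_simps)
      finally show ?thesis .
    qed
    then show "\<exists>N. \<forall>m\<ge>N. \<forall>n\<ge>N. ip (s m - s n) (s m - s n) < e" by blast
  qed (rule s)
  then obtain h where h: "h \<in> H" "(\<lambda>n. ip (s n - h) (s n - h)) \<longlonglongrightarrow> 0" by blast
  have "\<phi> x = ip h x" if x: "x \<in> H" for x
  proof -
    \<comment> \<open>First variation of \<open>J\<close> at the limit. In
      \<open>J (s n + t *\<^sub>R x)\<close> the value \<open>\<phi> (s n)\<close> is absorbed by
      \<open>J (s n)\<close>, so the limit is taken in \<open>ip\<close> only. A nonnegative
      quadratic in \<open>t\<close> without constant term has no linear term.\<close>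
    have "0 \<le> 0 + 2 * t * (ip h x - \<phi> x) + t\<^sup>2 * ip x x" for t
    proof (rule tendsto_lowerbound)
      show "(\<lambda>n. 1 / Suc n + 2 * t * (ip (s n) x - \<phi> x) + t\<^sup>2 * ip x x)
          \<longlonglongrightarrow> 0 + 2 * t * (ip h x - \<phi> x) + t\<^sup>2 * ip x x"
        by (intro tendsto_add tendsto_mult tendsto_diff tendsto_const lim_1_over_n[THEN LIMSEQ_Suc]
            tendsto_ip_left[OF s h(1) x h(2)])
    next
      have "0 \<le> 1 / Suc n + 2 * t * (ip (s n) x - \<phi> x) + t\<^sup>2 * ip x x" for n
      proof -
        have "m \<le> J (s n + t *\<^sub>R x)" using s x by (intro m_le) simp
        also have "\<dots> = J (s n) + 2 * t * (ip (s n) x - \<phi> x) + t\<^sup>2 * ip x x"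
          using s x by (simp add: J_def add scale ip_simps ip_sym[OF x s] power2_eq_square algebra_simps)
        finally show ?thesis using J_s[of n] by linarith
      qed
      then show "\<forall>\<^sub>F n in sequentially. 0 \<le> 1 / Suc n + 2 * t * (ip (s n) x - \<phi> x) + t\<^sup>2 * ip x x"
        by (intro always_eventually) blast
    qed simp
    then have "(ip h x - \<phi> x)\<^sup>2 \<le> 0 * ip x x"
      by (rule nonneg_quadratic_imp_discriminant)
    then show ?thesis by simp
  qed
  with h(1) that show thesis by blast
qed

text \<open>The two bounds make \<open>ip (A x) y\<close> an inner product equivalent to
  \<open>ip\<close>, hence again complete. Representing the functional \<open>ip g\<close> in this
  new inner product solves \<open>A h = g\<close> up to a null vector.\<close>

theorem coercive_surj:
  assumes A_mem: "\<And>x. x \<in> H \<Longrightarrow> A x \<in> H"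
    and A_sym: "\<And>x y. \<lbrakk>x \<in> H; y \<in> H\<rbrakk> \<Longrightarrow> ip (A x) y = ip x (A y)"
    and lower: "\<And>x. x \<in> H \<Longrightarrow> c * ip x x \<le> ip (A x) x"
    and upper: "\<And>x. x \<in> H \<Longrightarrow> ip (A x) x \<le> K * ip x x"
    and "c > 0" "g \<in> H"
  obtains h where "h \<in> H" "ip (A h - g) (A h - g) = 0"
proof -
  interpret A: semi_hilbert H "\<lambda>x y. ip (A x) y"
  proof
    fix s assume s: "\<And>n::nat. s n \<in> H"
      and cau: "\<And>e. e > 0 \<Longrightarrow> \<exists>N. \<forall>m\<ge>N. \<forall>n\<ge>N. ip (A (s m - s n)) (s m - s n) < e"
    have "\<exists>h\<in>H. (\<lambda>n. ip (s n - h) (s n - h)) \<longlonglongrightarrow> 0"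
    proof (rule complete)
      fix e :: real assume "e > 0"
      with cau[of "c * e"] \<open>c > 0\<close>
      obtain N where N: "\<And>m n. m \<ge> N \<Longrightarrow> n \<ge> N \<Longrightarrow> ip (A (s m - s n)) (s m - s n) < c * e" by auto
      have "ip (s m - s n) (s m - s n) < e" if "m \<ge> N" "n \<ge> N" for m n
      proof -
        have "c * ip (s m - s n) (s m - s n) < c * e"
          using lower[of "s m - s n"] N[OF that] s by auto
        then show ?thesis using \<open>c > 0\<close> by simp
      qed
      then show "\<exists>N. \<forall>m\<ge>N. \<forall>n\<ge>N. ip (s m - s n) (s m - s n) < e" by blast
    qed (rule s)
    then obtain h where h: "h \<in> H" "(\<lambda>n. ip (s n - h) (s n - h)) \<longlonglongrightarrow> 0" by blast
    have "(\<lambda>n. ip (A (s n - h)) (s n - h)) \<longlonglongrightarrow> 0"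
    proof (rule tendsto_sandwich[OF _ _ tendsto_const])
      show "(\<lambda>n. K * ip (s n - h) (s n - h)) \<longlonglongrightarrow> 0"
        using tendsto_mult_left[OF h(2), of K] by simp
      show "\<forall>\<^sub>F n in sequentially. 0 \<le> ip (A (s n - h)) (s n - h)"
      proof (rule always_eventually, rule allI)
        fix n
        have "s n - h \<in> H" using s h by simp
        then show "0 \<le> ip (A (s n - h)) (s n - h)"
          using lower[of "s n - h"] \<open>c > 0\<close> ip_nonneg[of "s n - h"] by (meson mult_nonneg_nonneg less_imp_le order_trans)
      qed
    qed (use upper s h in \<open>auto intro!: always_eventually\<close>)
    with h(1) show "\<exists>h\<in>H. (\<lambda>n. ip (A (s n - h)) (s n - h)) \<longlonglongrightarrow> 0" by blast
  next
    fix x assume "x \<in> H"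
    then show "0 \<le> ip (A x) x"
      using lower[of x] \<open>c > 0\<close> ip_nonneg[of x] by (meson mult_nonneg_nonneg less_imp_le order_trans)
  next
    fix x y assume "x \<in> H" "y \<in> H"
    then show "ip (A x) y = ip (A y) x" by (metis A_sym A_mem ip_sym)
  qed (simp_all add: subspace_H A_sym A_mem ip_simps)
  obtain h where h: "h \<in> H" "\<And>x. x \<in> H \<Longrightarrow> ip g x = ip (A h) x"
  proof (rule A.riesz_representation[of "ip g" "ip g g / c"])
    fix x assume x: "x \<in> H"
    have "(ip g x)\<^sup>2 \<le> ip g g / c * (c * ip x x)"
      using Cauchy_Schwarz[OF \<open>g \<in> H\<close> x] \<open>c > 0\<close> by simp
    also have "\<dots> \<le> ip g g / c * ip (A x) x"
      using lower[OF x] \<open>c > 0\<close> ip_nonneg[OF \<open>g \<in> H\<close>] by (intro mult_left_mono) auto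
    finally show "(ip g x)\<^sup>2 \<le> ip g g / c * ip (A x) x" .
  qed (use \<open>g \<in> H\<close> \<open>c > 0\<close> ip_nonneg[OF \<open>g \<in> H\<close>] in \<open>auto simp: ip_simps\<close>)
  have "ip (A h - g) (A h - g) = 0"
    using h A_mem[OF h(1)] \<open>g \<in> H\<close> by (simp add: ip_diff)
  with h(1) that show thesis by blast
qed

end

section \<open>Positive contractions: resolvents outside the unit interval and the effect of a gap
  below 1\<close>

locale positive_contraction = semi_hilbert +
  fixes T
  assumes T_mem [simp]: "x \<in> H \<Longrightarrow> T x \<in> H"
    and T_sym: "\<lbrakk>x \<in> H; y \<in> H\<rbrakk> \<Longrightarrow> ip (T x) y = ip x (T y)"
    and T_nonneg: "x \<in> H \<Longrightarrow> 0 \<le> ip (T x) x"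
    and T_le: "x \<in> H \<Longrightarrow> ip (T x) x \<le> ip x x"
begin

text \<open>Linearity of \<open>T\<close> is obtained weakly: \<open>T_sym\<close> moves
  \<open>T\<close> to the other argument, where \<open>ip\<close> is linear. This is the right
  notion for adjoints, which are chosen for each argument separately and so are linear only almost
  everywhere.\<close>

lemma T_form: "semi_inner H (\<lambda>x y. ip (T x) y)"
proof
  fix x y assume "x \<in> H" "y \<in> H"
  then show "ip (T x) y = ip (T y) x" by (metis T_sym T_mem ip_sym)
qed (simp_all add: subspace_H T_nonneg, simp_all add: T_sym ip_simps)

text \<open>Cauchy-Schwarz in the form of \<open>T\<close>, applied to \<open>x\<close> and
  \<open>T x\<close>, followed by division by the squared norm of \<open>T x\<close>. With
  \<open>q = 1\<close> it shows that \<open>T\<close> contracts; with \<open>q = a\<close> it gives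
  the decay on the range of \<open>1 - T\<close>.\<close>

lemma T_norm_le_form:
  assumes "x \<in> H" "q \<ge> 0" "ip (T (T x)) (T x) \<le> q * ip (T x) (T x)"
  shows "ip (T x) (T x) \<le> q * ip (T x) x"
proof -
  interpret T: semi_inner H "\<lambda>x y. ip (T x) y" by (rule T_form)
  have "(ip (T x) (T x))\<^sup>2 \<le> ip (T x) x * ip (T (T x)) (T x)"
    using T.Cauchy_Schwarz[of x "T x"] assms by simp
  also have "\<dots> \<le> ip (T x) x * (q * ip (T x) (T x))"
    using assms by (intro mult_left_mono T_nonneg)
  finally have "ip (T x) (T x) * ip (T x) (T x) \<le> (q * ip (T x) x) * ip (T x) (T x)"
    by (simp add: power2_eq_square mult_ac)
  moreover have "ip (T x) (T x) \<ge> 0" "q * ip (T x) x \<ge> 0" using assms by (simp_all add: ip_nonneg T_nonneg)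
  ultimately show ?thesis by (metis mult_right_le_imp_le order_le_less)
qed

lemma T_contraction: "x \<in> H \<Longrightarrow> ip (T x) (T x) \<le> ip x x"
  using T_norm_le_form[of x 1] T_le[of "T x"] T_le[of x] by simp

text \<open>Since \<open>T\<close> lies between 0 and 1 as a form, \<open>z - T\<close> or its
  negative is coercive, with the distance from \<open>z\<close> to the unit interval as
  constant.\<close>

lemma resolvent_exists:
  assumes "z < 0 \<or> z > 1" "g \<in> H"
  obtains h where "h \<in> H" "ip (z *\<^sub>R h - T h - g) (z *\<^sub>R h - T h - g) = 0"
proof (cases "z < 0")
  case True
  \<comment> \<open>For \<open>z < 0\<close> the coercive operator is \<open>T - z\<close>, so the
    equation is solved with the right hand side negated.\<close>
  obtain h where h: "h \<in> H" "ip (T h - z *\<^sub>R h - (-1) *\<^sub>R g) (T h - z *\<^sub>R h - (-1) *\<^sub>R g) = 0"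
  proof (rule coercive_surj[of "\<lambda>x. T x - z *\<^sub>R x" "- z" "1 - z" "(-1) *\<^sub>R g"])
    fix x y assume x: "x \<in> H"
    show "- z * ip x x \<le> ip (T x - z *\<^sub>R x) x"
      using x T_nonneg[OF x] by (simp add: ip_simps)
    show "ip (T x - z *\<^sub>R x) x \<le> (1 - z) * ip x x"
      using x T_le[OF x] by (simp add: ip_simps algebra_simps)
  next
    fix x y assume "x \<in> H" "y \<in> H"
    then show "ip (T x - z *\<^sub>R x) y = ip x (T y - z *\<^sub>R y)" by (simp add: ip_simps T_sym)
  qed (use True assms in \<open>simp_all del: scaleR_minus1_left\<close>)
  have "z *\<^sub>R h - T h - g = (-1) *\<^sub>R (T h - z *\<^sub>R h - (-1) *\<^sub>R g)" by simp
  moreover have "ip (- 1 *\<^sub>R (T h - z *\<^sub>R h - (-1) *\<^sub>R g)) (- 1 *\<^sub>R (T h - z *\<^sub>R h - (-1) *\<^sub>R g)) = 0"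
    using h assms(2) ip_minus_minus[of "T h - z *\<^sub>R h + g"] by simp
  ultimately show ?thesis using that[OF h(1)] by simp
next
  case False
  with assms have z: "z > 1" by simp
  obtain h where h: "h \<in> H" "ip (z *\<^sub>R h - T h - g) (z *\<^sub>R h - T h - g) = 0"
  proof (rule coercive_surj[of "\<lambda>x. z *\<^sub>R x - T x" "z - 1" "z" g])
    fix x y assume x: "x \<in> H"
    show "(z - 1) * ip x x \<le> ip (z *\<^sub>R x - T x) x"
      using x T_le[OF x] by (simp add: ip_simps algebra_simps)
    show "ip (z *\<^sub>R x - T x) x \<le> z * ip x x"
      using x T_nonneg[OF x] by (simp add: ip_simps)
  next
    fix x y assume "x \<in> H" "y \<in> H"
    then show "ip (z *\<^sub>R x - T x) y = ip x (z *\<^sub>R y - T y)" by (simp add: ip_simps T_sym)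
  qed (use z assms in \<open>simp_all\<close>)
  then show ?thesis by (rule that)
qed

lemma resolvent_bound:
  assumes "z < 0 \<or> z > 1"
  obtains B where "B > 0" "\<And>x. x \<in> H \<Longrightarrow> nrm x \<le> B * nrm (z *\<^sub>R x - T x)"
proof -
  define d where "d = (if z < 0 then - z else z - 1)"
  have d: "d > 0" using assms by (auto simp: d_def)
  have "nrm x \<le> 1 / d * nrm (z *\<^sub>R x - T x)" if x: "x \<in> H" for x
  proof (cases "nrm x = 0")
    case False
    have "d * (nrm x)\<^sup>2 \<le> \<bar>ip (z *\<^sub>R x - T x) x\<bar>"
      using x T_nonneg[OF x] T_le[OF x] assms ip_nonneg[OF x]
      by (auto simp: nrm_sq ip_simps d_def algebra_simps split: if_splits)
    also have "\<dots> \<le> nrm (z *\<^sub>R x - T x) * nrm x"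
      using x by (intro ip_le_nrm) auto
    finally have "d * nrm x \<le> nrm (z *\<^sub>R x - T x)"
      using False x nrm_nonneg[OF x] by (simp add: power2_eq_square)
    then show ?thesis using d by (simp add: field_simps)
  qed (use d x in simp)
  with that[of "1 / d"] d show thesis by simp
qed

lemma resolvent_inj:
  assumes "z < 0 \<or> z > 1" "x \<in> H" "\<And>v. v \<in> H \<Longrightarrow> ip (z *\<^sub>R x - T x) v = 0"
  shows "ip x x = 0"
proof -
  obtain B where "\<And>x. x \<in> H \<Longrightarrow> nrm x \<le> B * nrm (z *\<^sub>R x - T x)"
    using resolvent_bound[OF assms(1)] by blast
  from this[OF assms(2)] have "nrm x \<le> 0" using assms by (simp add: nrm_def)
  then show ?thesis using nrm_nonneg[OF assms(2)] nrm_sq[OF assms(2)] by simp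
qed

text \<open>
  Let \<open>c\<close> be the midpoint and \<open>d\<close> half the length of \<open>(a, 1)\<close>; the claim is \<open>(T - c)\<^sup>2 \<ge> d\<^sup>2\<close>.  If
  the largest \<open>m\<close> with \<open>(T - c)\<^sup>2 \<ge> m\<close> were less than \<open>d\<^sup>2\<close>, the factors of
  \<open>(T - c)\<^sup>2 - m = (T - (c + \<surd>m)) (T - (c - \<surd>m))\<close> would be bounded below, and \<open>m\<close> could be increased.
\<close>

lemma quadratic_nonneg_of_spectral_gap:
  assumes "0 \<le> a" "a < 1" "x \<in> H"
    and res: "\<And>s. \<lbrakk>a < s; s < 1\<rbrakk> \<Longrightarrow> \<exists>B. \<forall>x\<in>H. nrm x \<le> B * nrm (s *\<^sub>R x - T x)"
  shows "0 \<le> ip (T x) (T x) - (1 + a) * ip (T x) x + a * ip x x"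
proof -
  define c where "c = (1 + a) / 2"
  define d where "d = (1 - a) / 2"
  have cd: "c - d = a" "c + d = 1" "d > 0" "c \<ge> 0" "c \<le> 1"
    using assms by (auto simp: c_def d_def field_simps)
  define S where "S x = T x - c *\<^sub>R x" for x
  have S_mem [simp]: "S x \<in> H" if "x \<in> H" for x using that by (simp add: S_def)
  have ipS: "ip (S x) (S v) = ip (T x) (T v) - 2 * c * ip (T x) v + c\<^sup>2 * ip x v"
    if "x \<in> H" "v \<in> H" for x v
    using that by (simp add: S_def ip_simps T_sym power2_eq_square algebra_simps)
  \<comment> \<open>Only nonnegative bounds are collected, so that the supremum \<open>m\<close> has
    a real root \<open>e\<close>, and \<open>e < d\<close> places \<open>c - e\<close> and
    \<open>c + e\<close> strictly between \<open>a\<close> and 1, where \<open>res\<close>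
    applies.\<close>
  define D where "D = {q. 0 \<le> q \<and> (\<forall>x\<in>H. q * ip x x \<le> ip (S x) (S x))}"
  have "d\<^sup>2 \<in> D"
  proof (rule ccontr)
    assume nin: "d\<^sup>2 \<notin> D"
    have lt: "q < d\<^sup>2" if "q \<in> D" for q
    proof (rule ccontr)
      assume "\<not> q < d\<^sup>2"
      then have "d\<^sup>2 * ip x x \<le> ip (S x) (S x)" if "x \<in> H" for x
        using \<open>q \<in> D\<close> that mult_right_mono[of "d\<^sup>2" q "ip x x"] ip_nonneg[OF that]
        by (force simp: D_def)
      with nin show False by (simp add: D_def)
    qed
    have D0: "0 \<in> D" by (simp add: D_def ip_nonneg)
    have bdd: "bdd_above D" using lt by (meson bdd_above.I less_imp_le)
    define m where "m = Sup D"
    have m0: "m \<ge> 0" unfolding m_def using D0 bdd by (rule cSup_upper)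
    have mS: "m * ip x x \<le> ip (S x) (S x)" if x: "x \<in> H" for x
    proof (cases "ip x x = 0")
      case True
      then show ?thesis using x by (simp add: ip_nonneg)
    next
      case False
      with ip_nonneg[OF x] have pos: "ip x x > 0" by simp
      have "m \<le> ip (S x) (S x) / ip x x"
        unfolding m_def
      proof (rule cSup_least)
        fix q assume "q \<in> D"
        then have "q * ip x x \<le> ip (S x) (S x)" using x by (simp add: D_def)
        then show "q \<le> ip (S x) (S x) / ip x x" using pos by (simp add: field_simps)
      qed (use D0 in blast)
      then show ?thesis using pos by (simp add: field_simps)
    qed
    have mD: "m \<in> D" using m0 mS by (simp add: D_def)
    define e where "e = sqrt m"
    have e: "0 \<le> e" "e\<^sup>2 = m" "e < d"
      using m0 lt[OF mD] cd(3) by (auto simp: e_def intro: real_less_lsqrt)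
    obtain B1 where B1: "\<And>x. x \<in> H \<Longrightarrow> nrm x \<le> B1 * nrm ((c + e) *\<^sub>R x - T x)"
      using res[of "c + e"] e cd by auto
    obtain B2 where B2: "\<And>x. x \<in> H \<Longrightarrow> nrm x \<le> B2 * nrm ((c - e) *\<^sub>R x - T x)"
      using res[of "c - e"] e cd by auto
    define b where "b x y = ip (S x) (S y) - m * ip x y" for x y
    interpret b: semi_inner H b
    proof
      fix x y z and k :: real assume xyz: "x \<in> H" "y \<in> H" "z \<in> H"
      then show "b (x + y) z = b x z + b y z" "b (k *\<^sub>R x) z = k * b x z"
        by (simp_all add: b_def ipS T_sym ip_simps algebra_simps)
      show "b x y = b y x" using xyz by (simp add: b_def ip_sym)
      show "0 \<le> b x x" using mS[OF xyz(1)] by (simp add: b_def)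
    qed (rule subspace_H)
    \<comment> \<open>The summand 1 only keeps \<open>K\<close> positive; \<open>m\<close> is going
      to be raised by \<open>1 / K\<close>.\<close>
    define K where "K = 1 + (\<bar>B2\<bar> * \<bar>B1\<bar>)\<^sup>2 * 2"
    have "K \<ge> 1" by (simp add: K_def)
    have K: "ip x x \<le> K * b x x" if x: "x \<in> H" for x
    proof -
      define y where "y = (c - e) *\<^sub>R x - T x"
      define w where "w = (c + e) *\<^sub>R y - T y"
      have yw [simp]: "y \<in> H" "w \<in> H" using x by (simp_all add: y_def w_def)
      \<comment> \<open>\<open>w\<close> is \<open>(c + e - T) (c - e - T) x\<close> and therefore
        represents \<open>b x\<close>. The identity is checked against test vectors because
        \<open>T\<close> is linear only weakly.\<close>
      have wv: "ip w v = b x v" if v: "v \<in> H" for v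
      proof -
        have yv: "ip y v = (c - e) * ip x v - ip (T x) v"
          using x v by (simp add: y_def ip_simps)
        have "ip (T y) v = ip y (T v)" using v by (simp add: T_sym)
        also have "\<dots> = (c - e) * ip (T x) v - ip (T x) (T v)"
          using x v by (simp add: y_def ip_simps T_sym)
        finally have "ip w v = (c + e) * ((c - e) * ip x v - ip (T x) v) - ((c - e) * ip (T x) v - ip (T x) (T v))"
          using v yv by (simp add: w_def ip_simps)
        also have "\<dots> = b x v"
          using x v by (simp add: b_def ipS power2_eq_square algebra_simps flip: e(2))
        finally show ?thesis .
      qed
      have "nrm x \<le> \<bar>B2\<bar> * nrm y"
        using B2[OF x] mult_right_mono[OF abs_ge_self, of "nrm y" B2] by (simp flip: y_def)
      also have "\<dots> \<le> \<bar>B2\<bar> * (\<bar>B1\<bar> * nrm w)"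
        using B1[of y] mult_right_mono[OF abs_ge_self, of "nrm w" B1]
        by (intro mult_left_mono) (simp_all flip: w_def)
      finally have "(nrm x)\<^sup>2 \<le> (\<bar>B2\<bar> * \<bar>B1\<bar> * nrm w)\<^sup>2"
        using x by (intro power_mono) (simp_all add: mult.assoc)
      then have xw: "ip x x \<le> (\<bar>B2\<bar> * \<bar>B1\<bar>)\<^sup>2 * ip w w"
        using x by (simp add: nrm_sq power_mult_distrib)
      have "b w w \<le> (1 + c\<^sup>2) * ip w w"
        using T_contraction[of w] mult_nonneg_nonneg[OF m0 ip_nonneg[of w]]
          mult_nonneg_nonneg[OF cd(4) T_nonneg[of w]]
        by (simp add: b_def ipS algebra_simps)
      also have "\<dots> \<le> 2 * ip w w"
        using cd(4,5) by (intro mult_right_mono ip_nonneg) (simp_all add: power_le_one)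
      finally have bww: "b w w \<le> 2 * ip w w" .
      \<comment> \<open>The resolvent bounds compare \<open>x\<close> with \<open>w\<close>, but
        \<open>b x x\<close> is needed instead of the norm of \<open>w\<close>. Cauchy-Schwarz for
        \<open>b\<close> makes the exchange, as \<open>b x w\<close> is the squared norm of
        \<open>w\<close> and \<open>b w w\<close> is at most twice that.\<close>
      have "ip w w * ip w w \<le> b x x * b w w"
        using b.Cauchy_Schwarz[OF x yw(2)] wv[OF yw(2)] by (simp add: power2_eq_square)
      also have "\<dots> \<le> b x x * (2 * ip w w)"
        using bww b.ip_nonneg[OF x] by (rule mult_left_mono)
      finally have "ip w w * ip w w \<le> (2 * b x x) * ip w w" by (simp add: mult_ac)
      then have "ip w w \<le> 2 * b x x"
        using ip_nonneg[OF yw(2)] b.ip_nonneg[OF x]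
        by (cases "ip w w = 0") auto
      then have "ip x x \<le> (\<bar>B2\<bar> * \<bar>B1\<bar>)\<^sup>2 * (2 * b x x)"
        using xw by (meson mult_left_mono order_trans zero_le_power2)
      also have "\<dots> \<le> K * b x x"
        using b.ip_nonneg[OF x] by (simp add: K_def algebra_simps)
      finally show ?thesis .
    qed
    have "m + 1 / K \<in> D"
    proof -
      have "(m + 1 / K) * ip x x \<le> ip (S x) (S x)" if "x \<in> H" for x
        using K[OF that] \<open>K \<ge> 1\<close> by (simp add: b_def field_simps)
      then show ?thesis using m0 \<open>K \<ge> 1\<close> by (simp add: D_def)
    qed
    then have "m + 1 / K \<le> m"
      unfolding m_def using bdd by (rule cSup_upper)
    then show False using \<open>K \<ge> 1\<close> by simp
  qed
  then have "d\<^sup>2 * ip x x \<le> ip (S x) (S x)" using \<open>x \<in> H\<close> by (simp add: D_def)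
  \<comment> \<open>Since also \<open>2 * c = 1 + a\<close>, the bound (T - c)^2 \<ge> d^2 is
    nonnegativity of (1 - T) (a - T).\<close>
  moreover have "c\<^sup>2 - d\<^sup>2 = a"
    by (simp add: c_def d_def power2_eq_square field_simps)
  then have "c\<^sup>2 * ip x x = d\<^sup>2 * ip x x + a * ip x x" by (simp add: algebra_simps flip: distrib_right)
  ultimately show ?thesis
    using \<open>x \<in> H\<close> cd(1,2) by (simp add: ipS) (simp add: c_def field_simps)
qed

text \<open>
  The previous lemma gives \<open>T \<le> a\<close> on the range of \<open>1 - T\<close>.  Hence \<open>(T ^^ n) x\<close> converges, its
  limit is fixed by \<open>T\<close> and so vanishes, and \<open>x - (T ^^ n) x\<close>, which lies in that range, tends to \<open>x\<close>.
\<close>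

theorem form_le_of_spectral_gap:
  assumes a: "0 \<le> a" "a < 1" and x: "x \<in> H"
    and res: "\<And>s. \<lbrakk>a < s; s < 1\<rbrakk> \<Longrightarrow> \<exists>B. \<forall>x\<in>H. nrm x \<le> B * nrm (s *\<^sub>R x - T x)"
    and inj: "\<And>x. \<lbrakk>x \<in> H; ip (T x - x) (T x - x) = 0\<rbrakk> \<Longrightarrow> ip x x = 0"
  shows "ip (T x) x \<le> a * ip x x"
proof -
  define C where "C x = x - T x" for x
  have C_mem [simp]: "C x \<in> H" if "x \<in> H" for x using that by (simp add: C_def)
  have C_sym: "ip (C x) y = ip x (C y)" if "x \<in> H" "y \<in> H" for x y
    using that by (simp add: C_def ip_simps T_sym)
  interpret C: semi_inner H "\<lambda>x y. ip (C x) y"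
  proof
    fix x y assume "x \<in> H" "y \<in> H"
    then show "ip (C x) y = ip (C y) x" by (metis C_sym C_mem ip_sym)
  next
    fix x assume "x \<in> H"
    then show "0 \<le> ip (C x) x" using T_le[of x] by (simp add: C_def ip_simps)
  qed (simp_all add: subspace_H C_sym ip_simps)
  \<comment> \<open>In terms of \<open>C = 1 - T\<close>, the preceding lemma says (1 - a) C \<le>
    C^2. Cauchy-Schwarz in the form of \<open>C\<close> carries this from \<open>u\<close> to
    \<open>C u\<close>, where it becomes a lower bound for \<open>C\<close> itself.\<close>
  have range_form: "ip (T (C u)) (C u) \<le> a * ip (C u) (C u)" if u: "u \<in> H" for u
  proof -
    define y where "y = C u"
    have y: "y \<in> H" using u by (simp add: y_def)
    have "(1 - a) * ip (C u) u \<le> ip y y"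
      using quadratic_nonneg_of_spectral_gap[OF a u res] u
      by (simp add: y_def C_def ip_simps T_sym algebra_simps)
    moreover have "(ip y y)\<^sup>2 \<le> ip (C u) u * ip (C y) y"
      using C.Cauchy_Schwarz[OF u y] by (simp add: y_def)
    ultimately have "(1 - a) * (ip y y)\<^sup>2 \<le> (1 - a) * (ip (C u) u * ip (C y) y)"
      and "(1 - a) * ip (C u) u * ip (C y) y \<le> ip y y * ip (C y) y"
      using C.ip_nonneg[OF y] a by (simp_all add: mult_left_mono mult_right_mono)
    then have "(1 - a) * (ip y y)\<^sup>2 \<le> ip y y * ip (C y) y" by simp
    then have "(1 - a) * ip y y \<le> ip (C y) y"
      using ip_nonneg[OF y] C.ip_nonneg[OF y]
      by (cases "ip y y = 0") (auto simp: power2_eq_square mult.left_commute)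
    then show ?thesis using y by (simp add: C_def[of y] ip_simps algebra_simps flip: y_def)
  qed
  have weak: "ip (T (C u)) v = ip (C (T u)) v" if "u \<in> H" "v \<in> H" for u v
    using that by (simp add: C_def ip_simps T_sym)
  \<comment> \<open>\<open>T (C u)\<close> and \<open>C (T u)\<close> represent the same element but
    may differ as vectors, so quantities are carried from one to the other by testing. The second
    form shows membership in the range of \<open>C\<close>, on which \<open>range_form\<close>
    holds.\<close>
  have range_contr: "ip (C (T u)) (C (T u)) \<le> a\<^sup>2 * ip (C u) (C u)" if u: "u \<in> H" for u
  proof -
    define z where "z = T (C u)"
    define z' where "z' = C (T u)"
    have z: "z \<in> H" "z' \<in> H" using u by (simp_all add: z_def z'_def)
    have zv: "ip z v = ip z' v" if "v \<in> H" for v using weak[OF u that] by (simp add: z_def z'_def)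
    have zz: "ip z z = ip z' z'" using zv[OF z(1)] zv[OF z(2)] z ip_sym by simp
    have "ip (T z) z = ip (T z') z'"
      using z zv[of "T z"] zv[of "T z'"] by (metis T_mem T_sym ip_sym)
    also have "\<dots> \<le> a * ip z z" using range_form[of "T u"] u zz by (simp add: z'_def)
    finally have "ip z z \<le> a * ip (T (C u)) (C u)"
      using T_norm_le_form[of "C u" a] u a by (simp add: z_def)
    also have "\<dots> \<le> a * (a * ip (C u) (C u))" using range_form[OF u] a by (intro mult_left_mono)
    finally show ?thesis using zz by (simp add: z'_def power2_eq_square mult.assoc)
  qed
  define t where "t n = (T ^^ n) x" for n
  have t_mem [simp]: "t n \<in> H" for n by (induction n) (simp_all add: t_def x)
  have t_Suc: "t (Suc n) = T (t n)" for n by (simp add: t_def)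
  define r where "r = nrm (C x)"
  have step: "nrm (C (t n)) \<le> a ^ n * r" for n
  proof (induction n)
    case (Suc n)
    have "nrm (C (t (Suc n))) \<le> sqrt (a\<^sup>2 * ip (C (t n)) (C (t n)))"
      using range_contr[OF t_mem, of n] by (simp add: nrm_def t_Suc)
    also have "\<dots> = a * nrm (C (t n))" using a by (simp add: nrm_def real_sqrt_mult)
    also have "\<dots> \<le> a * (a ^ n * r)" using Suc a by (intro mult_left_mono)
    finally show ?case by simp
  qed (simp add: r_def t_def)
  \<comment> \<open>The increments \<open>C (t n)\<close> decay geometrically; the right hand side
    is their exact geometric sum, which lets the induction close.\<close>
  have tail: "nrm (t m - t (m + k)) \<le> r * (a ^ m - a ^ (m + k)) / (1 - a)" for m k
  proof (induction k)
    case 0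
    then show ?case using nrm_def ip_diff[OF t_mem[of m] t_mem[of m], of "t m - t m"] by simp
  next
    case (Suc k)
    have "nrm (t m - t (m + Suc k)) = nrm ((t m - t (m + k)) + C (t (m + k)))"
      by (simp add: C_def t_Suc)
    also have "\<dots> \<le> nrm (t m - t (m + k)) + nrm (C (t (m + k)))"
      by (intro nrm_triangle) simp_all
    also have "\<dots> \<le> r * (a ^ m - a ^ (m + k)) / (1 - a) + a ^ (m + k) * r"
      by (intro add_mono Suc step)
    also have "\<dots> = r * (a ^ m - a ^ (m + Suc k)) / (1 - a)"
      using a by (simp add: field_simps)
    finally show ?case .
  qed
  have r0: "r \<ge> 0" using x by (simp add: r_def)
  have tail': "nrm (t m - t (m + k)) \<le> r * a ^ m / (1 - a)" for m k
  proof -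
    have "r * (a ^ m - a ^ (m + k)) \<le> r * a ^ m" using r0 a by (intro mult_left_mono) auto
    then show ?thesis using tail[of m k] a by (meson divide_right_mono diff_ge_0_iff_ge less_imp_le order_trans)
  qed
  have "\<exists>h\<in>H. (\<lambda>n. ip (t n - h) (t n - h)) \<longlonglongrightarrow> 0"
  proof (rule complete)
    fix e :: real assume "e > 0"
    have "(\<lambda>m. 2 * (r * a ^ m / (1 - a))) \<longlonglongrightarrow> 2 * (r * 0 / (1 - a))"
      using a by (intro tendsto_intros LIMSEQ_realpow_zero) auto
    then have "\<forall>\<^sub>F m in sequentially. 2 * (r * a ^ m / (1 - a)) < sqrt e"
      using \<open>e > 0\<close> by (intro order_tendstoD(2)) auto
    then obtain N where N: "2 * (r * a ^ N / (1 - a)) < sqrt e"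
      by (auto simp: eventually_sequentially)
    have "ip (t m - t n) (t m - t n) < e" if "m \<ge> N" "n \<ge> N" for m n
    proof -
      have "nrm (t m - t n) = nrm ((t m - t N) + (t N - t n))" by simp
      also have "\<dots> \<le> nrm (t m - t N) + nrm (t N - t n)" by (intro nrm_triangle) simp_all
      also have "\<dots> = nrm (t N - t (N + (m - N))) + nrm (t N - t (N + (n - N)))"
        using that by (simp add: nrm_minus_commute[of "t m"])
      also have "\<dots> < sqrt e" using tail'[of N "m - N"] tail'[of N "n - N"] N by argo
      finally show ?thesis by (simp add: nrm_def)
    qed
    then show "\<exists>N. \<forall>m\<ge>N. \<forall>n\<ge>N. ip (t m - t n) (t m - t n) < e" by blast
  qed simp
  then obtain h where h: "h \<in> H" and lim: "(\<lambda>n. ip (t n - h) (t n - h)) \<longlonglongrightarrow> 0" by blast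
  have lim_v: "(\<lambda>n. ip (t n) v) \<longlonglongrightarrow> ip h v" if "v \<in> H" for v
    by (rule tendsto_ip_left[OF t_mem h that lim])
  have T_fix: "ip (T h) v = ip h v" if v: "v \<in> H" for v
  proof (rule LIMSEQ_unique)
    have "(\<lambda>n. ip (t n) (T v)) \<longlonglongrightarrow> ip h (T v)" using v by (intro lim_v) simp
    then show "(\<lambda>n. ip (t (Suc n)) v) \<longlonglongrightarrow> ip (T h) v" using v h by (simp add: t_Suc T_sym)
    show "(\<lambda>n. ip (t (Suc n)) v) \<longlonglongrightarrow> ip h v" using lim_v[OF v] by (rule LIMSEQ_Suc)
  qed
  have hh: "ip h h = 0" using h T_fix by (intro inj[OF h]) (simp_all add: ip_simps)
  have h0: "ip h v = 0" "ip v h = 0" if "v \<in> H" for v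
    using ip_eq_0[OF h that hh] ip_sym[OF h that] by simp_all
  have lim_0: "(\<lambda>n. ip (t n) v) \<longlonglongrightarrow> 0" if "v \<in> H" for v using lim_v[OF that] h0[OF that] by simp
  have lim_q: "(\<lambda>n. ip (t n) (t n)) \<longlonglongrightarrow> 0" using lim h by (simp add: ip_simps h0)
  \<comment> \<open>Partial sums of the Neumann series: applying \<open>C\<close> to them telescopes
    to \<open>x - t n\<close>, which places this difference in the range of
    \<open>C\<close>.\<close>
  define g where "g n = (\<Sum>i<n. t i)" for n
  have g_mem [simp]: "g n \<in> H" for n by (induction n) (simp_all add: g_def)
  have g: "ip (C (g n)) v = ip (x - t n) v" if v: "v \<in> H" for n v
  proof (induction n)
    case 0
    then show ?case using v by (simp add: g_def t_def C_sym) (metis H_mem(1) C_mem ip_diff diff_self)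
  next
    case (Suc n)
    have "ip (C (g (Suc n))) v = ip (C (g n)) v + ip (C (t n)) v"
      using v by (simp add: C_sym g_def[of "Suc n"] ip_simps flip: g_def)
    then show ?case using Suc v x by (simp add: ip_simps C_def t_Suc)
  qed
  \<comment> \<open>This is \<open>range_form\<close> for \<open>x - t n\<close>, expanded, without
    the nonnegative term \<open>ip (T (t n)) (t n)\<close>. Every term that still contains
    \<open>t n\<close> vanishes in the limit.\<close>
  have "ip (T x) x - 2 * ip (t n) (T x) \<le> a * (ip x x - 2 * ip (t n) x + ip (t n) (t n))" for n
  proof -
    define y where "y = x - t n"
    have y: "y \<in> H" using x by (simp add: y_def)
    have gy: "ip (C (g n)) v = ip y v" "ip v (C (g n)) = ip v y" if "v \<in> H" for v
      using g[OF that, of n] ip_sym[OF that y] ip_sym[OF that, of "C (g n)"] by (simp_all add: y_def)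
    have "ip (T y) y = ip (T (C (g n))) (C (g n))"
      using y by (simp add: gy) (simp add: T_sym gy)
    also have "\<dots> \<le> a * ip y y"
      using range_form[of "g n"] y by (simp add: gy)
    finally have "ip (T y) y \<le> a * ip y y" .
    moreover have "ip (T y) y = ip (T x) x - 2 * ip (t n) (T x) + ip (T (t n)) (t n)"
      using x by (simp add: y_def T_sym ip_simps ip_sym[of x "T (t n)"])
    moreover have "ip y y = ip x x - 2 * ip (t n) x + ip (t n) (t n)"
      using x by (simp add: y_def ip_simps ip_sym[of x "t n"])
    ultimately show ?thesis using T_nonneg[OF t_mem, of n] by simp
  qed
  moreover have "(\<lambda>n. ip (T x) x - 2 * ip (t n) (T x)) \<longlonglongrightarrow> ip (T x) x - 2 * 0"
    using x by (intro tendsto_intros lim_0) simp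
  moreover have "(\<lambda>n. a * (ip x x - 2 * ip (t n) x + ip (t n) (t n))) \<longlonglongrightarrow> a * (ip x x - 2 * 0 + 0)"
    using x by (intro tendsto_intros lim_0 lim_q)
  ultimately have "ip (T x) x - 2 * 0 \<le> a * (ip x x - 2 * 0 + 0)"
    by (intro tendsto_le[OF sequentially_bot]) (auto intro: always_eventually)
  then show ?thesis by simp
qed

end

section \<open>The Hilbert space of square integrable functions\<close>

instantiation "fun" :: (type, real_vector) real_vector
begin

definition "c *\<^sub>R f = (\<lambda>x. c *\<^sub>R f x)"

instance
  by standard (simp_all add: scaleR_fun_def fun_eq_iff algebra_simps)

end

lemma scaleR_fun_apply [simp]: "(c *\<^sub>R f) x = c *\<^sub>R f x"
  by (simp add: scaleR_fun_def)

text \<open>The real part turns complex \<open>L2\<close> into a real semi-Hilbert space with the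
  same norm, in which complex symmetric operators stay symmetric. Imaginary parts are recovered by
  multiplying an argument by \<i>.\<close>

abbreviation L2_ip :: "'a measure \<Rightarrow> ('a \<Rightarrow> complex) \<Rightarrow> ('a \<Rightarrow> complex) \<Rightarrow> real" where
  "L2_ip M f g \<equiv> Re (L2_inner M f g)"

lemma L2_measurable [measurable_dest]: "f \<in> L2 M \<Longrightarrow> f \<in> borel_measurable M"
  by (simp add: L2_def)

lemma L2_integrable_sq: "f \<in> L2 M \<Longrightarrow> integrable M (\<lambda>x. (norm (f x))\<^sup>2)"
  by (simp add: L2_def)

lemma L2_memI:
  assumes "f \<in> borel_measurable M" "integrable M g" "\<And>x. (norm (f x))\<^sup>2 \<le> g x"
  shows "f \<in> L2 M"
proof -
  have "norm (norm (f x) ^ 2) \<le> norm (g x)" for x using assms(3)[of x] by simp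
  then have "integrable M (\<lambda>x. (norm (f x))\<^sup>2)"
    by (intro Bochner_Integration.integrable_bound[OF assms(2)]) (use assms(1) in auto)
  then show ?thesis using assms(1) by (simp add: L2_def)
qed

lemma L2_inner_integrable:
  fixes f g :: "'a \<Rightarrow> complex"
  assumes "f \<in> L2 M" "g \<in> L2 M"
  shows "integrable M (\<lambda>x. f x * cnj (g x))"
proof (rule Bochner_Integration.integrable_bound)
  show "integrable M (\<lambda>x. (norm (f x))\<^sup>2 + (norm (g x))\<^sup>2)"
    using assms by (simp add: L2_integrable_sq)
  have "norm (f x * cnj (g x)) \<le> norm ((norm (f x))\<^sup>2 + (norm (g x))\<^sup>2)" for x
    using sum_squares_bound[of "norm (f x)" "norm (g x)"]
      mult_nonneg_nonneg[OF norm_ge_zero norm_ge_zero, of "f x" "g x"]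
    unfolding norm_mult complex_mod_cnj real_norm_def by linarith
  then show "AE x in M. norm (f x * cnj (g x)) \<le> norm ((norm (f x))\<^sup>2 + (norm (g x))\<^sup>2)"
    by simp
  have [measurable]: "f \<in> borel_measurable M" "g \<in> borel_measurable M"
    using assms by (auto dest: L2_measurable)
  have [measurable]: "cnj \<in> borel_measurable borel"
    by (intro borel_measurable_continuous_onI continuous_intros)
  show "(\<lambda>x. f x * cnj (g x)) \<in> borel_measurable M" by measurable
qed

lemma norm_add_sq_le:
  fixes a b :: "'a::real_normed_vector"
  shows "(norm (a + b))\<^sup>2 \<le> 2 * (norm a)\<^sup>2 + 2 * (norm b)\<^sup>2"
proof -
  have "(norm (a + b))\<^sup>2 \<le> (norm a + norm b)\<^sup>2"
    by (intro power_mono norm_triangle_ineq norm_ge_zero)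
  also have "\<dots> \<le> 2 * (norm a)\<^sup>2 + 2 * (norm b)\<^sup>2"
    using sum_squares_bound[of "norm a" "norm b"] by (simp add: power2_sum)
  finally show ?thesis .
qed

lemma L2_add:
  fixes f g :: "'a \<Rightarrow> complex"
  assumes "f \<in> L2 M" "g \<in> L2 M"
  shows "f + g \<in> L2 M"
proof (rule L2_memI)
  show "integrable M (\<lambda>x. 2 * (norm (f x))\<^sup>2 + 2 * (norm (g x))\<^sup>2)"
    using assms by (simp add: L2_integrable_sq)
  have [measurable]: "f \<in> borel_measurable M" "g \<in> borel_measurable M"
    using assms by (auto dest: L2_measurable)
  show "f + g \<in> borel_measurable M" unfolding plus_fun_def by measurable
qed (simp add: norm_add_sq_le)

lemma L2_cmult:
  fixes f :: "'a \<Rightarrow> complex"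
  assumes "f \<in> L2 M"
  shows "(\<lambda>x. c * f x) \<in> L2 M"
proof (rule L2_memI)
  show "integrable M (\<lambda>x. (norm c)\<^sup>2 * (norm (f x))\<^sup>2)"
    using assms by (simp add: L2_integrable_sq)
  have [measurable]: "f \<in> borel_measurable M" using assms by (auto dest: L2_measurable)
  show "(\<lambda>x. c * f x) \<in> borel_measurable M" by measurable
qed (simp add: norm_mult power_mult_distrib)

lemma L2_scaleR: "f \<in> L2 M \<Longrightarrow> c *\<^sub>R f \<in> L2 M" for f :: "'a \<Rightarrow> complex"
  using L2_cmult[of f M "of_real c"] by (simp add: scaleR_fun_def scaleR_conv_of_real)

lemma L2_inner_add_left:
  "\<lbrakk>f \<in> L2 M; g \<in> L2 M; h \<in> L2 M\<rbrakk> \<Longrightarrow> L2_inner M (f + g) h = L2_inner M f h + L2_inner M g h"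
  by (simp add: L2_inner_def distrib_right L2_inner_integrable)

lemma L2_inner_cmult_left: "L2_inner M (\<lambda>x. c * f x) g = c * L2_inner M f g"
  by (simp add: L2_inner_def mult.assoc)

lemma L2_inner_cmult_right: "L2_inner M f (\<lambda>x. c * g x) = cnj c * L2_inner M f g"
  by (simp add: L2_inner_def mult.left_commute)

lemma L2_inner_commute: "L2_inner M g f = cnj (L2_inner M f g)"
proof -
  have "L2_inner M g f = (\<integral>x. cnj (f x * cnj (g x)) \<partial>M)"
    by (simp add: L2_inner_def mult.commute del: Bochner_Integration.integral_cnj)
  then show ?thesis by (simp only: L2_inner_def Bochner_Integration.integral_cnj)
qed

lemma L2_inner_self: "L2_inner M f f = of_real (\<integral>x. (norm (f x))\<^sup>2 \<partial>M)"
proof -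
  have "f x * cnj (f x) = of_real ((norm (f x))\<^sup>2)" for x
    using complex_norm_square[of "f x"] by simp
  then show ?thesis unfolding L2_inner_def by (simp only: integral_complex_of_real)
qed

lemma L2_ip_self: "L2_ip M f f = (\<integral>x. (norm (f x))\<^sup>2 \<partial>M)"
  by (simp add: L2_inner_self)

lemma L2_norm_eq: "L2_norm M f = sqrt (L2_ip M f f)"
  by (simp add: L2_norm_def L2_ip_self)

lemma L2_ip_eq_0_iff:
  assumes "f \<in> L2 M"
  shows "L2_ip M f f = 0 \<longleftrightarrow> (AE x in M. f x = 0)"
  unfolding L2_ip_self using L2_integrable_sq[OF assms]
  by (subst integral_nonneg_eq_0_iff_AE) auto

lemma L2_semi_inner: "semi_inner (L2 M) (L2_ip M)"
proof
  show "subspace (L2 M :: ('a \<Rightarrow> complex) set)"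
    unfolding subspace_def by (auto simp: L2_add L2_scaleR) (simp add: L2_def zero_fun_def)
  fix f g h :: "'a \<Rightarrow> complex" and c :: real
  assume fgh: "f \<in> L2 M" "g \<in> L2 M" "h \<in> L2 M"
  then show "L2_ip M (f + g) h = L2_ip M f h + L2_ip M g h" by (simp add: L2_inner_add_left)
  show "L2_ip M (c *\<^sub>R f) h = c * L2_ip M f h"
    using L2_inner_cmult_left[of M "of_real c" f h] by (simp add: scaleR_fun_def scaleR_conv_of_real)
  show "L2_ip M f g = L2_ip M g f" by (simp add: L2_inner_commute[of M g f])
  show "0 \<le> L2_ip M f f" by (simp add: L2_ip_self)
qed

context prob_space
begin

text \<open>A rapidly Cauchy subsequence converges almost everywhere; Fatou's lemma does the rest.\<close>

theorem L2_complete: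
  fixes s :: "nat \<Rightarrow> 'a \<Rightarrow> complex"
  assumes s: "\<And>n. s n \<in> L2 M"
    and cau: "\<And>e. e > 0 \<Longrightarrow> \<exists>N. \<forall>m\<ge>N. \<forall>n\<ge>N. L2_ip M (s m - s n) (s m - s n) < e"
  shows "\<exists>h\<in>L2 M. (\<lambda>n. L2_ip M (s n - h) (s n - h)) \<longlonglongrightarrow> 0"
proof -
  interpret L: semi_inner "L2 M" "L2_ip M" by (rule L2_semi_inner)
  have [measurable]: "s n \<in> borel_measurable M" for n using s by (rule L2_measurable)
  have diff: "s m - s n \<in> L2 M" for m n using s by simp
  have nn_eq: "(\<integral>\<^sup>+x. ennreal ((norm (f x))\<^sup>2) \<partial>M) = ennreal (L2_ip M f f)" if "f \<in> L2 M" for f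
    unfolding L2_ip_self by (intro nn_integral_eq_integral L2_integrable_sq that) simp
  \<comment> \<open>The bound concerns squared norms; the increments themselves are then at most
    \<open>(1/2)^k\<close> in mean and hence summable.\<close>
  have "\<exists>N. \<forall>m\<ge>N. \<forall>n\<ge>N. L2_ip M (s m - s n) (s m - s n) < (1/4)^k" for k :: nat
    by (rule cau) simp
  then obtain N where N: "\<And>k m n. m \<ge> N k \<Longrightarrow> n \<ge> N k \<Longrightarrow> L2_ip M (s m - s n) (s m - s n) < (1/4)^k"
    by metis
  \<comment> \<open>Partial sums of \<open>N\<close> dominate \<open>N j\<close> for all
    \<open>j \<le> k\<close> at once.\<close>
  define R where "R k = (\<Sum>i\<le>k. N i)" for k
  have RN: "N j \<le> R k" if "j \<le> k" for j k
    unfolding R_def using that by (intro member_le_sum) auto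
  define d where "d k x = norm (s (R (Suc k)) x - s (R k) x)" for k x
  have [measurable]: "d k \<in> borel_measurable M" for k unfolding d_def by measurable
  have "(\<integral>\<^sup>+x. ennreal (d k x) \<partial>M) \<le> ennreal ((1/2)^k)" for k
  proof -
    have int: "integrable M (\<lambda>x. (d k x)\<^sup>2)"
      using L2_integrable_sq[OF diff[of "R (Suc k)" "R k"]] by (simp add: d_def)
    have int1: "integrable M (d k)" by (rule square_integrable_imp_integrable) (simp_all add: int)
    have "(expectation (d k))\<^sup>2 \<le> expectation (\<lambda>x. (d k x)\<^sup>2)"
      using variance_eq[OF int1 int] variance_positive[of "d k"] by simp
    also have "\<dots> = L2_ip M (s (R (Suc k)) - s (R k)) (s (R (Suc k)) - s (R k))"
      by (simp add: L2_ip_self d_def)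
    also have "\<dots> \<le> (1/4)^k" using N[of k "R (Suc k)" "R k"] RN by (simp add: less_imp_le)
    also have "\<dots> = ((1/2)^k)\<^sup>2" by (simp add: power2_eq_square flip: power_mult_distrib)
    finally have "expectation (d k) \<le> (1/2)^k" by (rule power2_le_imp_le) simp
    moreover have "(\<integral>\<^sup>+x. ennreal (d k x) \<partial>M) = ennreal (expectation (d k))"
      by (intro nn_integral_eq_integral int1) (simp add: d_def)
    ultimately show ?thesis by (simp add: ennreal_leI)
  qed
  then have "(\<Sum>k. \<integral>\<^sup>+x. ennreal (d k x) \<partial>M) \<le> (\<Sum>k. ennreal ((1/2)^k))"
    by (intro suminf_le) auto
  also have "\<dots> = ennreal (\<Sum>k. (1/2)^k)"
    by (intro suminf_ennreal2 summable_geometric) auto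
  finally have "(\<integral>\<^sup>+x. (\<Sum>k. ennreal (d k x)) \<partial>M) \<noteq> \<infinity>"
    by (subst nn_integral_suminf) (auto simp: top_unique)
  then have "AE x in M. (\<Sum>k. ennreal (d k x)) \<noteq> \<infinity>"
    by (rule nn_integral_noteq_infinite[rotated]) measurable
  then have conv: "AE x in M. convergent (\<lambda>k. s (R k) x)"
  proof eventually_elim
    case (elim x)
    then have "summable (\<lambda>k. d k x)" by (intro summable_suminf_not_top) (auto simp: d_def)
    then have "summable (\<lambda>k. s (R (Suc k)) x - s (R k) x)"
      unfolding d_def by (rule summable_norm_cancel)
    then have "convergent (\<lambda>n. (\<Sum>k<n. s (R (Suc k)) x - s (R k) x) + s (R 0) x)"
      by (intro convergent_add convergent_const) (simp add: summable_iff_convergent)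
    then show ?case by (simp add: sum_lessThan_telescope[of "\<lambda>k. s (R k) x"])
  qed
  define h where "h x = lim (\<lambda>k. s (R k) x)" for x
  have [measurable]: "h \<in> borel_measurable M" unfolding h_def by measurable
  have lim: "AE x in M. (\<lambda>k. s (R k) x) \<longlonglongrightarrow> h x"
    using conv by eventually_elim (simp add: h_def convergent_LIMSEQ_iff)
  have fatou: "(\<integral>\<^sup>+x. ennreal ((norm (s n x - h x))\<^sup>2) \<partial>M) \<le> ennreal ((1/4)^k)" if "n \<ge> N k" for n k
  proof -
    have "(\<integral>\<^sup>+x. ennreal ((norm (s n x - h x))\<^sup>2) \<partial>M)
        = (\<integral>\<^sup>+x. liminf (\<lambda>j. ennreal ((norm (s n x - s (R j) x))\<^sup>2)) \<partial>M)"
    proof (rule nn_integral_cong_AE)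
      show "AE x in M. ennreal ((norm (s n x - h x))\<^sup>2) = liminf (\<lambda>j. ennreal ((norm (s n x - s (R j) x))\<^sup>2))"
        using lim
      proof eventually_elim
        case (elim x)
        then have "(\<lambda>j. ennreal ((norm (s n x - s (R j) x))\<^sup>2)) \<longlonglongrightarrow> ennreal ((norm (s n x - h x))\<^sup>2)"
          by (intro tendsto_ennrealI tendsto_power tendsto_norm tendsto_diff tendsto_const)
        then show ?case by (intro lim_imp_Liminf[symmetric]) simp_all
      qed
    qed
    also have "\<dots> \<le> liminf (\<lambda>j. \<integral>\<^sup>+x. ennreal ((norm (s n x - s (R j) x))\<^sup>2) \<partial>M)"
      by (rule nn_integral_liminf) measurable
    also have "\<dots> = liminf (\<lambda>j. ennreal (L2_ip M (s n - s (R j)) (s n - s (R j))))"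
      using nn_eq[OF diff] by simp
    also have "\<dots> \<le> ennreal ((1/4)^k)"
    proof (rule Liminf_le)
      show "\<forall>\<^sub>F j in sequentially. ennreal (L2_ip M (s n - s (R j)) (s n - s (R j))) \<le> ennreal ((1/4)^k)"
        unfolding eventually_sequentially using N[of k n] that RN
        by (intro exI[of _ k]) (auto intro!: ennreal_leI less_imp_le)
    qed simp
    finally show ?thesis .
  qed
  \<comment> \<open>Fatou's bound starts at \<open>N 0\<close>. A single such difference already
    places \<open>h\<close> in \<open>L2\<close>.\<close>
  have sh: "s n - h \<in> L2 M" if "n \<ge> N 0" for n
  proof -
    have "(\<integral>\<^sup>+x. ennreal ((norm (s n x - h x))\<^sup>2) \<partial>M) < \<infinity>"
      using fatou[OF that] by (auto simp: top_unique less_top[symmetric])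
    then have "integrable M (\<lambda>x. (norm (s n x - h x))\<^sup>2)"
      by (intro integrableI_bounded) auto
    then show ?thesis by (simp add: L2_def fun_diff_def)
  qed
  have h: "h \<in> L2 M" using L.H_mem(4)[OF s sh[of "N 0"], of "N 0"] by simp
  have "\<exists>n0. \<forall>n\<ge>n0. norm (L2_ip M (s n - h) (s n - h) - 0) < e" if e: "e > 0" for e :: real
  proof -
    obtain k :: nat where k: "(1/4)^k < e" using real_arch_pow_inv[OF e, of "1/4"] by auto
    have "norm (L2_ip M (s n - h) (s n - h) - 0) < e" if "n \<ge> N k" for n
    proof -
      have "ennreal (L2_ip M (s n - h) (s n - h)) \<le> ennreal ((1/4)^k)"
        using fatou[OF that] nn_eq[of "s n - h"] s h by simp
      then have "L2_ip M (s n - h) (s n - h) \<le> (1/4)^k" by (simp add: ennreal_le_iff)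
      with k L.ip_nonneg[of "s n - h"] s h show ?thesis by simp
    qed
    then show ?thesis by blast
  qed
  then have "(\<lambda>n. L2_ip M (s n - h) (s n - h)) \<longlonglongrightarrow> 0" by (intro LIMSEQ_I)
  with h show ?thesis by blast
qed

lemma L2_semi_hilbert: "semi_hilbert (L2 M) (L2_ip M)"
  by (intro semi_hilbert.intro L2_semi_inner semi_hilbert_axioms.intro L2_complete)

end

section \<open>The operator of a stationary kernel\<close>

locale stationary_kernel =
  fixes P :: "'a::polish_space \<Rightarrow> 'a measure" and \<pi> :: "'a measure"
  assumes P_prob: "P \<in> borel \<rightarrow>\<^sub>M prob_algebra borel"
    and stationary: "stationary_distribution P \<pi>"
begin

sublocale prob_space \<pi>
  using stationary by (simp add: stationary_distribution_def)

lemma sets_pi [simp, measurable_cong]: "sets \<pi> = sets borel"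
  using stationary by (simp add: stationary_distribution_def)

lemma space_pi [simp]: "space \<pi> = UNIV"
  using sets_eq_imp_space_eq[OF sets_pi] by simp

lemma P_subprob [measurable]: "P \<in> borel \<rightarrow>\<^sub>M subprob_algebra borel"
  using P_prob by (rule measurable_prob_algebraD)

lemma sets_P [simp, measurable_cong]: "sets (P x) = sets borel"
  using sets_kernel[OF P_subprob, of x] by simp

lemma space_P [simp]: "space (P x) = UNIV"
  using sets_eq_imp_space_eq[OF sets_P] by simp

lemma prob_space_P: "prob_space (P x)"
  using measurable_space[OF P_prob, of x] by (simp add: space_prob_algebra)

lemma nn_integral_stationary:
  assumes "f \<in> borel_measurable borel"
  shows "(\<integral>\<^sup>+x. \<integral>\<^sup>+y. f y \<partial>P x \<partial>\<pi>) = (\<integral>\<^sup>+x. f x \<partial>\<pi>)"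
proof -
  have "P \<in> \<pi> \<rightarrow>\<^sub>M subprob_algebra borel" by measurable
  from nn_integral_bind[OF assms this] show ?thesis
    using stationary by (simp add: stationary_distribution_def)
qed

lemma markov_op_measurable:
  assumes [measurable]: "f \<in> borel_measurable borel"
  shows "markov_op P f \<in> borel_measurable borel"
  unfolding markov_op_def
  by (rule measurable_compose[OF P_subprob integral_measurable_subprob_algebra]) simp

text \<open>By stationarity the squared modulus has the same integral under one step of
  \<open>P\<close> as under \<pi>. At the exceptional points \<open>markov_op\<close> takes a
  default value and additivity may fail there.\<close>

lemma AE_square_integrable:
  fixes f :: "'a \<Rightarrow> complex"
  assumes "f \<in> L2 \<pi>"
  shows "AE x in \<pi>. integrable (P x) (\<lambda>y. (norm (f y))\<^sup>2) \<and> integrable (P x) f"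
proof -
  have [measurable]: "f \<in> borel_measurable borel" using L2_measurable[OF assms] by simp
  have "(\<integral>\<^sup>+x. \<integral>\<^sup>+y. ennreal ((norm (f y))\<^sup>2) \<partial>P x \<partial>\<pi>) = (\<integral>\<^sup>+x. ennreal ((norm (f x))\<^sup>2) \<partial>\<pi>)"
    by (rule nn_integral_stationary) measurable
  also have "\<dots> \<noteq> \<infinity>" using L2_integrable_sq[OF assms] by (simp add: nn_integral_eq_integral)
  finally have "AE x in \<pi>. (\<integral>\<^sup>+y. ennreal ((norm (f y))\<^sup>2) \<partial>P x) \<noteq> \<infinity>"
    by (intro nn_integral_noteq_infinite) measurable
  then show ?thesis
  proof eventually_elim
    case (elim x)
    interpret Px: prob_space "P x" by (rule prob_space_P)
    have 1: "integrable (P x) (\<lambda>y. (norm (f y))\<^sup>2)"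
      using elim by (intro integrableI_bounded) (auto simp: less_top)
    have "integrable (P x) (\<lambda>y. norm (f y))"
      by (rule Px.square_integrable_imp_integrable) (use 1 in auto)
    then have "integrable (P x) f" by (subst (asm) integrable_norm_iff) auto
    with 1 show ?case by blast
  qed
qed

text \<open>Nonnegativity of a variance under \<open>P x\<close>. The right hand side is an extended
  real so that the estimate also covers the points at which the default value of the integral is
  used.\<close>

lemma markov_op_norm_sq_le: "ennreal ((norm (markov_op P f x))\<^sup>2) \<le> (\<integral>\<^sup>+y. ennreal ((norm (f y))\<^sup>2) \<partial>P x)"
  if [measurable]: "f \<in> borel_measurable borel"
proof (cases "(\<integral>\<^sup>+y. ennreal ((norm (f y))\<^sup>2) \<partial>P x) = \<infinity>")
  case False
  interpret Px: prob_space "P x" by (rule prob_space_P)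
  have int2: "integrable (P x) (\<lambda>y. (norm (f y))\<^sup>2)"
    using False by (intro integrableI_bounded) (auto simp: less_top)
  have int1: "integrable (P x) (\<lambda>y. norm (f y))"
    by (rule Px.square_integrable_imp_integrable) (use int2 in auto)
  have "(norm (markov_op P f x))\<^sup>2 \<le> (\<integral>y. norm (f y) \<partial>P x)\<^sup>2"
    unfolding markov_op_def by (intro power_mono integral_norm_bound norm_ge_zero)
  also have "\<dots> \<le> (\<integral>y. (norm (f y))\<^sup>2 \<partial>P x)"
    using Px.variance_eq[OF int1 int2] Px.variance_positive[of "\<lambda>y. norm (f y)"] by simp
  finally have "ennreal ((norm (markov_op P f x))\<^sup>2) \<le> ennreal (\<integral>y. (norm (f y))\<^sup>2 \<partial>P x)"
    by (rule ennreal_leI)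
  then show ?thesis using int2 by (simp add: nn_integral_eq_integral)
qed simp

lemma
  fixes f :: "'a \<Rightarrow> complex"
  assumes f: "f \<in> L2 \<pi>"
  shows markov_op_L2: "markov_op P f \<in> L2 \<pi>"
    and markov_op_contraction: "L2_ip \<pi> (markov_op P f) (markov_op P f) \<le> L2_ip \<pi> f f"
proof -
  have [measurable]: "f \<in> borel_measurable borel" using L2_measurable[OF f] by simp
  note [measurable] = markov_op_measurable[of f]
  have "(\<integral>\<^sup>+x. ennreal ((norm (markov_op P f x))\<^sup>2) \<partial>\<pi>) \<le> (\<integral>\<^sup>+x. \<integral>\<^sup>+y. ennreal ((norm (f y))\<^sup>2) \<partial>P x \<partial>\<pi>)"
    by (intro nn_integral_mono markov_op_norm_sq_le) measurable
  also have "\<dots> = (\<integral>\<^sup>+x. ennreal ((norm (f x))\<^sup>2) \<partial>\<pi>)"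
    by (rule nn_integral_stationary) measurable
  also have "\<dots> = ennreal (L2_ip \<pi> f f)"
    unfolding L2_ip_self by (intro nn_integral_eq_integral L2_integrable_sq f) simp
  finally have le: "(\<integral>\<^sup>+x. ennreal ((norm (markov_op P f x))\<^sup>2) \<partial>\<pi>) \<le> ennreal (L2_ip \<pi> f f)" .
  have int: "integrable \<pi> (\<lambda>x. (norm (markov_op P f x))\<^sup>2)"
    using le by (intro integrableI_bounded) (auto simp: top_unique less_top[symmetric])
  then show "markov_op P f \<in> L2 \<pi>" by (simp add: L2_def)
  show "L2_ip \<pi> (markov_op P f) (markov_op P f) \<le> L2_ip \<pi> f f"
    using le int by (simp add: nn_integral_eq_integral L2_ip_self ennreal_le_iff)
qed

lemma markov_op_add:
  fixes f g :: "'a \<Rightarrow> complex"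
  assumes "f \<in> L2 \<pi>" "g \<in> L2 \<pi>"
  shows "AE x in \<pi>. markov_op P (f + g) x = (markov_op P f + markov_op P g) x"
  using AE_square_integrable[OF assms(1)] AE_square_integrable[OF assms(2)]
  by eventually_elim (simp add: markov_op_def)

lemma markov_op_cmult: "markov_op P (\<lambda>x. c * f x) = (\<lambda>x. c * markov_op P f x)"
  for c :: complex
  by (simp add: markov_op_def)

lemma L2_inner_cong_AE:
  assumes "AE x in \<pi>. f x = f' x" "f \<in> L2 \<pi>" "f' \<in> L2 \<pi>" "g \<in> L2 \<pi>"
  shows "L2_inner \<pi> f g = L2_inner \<pi> f' g"
  unfolding L2_inner_def
  using assms(1) borel_measurable_integrable[OF L2_inner_integrable[OF assms(2,4)]]
    borel_measurable_integrable[OF L2_inner_integrable[OF assms(3,4)]]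
  by (intro integral_cong_AE) auto

sublocale L2: semi_hilbert "L2 \<pi>" "L2_ip \<pi>"
  by (rule L2_semi_hilbert)

section \<open>The adjoint and the positive contraction formed from powers of
  \<open>P\<close>\<close>

abbreviation adj :: "'a operator" where
  "adj \<equiv> L2_adjoint \<pi> (markov_op P)"

text \<open>The real representation theorem yields only equality of real parts; inserting
  \<open>\<i> * f\<close> for \<open>f\<close> yields the imaginary parts.\<close>

lemma adj_exists:
  assumes g: "g \<in> L2 \<pi>"
  shows "\<exists>h. h \<in> L2 \<pi> \<and> (\<forall>f\<in>L2 \<pi>. L2_inner \<pi> (markov_op P f) g = L2_inner \<pi> f h)"
proof -
  obtain h where h: "h \<in> L2 \<pi>" "\<And>f. f \<in> L2 \<pi> \<Longrightarrow> L2_ip \<pi> (markov_op P f) g = L2_ip \<pi> h f"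
  proof (rule L2.riesz_representation[of "\<lambda>f. L2_ip \<pi> (markov_op P f) g" "L2_ip \<pi> g g"])
    fix f f' :: "'a \<Rightarrow> complex" and c :: real
    assume f: "f \<in> L2 \<pi>" "f' \<in> L2 \<pi>"
    have "L2_inner \<pi> (markov_op P (f + f')) g = L2_inner \<pi> (markov_op P f + markov_op P f') g"
      using f g by (intro L2_inner_cong_AE markov_op_add markov_op_L2 L2_add)
    then show "L2_ip \<pi> (markov_op P (f + f')) g = L2_ip \<pi> (markov_op P f) g + L2_ip \<pi> (markov_op P f') g"
      using f g by (simp add: L2_inner_add_left markov_op_L2)
  next
    fix f :: "'a \<Rightarrow> complex" and c :: real
    assume f: "f \<in> L2 \<pi>"
    have "c *\<^sub>R f = (\<lambda>x. of_real c * f x)" by (simp add: scaleR_fun_def scaleR_conv_of_real)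
    then show "L2_ip \<pi> (markov_op P (c *\<^sub>R f)) g = c * L2_ip \<pi> (markov_op P f) g"
      by (simp add: markov_op_cmult L2_inner_cmult_left)
    have "(L2_ip \<pi> (markov_op P f) g)\<^sup>2 \<le> L2_ip \<pi> (markov_op P f) (markov_op P f) * L2_ip \<pi> g g"
      using f g by (intro L2.Cauchy_Schwarz markov_op_L2)
    also have "\<dots> \<le> L2_ip \<pi> f f * L2_ip \<pi> g g"
      using f g by (intro mult_right_mono markov_op_contraction L2.ip_nonneg)
    finally show "(L2_ip \<pi> (markov_op P f) g)\<^sup>2 \<le> L2_ip \<pi> g g * L2_ip \<pi> f f" by (simp add: mult.commute)
  qed (use L2.ip_nonneg[OF g] in auto)
  have "L2_inner \<pi> (markov_op P f) g = L2_inner \<pi> f h" if f: "f \<in> L2 \<pi>" for f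
  proof (rule complex_eqI)
    show re: "L2_ip \<pi> (markov_op P f) g = L2_ip \<pi> f h"
      using h(2)[OF f] L2.ip_sym[OF f h(1)] by simp
    have if': "(\<lambda>x. \<i> * f x) \<in> L2 \<pi>" using f by (rule L2_cmult)
    have "L2_ip \<pi> (markov_op P (\<lambda>x. \<i> * f x)) g = L2_ip \<pi> (\<lambda>x. \<i> * f x) h"
      using h(2)[OF if'] L2.ip_sym[OF if' h(1)] by simp
    then show "Im (L2_inner \<pi> (markov_op P f) g) = Im (L2_inner \<pi> f h)"
      by (simp add: markov_op_cmult L2_inner_cmult_left)
  qed
  with h(1) show ?thesis by blast
qed

lemma
  assumes "g \<in> L2 \<pi>"
  shows adj_L2: "adj g \<in> L2 \<pi>"
    and adj_inner: "f \<in> L2 \<pi> \<Longrightarrow> L2_inner \<pi> (markov_op P f) g = L2_inner \<pi> f (adj g)"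
  using someI_ex[OF adj_exists[OF assms]] unfolding L2_adjoint_def by blast+

lemma markov_op_pow_L2: "f \<in> L2 \<pi> \<Longrightarrow> (markov_op P ^^ k) f \<in> L2 \<pi>"
  for f :: "'a \<Rightarrow> complex"
  by (induction k) (simp_all add: markov_op_L2)

lemma adj_pow_L2: "f \<in> L2 \<pi> \<Longrightarrow> (adj ^^ k) f \<in> L2 \<pi>"
  by (induction k) (simp_all add: adj_L2)

lemma markov_op_pow_contraction:
  "f \<in> L2 \<pi> \<Longrightarrow> L2_ip \<pi> ((markov_op P ^^ k) f) ((markov_op P ^^ k) f) \<le> L2_ip \<pi> f f"
proof (induction k)
  case (Suc k)
  then show ?case using markov_op_contraction[OF markov_op_pow_L2, of f k] by simp
qed simp

lemma adj_pow_inner: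
  "\<lbrakk>f \<in> L2 \<pi>; g \<in> L2 \<pi>\<rbrakk> \<Longrightarrow> L2_inner \<pi> ((markov_op P ^^ k) f) g = L2_inner \<pi> f ((adj ^^ k) g)"
proof (induction k arbitrary: g)
  case (Suc k)
  have "L2_inner \<pi> ((markov_op P ^^ Suc k) f) g = L2_inner \<pi> ((markov_op P ^^ k) f) (adj g)"
    using Suc.prems by (simp add: adj_inner markov_op_pow_L2)
  also have "\<dots> = L2_inner \<pi> f ((adj ^^ k) (adj g))"
    using Suc.prems by (intro Suc.IH adj_L2)
  also have "(adj ^^ k) (adj g) = (adj ^^ Suc k) g" by (simp only: funpow_swap1 funpow.simps comp_def)
  finally show ?case .
qed simp

definition sq_op :: "nat \<Rightarrow> 'a operator" where
  "sq_op k = (adj ^^ k) \<circ> (markov_op P ^^ k)"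

lemma sq_op_L2: "f \<in> L2 \<pi> \<Longrightarrow> sq_op k f \<in> L2 \<pi>"
  by (simp add: sq_op_def adj_pow_L2 markov_op_pow_L2)

lemma sq_op_inner_right:
  "\<lbrakk>f \<in> L2 \<pi>; g \<in> L2 \<pi>\<rbrakk> \<Longrightarrow> L2_inner \<pi> g (sq_op k f) = L2_inner \<pi> ((markov_op P ^^ k) g) ((markov_op P ^^ k) f)"
  by (simp add: sq_op_def adj_pow_inner markov_op_pow_L2)

lemma sq_op_inner_left:
  "\<lbrakk>f \<in> L2 \<pi>; g \<in> L2 \<pi>\<rbrakk> \<Longrightarrow> L2_inner \<pi> (sq_op k f) g = L2_inner \<pi> ((markov_op P ^^ k) f) ((markov_op P ^^ k) g)"
  using sq_op_inner_right[of f g k] L2_inner_commute[of \<pi> "sq_op k f" g]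
    L2_inner_commute[of \<pi> "(markov_op P ^^ k) f" "(markov_op P ^^ k) g"] by simp

lemma sq_op_sym: "\<lbrakk>f \<in> L2 \<pi>; g \<in> L2 \<pi>\<rbrakk> \<Longrightarrow> L2_inner \<pi> (sq_op k f) g = L2_inner \<pi> f (sq_op k g)"
  by (simp add: sq_op_inner_left sq_op_inner_right)

text \<open>Moving the adjoints across shows that the quadratic form is the squared norm of
  \<open>(markov_op P ^^ k) f\<close>, which lies between 0 and the squared norm of
  \<open>f\<close>.\<close>

sublocale sq: positive_contraction "L2 \<pi>" "L2_ip \<pi>" "sq_op k" for k
  by standard
    (simp_all add: sq_op_L2 sq_op_sym, simp_all add: sq_op_inner_right L2.ip_nonneg markov_op_pow_L2 markov_op_pow_contraction)

lemma AE_eq_iff: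
  fixes f g :: "'a \<Rightarrow> complex"
  assumes "f \<in> L2 \<pi>" "g \<in> L2 \<pi>"
  shows "(AE x in \<pi>. f x = g x) \<longleftrightarrow> L2_ip \<pi> (f - g) (f - g) = 0"
  using L2_ip_eq_0_iff[of "f - g" \<pi>] assms by simp

lemma const_L2 [simp]: "(\<lambda>x. c) \<in> L2 \<pi>" for c :: complex
  by (simp add: L2_def)

lemma markov_op_pow_const: "(markov_op P ^^ k) (\<lambda>x. c) = (\<lambda>x. c)" for c :: complex
proof (induction k)
  case (Suc k)
  have "(\<integral>y. c \<partial>P x) = c" for x
  proof -
    interpret Px: prob_space "P x" by (rule prob_space_P)
    show ?thesis using Px.prob_space by simp
  qed
  with Suc show ?case by (simp add: markov_op_def)
qed simp

text \<open>The bounded inverse applied to \<open>z f - Q f\<close> returns \<open>f\<close> almost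
  everywhere, so its bound serves as \<open>B\<close>. Unlike the inverse, such an estimate passes
  to subspaces at once.\<close>

lemma resolvent_bounded_below:
  assumes "complex_of_real z \<notin> L2_spectrum \<pi> (sq_op k)"
  shows "\<exists>B. \<forall>f\<in>L2 \<pi>. L2.nrm f \<le> B * L2.nrm (z *\<^sub>R f - sq_op k f)"
proof -
  obtain R B where R: "L2_bounded_linear \<pi> R"
    and inv: "\<And>f. f \<in> L2 \<pi> \<Longrightarrow> AE x in \<pi>. R (\<lambda>y. of_real z * f y - sq_op k f y) x = f x"
    and B: "\<And>f. f \<in> L2 \<pi> \<Longrightarrow> L2_norm \<pi> (R f) \<le> B * L2_norm \<pi> f"
    using assms unfolding L2_spectrum_def L2_bounded_linear_def by blast
  have "L2.nrm f \<le> B * L2.nrm (z *\<^sub>R f - sq_op k f)" if f: "f \<in> L2 \<pi>" for f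
  proof -
    define u where "u = z *\<^sub>R f - sq_op k f"
    have u: "u \<in> L2 \<pi>" "u = (\<lambda>y. of_real z * f y - sq_op k f y)"
      using f by (simp_all add: u_def sq_op_L2 fun_eq_iff scaleR_conv_of_real)
    have Ru: "R u \<in> L2 \<pi>" using R u(1) by (simp add: L2_bounded_linear_def)
    have "L2_norm \<pi> (R u) = L2_norm \<pi> f"
      unfolding L2_norm_def using inv[OF f] L2_measurable[OF f] L2_measurable[OF Ru]
      by (intro arg_cong[where f = sqrt] integral_cong_AE) (auto simp: u(2))
    then show ?thesis using B[OF u(1)] by (simp add: L2_norm_eq L2.nrm_def u_def)
  qed
  then show ?thesis by blast
qed

text \<open>For \<open>z\<close> outside the unit interval a solution of
  \<open>z h - Q h = g\<close> is chosen for each \<open>g\<close>. Uniqueness of solutions makes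
  this choice linear and a two-sided inverse, and the distance of \<open>z\<close> from the interval
  bounds it. The result gives meaning to the supremum in \<open>spectral_gap\<close>.\<close>

lemma spectrum_sq_op_real:
  assumes "complex_of_real z \<in> L2_spectrum \<pi> (sq_op k)"
  shows "0 \<le> z" "z \<le> 1"
proof -
  have "\<not> (z < 0 \<or> z > 1)"
  proof
    assume z: "z < 0 \<or> z > 1"
    have "\<forall>g\<in>L2 \<pi>. \<exists>h. h \<in> L2 \<pi> \<and> L2_ip \<pi> (z *\<^sub>R h - sq_op k h - g) (z *\<^sub>R h - sq_op k h - g) = 0"
    proof
      fix g :: "'a \<Rightarrow> complex" assume g: "g \<in> L2 \<pi>"
      obtain h where "h \<in> L2 \<pi>" "L2_ip \<pi> (z *\<^sub>R h - sq_op k h - g) (z *\<^sub>R h - sq_op k h - g) = 0"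
        using z g by (rule sq.resolvent_exists)
      then show "\<exists>h. h \<in> L2 \<pi> \<and> L2_ip \<pi> (z *\<^sub>R h - sq_op k h - g) (z *\<^sub>R h - sq_op k h - g) = 0"
        by (intro exI conjI)
    qed
    from bchoice[OF this] obtain R where R_spec: "\<forall>g\<in>L2 \<pi>. R g \<in> L2 \<pi> \<and>
        L2_ip \<pi> (z *\<^sub>R R g - sq_op k (R g) - g) (z *\<^sub>R R g - sq_op k (R g) - g) = 0" ..
    have R: "R g \<in> L2 \<pi>"
      and R0: "L2_ip \<pi> (z *\<^sub>R R g - sq_op k (R g) - g) (z *\<^sub>R R g - sq_op k (R g) - g) = 0"
      if "g \<in> L2 \<pi>" for g using bspec[OF R_spec that] by (rule conjunct1, rule conjunct2)
    have Rv: "z * L2_ip \<pi> (R g) v - L2_ip \<pi> (R g) (sq_op k v) = L2_ip \<pi> g v"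
      if "g \<in> L2 \<pi>" "v \<in> L2 \<pi>" for g v
      using L2.ip_eq_0[OF _ that(2) R0[OF that(1)]] that R[OF that(1)]
      by (simp add: L2.ip_simps sq_op_L2 sq_op_sym)
    \<comment> \<open>All laws for \<open>R\<close> are verified through weak equations, in which
      the operator acts on the test function \<open>v\<close>.\<close>
    have uniq: "AE x in \<pi>. f x = g x"
      if "f \<in> L2 \<pi>" "g \<in> L2 \<pi>"
        "\<And>v. v \<in> L2 \<pi> \<Longrightarrow> z * L2_ip \<pi> f v - L2_ip \<pi> f (sq_op k v) = z * L2_ip \<pi> g v - L2_ip \<pi> g (sq_op k v)"
      for f g
      unfolding AE_eq_iff[OF that(1,2)]
    proof (rule sq.resolvent_inj[OF z])
      fix v :: "'a \<Rightarrow> complex" assume v: "v \<in> L2 \<pi>"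
      have "f - g \<in> L2 \<pi>" using that by simp
      then have "L2_ip \<pi> (z *\<^sub>R (f - g) - sq_op k (f - g)) v = z * L2_ip \<pi> (f - g) v - L2_ip \<pi> (f - g) (sq_op k v)"
        using v by (simp add: L2.ip_diff[of "z *\<^sub>R (f - g)"] L2.ip_scale sq_op_L2 sq_op_sym del: scaleR_diff_right)
      also have "\<dots> = 0" using that v by (simp add: L2.ip_simps sq_op_L2 algebra_simps)
      finally show "L2_ip \<pi> (z *\<^sub>R (f - g) - sq_op k (f - g)) v = 0" .
    qed (use that in simp)
    obtain B where "B > 0" and B: "\<And>x. x \<in> L2 \<pi> \<Longrightarrow> L2.nrm x \<le> B * L2.nrm (z *\<^sub>R x - sq_op k x)"
      using sq.resolvent_bound[OF z] by blast
    have "L2_bounded_linear \<pi> R"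
      unfolding L2_bounded_linear_def
    proof (intro conjI ballI allI exI[of _ B])
      fix f :: "'a \<Rightarrow> complex" assume f: "f \<in> L2 \<pi>"
      show "R f \<in> L2 \<pi>" using f by (rule R)
      define u where "u = z *\<^sub>R R f - sq_op k (R f)"
      have u: "u \<in> L2 \<pi>" using f by (simp add: u_def R sq_op_L2)
      have "AE x in \<pi>. u x = f x" using R0[OF f] AE_eq_iff[OF u f] by (simp add: u_def)
      then have "L2_norm \<pi> u = L2_norm \<pi> f"
        unfolding L2_norm_def using L2_measurable[OF f] L2_measurable[OF u]
        by (intro arg_cong[where f = sqrt] integral_cong_AE) auto
      then show "L2_norm \<pi> (R f) \<le> B * L2_norm \<pi> f"
        using B[OF R[OF f]] by (simp add: L2_norm_eq L2.nrm_def flip: u_def)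
    next
      fix f g :: "'a \<Rightarrow> complex" assume fg: "f \<in> L2 \<pi>" "g \<in> L2 \<pi>"
      have fg': "f + g \<in> L2 \<pi>" using fg by simp
      have "AE x in \<pi>. R (f + g) x = (R f + R g) x"
      proof (rule uniq)
        fix v :: "'a \<Rightarrow> complex" assume v: "v \<in> L2 \<pi>"
        show "z * L2_ip \<pi> (R (f + g)) v - L2_ip \<pi> (R (f + g)) (sq_op k v) =
            z * L2_ip \<pi> (R f + R g) v - L2_ip \<pi> (R f + R g) (sq_op k v)"
          using Rv[OF fg' v] Rv[OF fg(1) v] Rv[OF fg(2) v] fg v R
          by (simp add: L2.ip_simps sq_op_L2 algebra_simps)
      qed (rule R[OF fg'], rule L2_add[OF R[OF fg(1)] R[OF fg(2)]])
      then show "AE x in \<pi>. R (\<lambda>y. f y + g y) x = R f x + R g x" by (simp add: plus_fun_def)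
    next
      fix c :: complex and f :: "'a \<Rightarrow> complex" assume f: "f \<in> L2 \<pi>"
      have cf: "(\<lambda>x. c * f x) \<in> L2 \<pi>" using f by (rule L2_cmult)
      show "AE x in \<pi>. R (\<lambda>y. c * f y) x = c * R f x"
      proof (rule uniq[OF R[OF cf] L2_cmult[OF R[OF f]]])
        fix v :: "'a \<Rightarrow> complex" assume v: "v \<in> L2 \<pi>"
        \<comment> \<open>The real form \<open>L2_ip\<close> respects real scalars only; a complex
          scalar is moved to the test function as its conjugate.\<close>
        define w where "w = (\<lambda>x. cnj c * v x)"
        have w: "w \<in> L2 \<pi>" using v by (simp add: w_def L2_cmult)
        have inner: "L2_inner \<pi> (\<lambda>x. c * g x) v = L2_inner \<pi> g w" for g
          by (simp add: w_def L2_inner_cmult_left L2_inner_cmult_right)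
        have "L2_inner \<pi> (\<lambda>x. c * R f x) (sq_op k v) = c * L2_inner \<pi> (sq_op k (R f)) v"
          using f v by (simp add: L2_inner_cmult_left sq_op_sym R)
        also have "\<dots> = L2_inner \<pi> (sq_op k (R f)) w"
          by (simp add: w_def L2_inner_cmult_right)
        also have "\<dots> = L2_inner \<pi> (R f) (sq_op k w)"
          using f w by (simp add: sq_op_sym R)
        finally show "z * L2_ip \<pi> (R (\<lambda>y. c * f y)) v - L2_ip \<pi> (R (\<lambda>y. c * f y)) (sq_op k v) =
            z * L2_ip \<pi> (\<lambda>x. c * R f x) v - L2_ip \<pi> (\<lambda>x. c * R f x) (sq_op k v)"
          using Rv[OF cf v] Rv[OF f w] by (simp add: inner)
      qed
    qed
    moreover have "(AE x in \<pi>. R (\<lambda>y. of_real z * f y - sq_op k f y) x = f x) \<and>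
        (AE x in \<pi>. of_real z * R f x - sq_op k (R f) x = f x)" if f: "f \<in> L2 \<pi>" for f
    proof
      define u where "u = z *\<^sub>R f - sq_op k f"
      have u: "u \<in> L2 \<pi>" using f by (simp add: u_def sq_op_L2)
      have "AE x in \<pi>. R u x = f x"
      proof (rule uniq[OF R[OF u] f])
        fix v :: "'a \<Rightarrow> complex" assume v: "v \<in> L2 \<pi>"
        show "z * L2_ip \<pi> (R u) v - L2_ip \<pi> (R u) (sq_op k v) = z * L2_ip \<pi> f v - L2_ip \<pi> f (sq_op k v)"
          using Rv[OF u v] f v by (simp add: u_def L2.ip_simps sq_op_L2 sq_op_sym)
      qed
      then show "AE x in \<pi>. R (\<lambda>y. of_real z * f y - sq_op k f y) x = f x"
        by (simp add: u_def fun_diff_def scaleR_fun_def scaleR_conv_of_real)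
      have "AE x in \<pi>. (z *\<^sub>R R f - sq_op k (R f)) x = f x"
        using f R0[OF f] R[OF f] by (subst AE_eq_iff) (simp_all add: sq_op_L2)
      then show "AE x in \<pi>. of_real z * R f x - sq_op k (R f) x = f x"
        by (simp add: scaleR_conv_of_real)
    qed
    ultimately show False using assms unfolding L2_spectrum_def by blast
  qed
  then show "0 \<le> z" "z \<le> 1" by simp_all
qed

text \<open>The adjoint is not known explicitly, so the equality case of the contraction is used:
  \<open>Q 1\<close> has norm at most 1 and inner product 1 with the constant 1, hence their
  distance is 0.\<close>

lemma sq_op_one: "AE x in \<pi>. sq_op k (\<lambda>_. 1) x = 1"
proof -
  let ?e = "\<lambda>_::'a. 1 :: complex"
  have "L2_ip \<pi> (sq_op k ?e) ?e = L2_ip \<pi> ?e ?e"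
    by (simp add: sq_op_inner_left markov_op_pow_const)
  then have "L2_ip \<pi> (sq_op k ?e - ?e) (sq_op k ?e - ?e) \<le> 0"
    using sq.T_contraction[of ?e k] L2.ip_sym[of ?e "sq_op k ?e"]
    by (simp add: L2.ip_simps sq_op_L2)
  then show ?thesis
    using L2.ip_nonneg[of "sq_op k ?e - ?e"] by (subst AE_eq_iff) (simp_all add: sq_op_L2)
qed

section \<open>The spectral gap as an inequality on the orthogonal complement of the
  constants\<close>

definition centred :: "('a \<Rightarrow> complex) set" where
  "centred = {f \<in> L2 \<pi>. L2_inner \<pi> f (\<lambda>_. 1) = 0}"

lemma centred_L2: "f \<in> centred \<Longrightarrow> f \<in> L2 \<pi>"
  by (simp add: centred_def)

text \<open>Invariance holds because the operator is symmetric and fixes the constant 1;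
  completeness holds because the mean is continuous in \<open>L2\<close>.\<close>

lemma centred_contraction: "positive_contraction centred (L2_ip \<pi>) (sq_op k)"
proof
  let ?e = "\<lambda>_::'a. 1 :: complex"
  show "subspace centred"
    using L2_inner_cmult_left[of \<pi> "of_real _" _ ?e]
    by (auto simp: subspace_def centred_def L2_inner_add_left L2_scaleR scaleR_fun_def scaleR_conv_of_real L2_cmult)
      (simp_all add: L2_inner_def zero_fun_def)
  fix f assume "f \<in> centred"
  then have f: "f \<in> L2 \<pi>" "L2_inner \<pi> f ?e = 0" by (simp_all add: centred_def)
  have "L2_inner \<pi> ?e f = 0" using f(2) L2_inner_commute[of \<pi> ?e f] by simp
  moreover have "L2_inner \<pi> (sq_op k ?e) f = L2_inner \<pi> ?e f"
    by (intro L2_inner_cong_AE sq_op_one sq_op_L2 f const_L2)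
  ultimately have "L2_inner \<pi> f (sq_op k ?e) = 0"
    using L2_inner_commute[of \<pi> f "sq_op k ?e"] by simp
  then show "sq_op k f \<in> centred"
    using f by (simp add: centred_def sq_op_L2 sq_op_sym)
next
  fix s assume s: "\<And>n::nat. s n \<in> centred"
    and cau: "\<And>e. e > 0 \<Longrightarrow> \<exists>N. \<forall>m\<ge>N. \<forall>n\<ge>N. L2_ip \<pi> (s m - s n) (s m - s n) < e"
  have s': "\<And>n. s n \<in> L2 \<pi>" using s by (rule centred_L2)
  obtain h where h: "h \<in> L2 \<pi>" "(\<lambda>n. L2_ip \<pi> (s n - h) (s n - h)) \<longlonglongrightarrow> 0"
    using L2.complete[OF s' cau] by blast
  \<comment> \<open>Convergence is available for real parts; the constants 1 and \<i> together
    determine the complex mean.\<close>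
  have lim: "(\<lambda>n. L2_ip \<pi> (s n) (\<lambda>_. c)) \<longlonglongrightarrow> L2_ip \<pi> h (\<lambda>_. c)" for c
    by (rule L2.tendsto_ip_left[OF s' h(1) const_L2 h(2)])
  have c: "L2_inner \<pi> f (\<lambda>_. c) = cnj c * L2_inner \<pi> f (\<lambda>_. 1)" for f c
    using L2_inner_cmult_right[of \<pi> f c "\<lambda>_. 1"] by simp
  have "L2_inner \<pi> (s n) (\<lambda>_. c) = 0" for n c
    using s[of n] by (subst c) (simp add: centred_def)
  then have "L2_ip \<pi> h (\<lambda>_. c) = 0" for c
    using LIMSEQ_unique[OF lim[of c]] by auto
  from this[of 1] this[of \<i>] have "L2_inner \<pi> h (\<lambda>_. 1) = 0"
    by (subst (asm) (2) c) (simp add: complex_eq_iff)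
  with h show "\<exists>h\<in>centred. (\<lambda>n. L2_ip \<pi> (s n - h) (s n - h)) \<longlonglongrightarrow> 0"
    by (intro bexI[of _ h]) (simp_all add: centred_def)
qed (auto dest!: centred_L2 intro: L2.ip_add L2.ip_scale L2.ip_sym L2.ip_nonneg sq.T_sym sq.T_nonneg sq.T_le)

lemma gap_pow_eq: "gap_pow \<pi> P k = spectral_gap \<pi> (sq_op k)"
  by (simp add: gap_pow_def sq_op_def)

lemma gap_pow_bounds: "0 \<le> gap_pow \<pi> P k" "gap_pow \<pi> P k \<le> 1"
proof -
  define S where "S = {r. complex_of_real r \<in> L2_spectrum \<pi> (sq_op k) \<and> r \<noteq> 1}"
  have S: "0 \<le> r" "r \<le> 1" if "r \<in> S" for r
    using that spectrum_sq_op_real[of r k] by (auto simp: S_def)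
  have "0 \<le> Sup S" "Sup S \<le> 1" if "S \<noteq> {}"
  proof -
    obtain r where r: "r \<in> S" using \<open>S \<noteq> {}\<close> by blast
    have "bdd_above S" using S(2) by (rule bdd_aboveI)
    then show "0 \<le> Sup S" using r S(1)[of r] cSup_upper[of r S] by simp
    show "Sup S \<le> 1" using that S(2) by (rule cSup_least)
  qed
  then show "0 \<le> gap_pow \<pi> P k" "gap_pow \<pi> P k \<le> 1"
    unfolding gap_pow_eq spectral_gap_def S_def[symmetric] Let_def by auto
qed

text \<open>Both \<open>f\<close> and the constant 1 are multiples of the same eigenvector, so
  \<open>f\<close> is almost everywhere constant, and its mean is 0.\<close>

lemma fixed_centred_eq_0:
  assumes "eigenvalue_one_simple \<pi> (sq_op k)" and f: "f \<in> centred" "AE x in \<pi>. sq_op k f x = f x"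
  shows "L2_ip \<pi> f f = 0"
proof -
  obtain v where v: "\<And>f. f \<in> L2 \<pi> \<Longrightarrow> AE x in \<pi>. sq_op k f x = f x \<Longrightarrow> \<exists>c. AE x in \<pi>. f x = c * v x"
    using assms(1) unfolding eigenvalue_one_simple_def by blast
  obtain c where c: "AE x in \<pi>. f x = c * v x" using v[OF centred_L2[OF f(1)] f(2)] by blast
  obtain d where d: "AE x in \<pi>. 1 = d * v x"
    using v[OF const_L2[of 1] sq_op_one] by blast
  have const: "AE x in \<pi>. f x = c / d"
    using c d by eventually_elim (metis mult_eq_0_iff nonzero_mult_div_cancel_left one_neq_zero
        mult.commute mult.right_neutral mult.assoc nonzero_eq_divide_eq)
  have [measurable]: "f \<in> borel_measurable \<pi>" using f(1) by (intro L2_measurable centred_L2)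
  have "L2_inner \<pi> f (\<lambda>_. 1) = (\<integral>x. f x \<partial>\<pi>)" by (simp add: L2_inner_def)
  also have "\<dots> = (\<integral>x. c / d \<partial>\<pi>)" using const by (intro integral_cong_AE) auto
  also have "\<dots> = c / d" using prob_space by simp
  finally have "c / d = 0" using f(1) by (simp only: centred_def mem_Collect_eq)
  then have "AE x in \<pi>. f x = 0" using const by (simp only:)
  then show ?thesis using L2_ip_eq_0_iff[OF centred_L2[OF f(1)]] by simp
qed

text \<open>Every \<open>s\<close> strictly between \<open>a\<close> and 1 is outside the spectrum,
  because the supremum omits only the point 1. The resulting lower bounds are restricted to centred
  functions, on which 1 is no eigenvalue, and the form of \<open>sq_op k\<close> is the squared norm
  on the left.\<close>

theorem markov_op_pow_gap:
  assumes "gap_pow \<pi> P k > 0" and f: "f \<in> centred"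
  shows "L2_ip \<pi> ((markov_op P ^^ k) f) ((markov_op P ^^ k) f) \<le> (1 - gap_pow \<pi> P k) * L2_ip \<pi> f f"
proof -
  define S where "S = {r. complex_of_real r \<in> L2_spectrum \<pi> (sq_op k) \<and> r \<noteq> 1}"
  define a where "a = (if S = {} then 0 else Sup S)"
  have simple: "eigenvalue_one_simple \<pi> (sq_op k)" and gap: "gap_pow \<pi> P k = 1 - a"
    using assms(1) unfolding gap_pow_eq spectral_gap_def S_def[symmetric] Let_def a_def[symmetric]
    by (auto split: if_splits)
  have a: "0 \<le> a" "a < 1" using gap gap_pow_bounds[of k] assms(1) by auto
  interpret centred: positive_contraction centred "L2_ip \<pi>" "sq_op k"
    by (rule centred_contraction)
  have "L2_ip \<pi> (sq_op k f) f \<le> a * L2_ip \<pi> f f"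
  proof (rule centred.form_le_of_spectral_gap[OF a f])
    fix s assume s: "a < s" "s < 1"
    have "s \<notin> S"
    proof
      assume "s \<in> S"
      moreover have "bdd_above S"
        using spectrum_sq_op_real(2)[of _ k] by (intro bdd_aboveI) (auto simp: S_def)
      ultimately have "s \<le> a" using cSup_upper[of s S] by (auto simp: a_def)
      with s show False by simp
    qed
    with s have "complex_of_real s \<notin> L2_spectrum \<pi> (sq_op k)" by (auto simp: S_def)
    from resolvent_bounded_below[OF this] centred_L2
    show "\<exists>B. \<forall>f\<in>centred. L2.nrm f \<le> B * L2.nrm (s *\<^sub>R f - sq_op k f)" by blast
  next
    fix g assume g: "g \<in> centred" "L2_ip \<pi> (sq_op k g - g) (sq_op k g - g) = 0"
    then have "AE x in \<pi>. sq_op k g x = g x"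
      using centred_L2[OF g(1)] by (subst AE_eq_iff) (simp_all add: sq_op_L2)
    then show "L2_ip \<pi> g g = 0" using simple g(1) by (intro fixed_centred_eq_0)
  qed
  then show ?thesis using f by (simp add: gap sq_op_inner_left centred_L2)
qed

text \<open>Gaps are at most 1, so the \<open>k\<close>-th candidate is at most
  \<open>1 / k\<close>. Once some candidate is positive, only finitely many indices compete with it;
  otherwise all candidates are 0.\<close>

lemma pseudo_spectral_gap_attained:
  "\<exists>k\<ge>1. pseudo_spectral_gap \<pi> P = gap_pow \<pi> P k / real k"
proof -
  define G where "G k = gap_pow \<pi> P k / real k" for k
  have "\<exists>k\<ge>1. \<forall>j\<ge>1. G j \<le> G k"
  proof (cases "\<exists>k\<ge>1. G k > 0")
    case False
    then have "G j = 0" if "j \<ge> 1" for j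
      using that gap_pow_bounds(1)[of j] divide_nonneg_nonneg[of "gap_pow \<pi> P j" "real j"]
      by (metis G_def of_nat_0_le_iff order_le_less)
    then show ?thesis by (intro exI[of _ 1]) simp
  next
    case True
    then obtain k0 where k0: "k0 \<ge> 1" "G k0 > 0" by blast
    obtain K :: nat where K: "1 / G k0 < K" using reals_Archimedean2 by blast
    define A where "A = {1..max K k0}"
    have A: "finite A" "k0 \<in> A" using k0 by (auto simp: A_def)
    define m where "m = Max (G ` A)"
    have "m \<in> G ` A" unfolding m_def using A by (intro Max_in) auto
    then obtain k where k: "k \<in> A" "m = G k" by blast
    have "G j \<le> G k" if j: "j \<ge> 1" for j
    proof (cases "j \<in> A")
      case True
      then show ?thesis using A k(2) by (simp add: m_def flip: k(2))
    next
      case False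
      then have "j > K" using j by (auto simp: A_def)
      have "G j \<le> 1 / real j" unfolding G_def using gap_pow_bounds by (intro divide_right_mono) auto
      also have "\<dots> \<le> G k0"
      proof -
        have "1 < real K * G k0" using K k0 by (simp add: field_simps)
        also have "\<dots> \<le> real j * G k0" using \<open>j > K\<close> k0 by (intro mult_right_mono) auto
        finally show ?thesis using j by (simp add: field_simps)
      qed
      also have "\<dots> \<le> G k" using A by (simp add: m_def flip: k(2))
      finally show ?thesis .
    qed
    then show ?thesis using k by (intro exI[of _ k]) (auto simp: A_def)
  qed
  then obtain k where k: "k \<ge> 1" "\<And>j. j \<ge> 1 \<Longrightarrow> G j \<le> G k" by blast
  have "pseudo_spectral_gap \<pi> P = G k"
    unfolding pseudo_spectral_gap_def G_def[symmetric]
    using k by (intro Greatest_equality) auto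
  with k(1) show ?thesis by (auto simp: G_def)
qed

lemma k_ps:
  "k_ps \<pi> P \<ge> 1" "pseudo_spectral_gap \<pi> P = gap_pow \<pi> P (k_ps \<pi> P) / real (k_ps \<pi> P)"
  using LeastI_ex[OF pseudo_spectral_gap_attained] unfolding k_ps_def by blast+

end

section \<open>Exponential moments along a skeleton of the chain\<close>

context stationary_kernel
begin

text \<open>A class closed under products, exponentials and the kernel, on which all integrals exist
  at every point, so that identities hold everywhere. The functions of the theorem belong to it
  because they stay within \<open>C\<close> of their means.\<close>

definition bmeas :: "('a \<Rightarrow> real) set" where
  "bmeas = {f \<in> borel_measurable borel. \<exists>B. \<forall>x. \<bar>f x\<bar> \<le> B}"

lemma bmeasI: "\<lbrakk>f \<in> borel_measurable borel; \<And>x. \<bar>f x\<bar> \<le> B\<rbrakk> \<Longrightarrow> f \<in> bmeas"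
  by (auto simp: bmeas_def)

lemma bmeasE:
  assumes "f \<in> bmeas"
  obtains B where "B \<ge> 0" "\<And>x. \<bar>f x\<bar> \<le> B"
  using assms by (auto simp: bmeas_def) (metis abs_ge_zero order_trans)

lemma bmeas_measurable [measurable_dest]: "f \<in> bmeas \<Longrightarrow> f \<in> borel_measurable borel"
  by (simp add: bmeas_def)

lemma bmeas_const: "(\<lambda>x. c) \<in> bmeas"
  by (rule bmeasI[of _ "\<bar>c\<bar>"]) auto

lemma bmeas_mult:
  assumes "f \<in> bmeas" "g \<in> bmeas"
  shows "(\<lambda>x. f x * g x) \<in> bmeas"
proof -
  obtain A B where "A \<ge> 0" "\<And>x. \<bar>f x\<bar> \<le> A" "B \<ge> 0" "\<And>x. \<bar>g x\<bar> \<le> B"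
    using assms by (metis bmeasE)
  then show ?thesis
    using assms by (intro bmeasI[of _ "A * B"]) (auto simp: abs_mult intro: mult_mono bmeas_measurable)
qed

lemma bmeas_diff:
  assumes "f \<in> bmeas" "g \<in> bmeas"
  shows "(\<lambda>x. f x - g x) \<in> bmeas"
proof -
  obtain A B where AB: "\<And>x. \<bar>f x\<bar> \<le> A" "\<And>x. \<bar>g x\<bar> \<le> B"
    using assms by (metis bmeasE)
  have "\<bar>f x - g x\<bar> \<le> A + B" for x using AB[of x] by linarith
  then show ?thesis
    using assms by (intro bmeasI[of _ "A + B"]) (auto intro: bmeas_measurable)
qed

lemma bmeas_exp:
  assumes "f \<in> bmeas"
  shows "(\<lambda>x. exp (f x)) \<in> bmeas"
proof -
  obtain A where A: "\<And>x. \<bar>f x\<bar> \<le> A" using assms by (metis bmeasE)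
  have "f x \<le> A" for x using A[of x] by linarith
  then show ?thesis using assms by (intro bmeasI[of _ "exp A"]) (auto intro: bmeas_measurable)
qed

lemma bmeas_square: "f \<in> bmeas \<Longrightarrow> (\<lambda>x. (f x)\<^sup>2) \<in> bmeas"
  unfolding power2_eq_square by (rule bmeas_mult)

lemma bmeas_integrable: "f \<in> bmeas \<Longrightarrow> integrable \<pi> f"
  by (rule bmeasE, assumption, rule integrable_const_bound) (auto intro: bmeas_measurable)

lemma bmeas_integrable_P:
  assumes "f \<in> bmeas"
  shows "integrable (P x) f"
proof -
  interpret Px: prob_space "P x" by (rule prob_space_P)
  obtain B where "\<And>x. \<bar>f x\<bar> \<le> B" using assms by (metis bmeasE)
  then show ?thesis
    using assms by (intro Px.integrable_const_bound[of _ B]) (auto intro: bmeas_measurable)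
qed

lemmas bmeas_intros = bmeas_const bmeas_mult bmeas_diff bmeas_exp bmeas_square

definition kernel_op :: "('a \<Rightarrow> real) \<Rightarrow> 'a \<Rightarrow> real" where
  "kernel_op f = (\<lambda>x. \<integral>y. f y \<partial>P x)"

lemma kernel_op_bmeas:
  assumes "f \<in> bmeas"
  shows "kernel_op f \<in> bmeas"
proof -
  obtain B where B: "\<And>x. \<bar>f x\<bar> \<le> B" using assms by (metis bmeasE)
  show ?thesis
  proof (rule bmeasI[of _ B])
    have [measurable]: "f \<in> borel_measurable borel" using assms by (rule bmeas_measurable)
    show "kernel_op f \<in> borel_measurable borel"
      unfolding kernel_op_def
      by (rule measurable_compose[OF P_subprob integral_measurable_subprob_algebra]) simp
    fix x
    interpret Px: prob_space "P x" by (rule prob_space_P)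
    have "\<bar>kernel_op f x\<bar> \<le> (\<integral>y. \<bar>f y\<bar> \<partial>P x)"
      unfolding kernel_op_def by (rule integral_abs_bound)
    also have "\<dots> \<le> (\<integral>y. B \<partial>P x)"
      using assms B by (intro integral_mono integrable_abs bmeas_integrable_P bmeas_const) auto
    also have "\<dots> = B" using Px.prob_space by simp
    finally show "\<bar>kernel_op f x\<bar> \<le> B" .
  qed
qed

lemma kernel_op_pow_bmeas: "f \<in> bmeas \<Longrightarrow> (kernel_op ^^ k) f \<in> bmeas"
  by (induction k) (simp_all add: kernel_op_bmeas)

lemma kernel_op_diff_const:
  assumes "f \<in> bmeas"
  shows "kernel_op (\<lambda>x. f x - c) = (\<lambda>x. kernel_op f x - c)"
proof
  fix x
  interpret Px: prob_space "P x" by (rule prob_space_P)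
  show "kernel_op (\<lambda>x. f x - c) x = kernel_op f x - c"
    using bmeas_integrable_P[OF assms] Px.prob_space by (simp add: kernel_op_def)
qed

lemma kernel_op_pow_diff_const:
  "f \<in> bmeas \<Longrightarrow> (kernel_op ^^ k) (\<lambda>x. f x - c) = (\<lambda>x. (kernel_op ^^ k) f x - c)"
  by (induction k) (simp_all add: kernel_op_diff_const kernel_op_pow_bmeas)

lemma integral_kernel_op:
  assumes "f \<in> bmeas"
  shows "(\<integral>x. kernel_op f x \<partial>\<pi>) = (\<integral>x. f x \<partial>\<pi>)"
proof -
  obtain B where B: "\<And>x. \<bar>f x\<bar> \<le> B" using assms by (metis bmeasE)
  have "(\<integral>x. f x \<partial>(\<pi> \<bind> P)) = (\<integral>x. \<integral>y. f y \<partial>P x \<partial>\<pi>)"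
  proof (rule integral_bind[where K = borel and B = B and B' = 1])
    show "AE x in \<pi>. emeasure (P x) (space (P x)) \<le> ennreal 1"
      using prob_space.emeasure_space_1[OF prob_space_P] by simp
  qed (use assms B in \<open>auto intro: bmeas_measurable finite_measure_axioms\<close>)
  then show ?thesis using stationary by (simp add: kernel_op_def stationary_distribution_def)
qed

lemma integral_kernel_op_pow: "f \<in> bmeas \<Longrightarrow> (\<integral>x. (kernel_op ^^ k) f x \<partial>\<pi>) = (\<integral>x. f x \<partial>\<pi>)"
  by (induction k) (simp_all add: integral_kernel_op kernel_op_pow_bmeas)

lemma markov_op_of_real: "markov_op P (\<lambda>x. complex_of_real (f x)) = (\<lambda>x. of_real (kernel_op f x))"
  by (simp add: markov_op_def kernel_op_def)

lemma markov_op_pow_of_real: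
  "(markov_op P ^^ k) (\<lambda>x. complex_of_real (f x)) = (\<lambda>x. of_real ((kernel_op ^^ k) f x))"
  by (induction k) (simp_all add: markov_op_of_real)

lemma bmeas_L2: "f \<in> bmeas \<Longrightarrow> (\<lambda>x. complex_of_real (f x)) \<in> L2 \<pi>"
  using bmeas_integrable[OF bmeas_square] by (simp add: L2_def bmeas_measurable)

lemma L2_inner_of_real:
  "L2_inner \<pi> (\<lambda>x. complex_of_real (f x)) (\<lambda>x. complex_of_real (g x)) = of_real (\<integral>x. f x * g x \<partial>\<pi>)"
  unfolding L2_inner_def by (simp flip: of_real_mult)

lemma integral_Cauchy_Schwarz:
  assumes "f \<in> bmeas" "g \<in> bmeas"
  shows "(\<integral>x. f x * g x \<partial>\<pi>)\<^sup>2 \<le> (\<integral>x. (f x)\<^sup>2 \<partial>\<pi>) * (\<integral>x. (g x)\<^sup>2 \<partial>\<pi>)"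
  using L2.Cauchy_Schwarz[OF bmeas_L2 bmeas_L2, OF assms]
  by (simp add: L2_inner_of_real power2_eq_square)

text \<open>
  The quadratic form of the operator \<open>l I + (1 - l) \<Pi>\<close>, where \<open>\<Pi>\<close> is the projection onto the
  constants.
\<close>

definition form :: "real \<Rightarrow> ('a \<Rightarrow> real) \<Rightarrow> real" where
  "form l u = (1 - l) * (\<integral>x. u x \<partial>\<pi>)\<^sup>2 + l * (\<integral>x. (u x)\<^sup>2 \<partial>\<pi>)"

lemma form_eq: "form l u = (\<integral>x. u x \<partial>\<pi>)\<^sup>2 + l * ((\<integral>x. (u x)\<^sup>2 \<partial>\<pi>) - (\<integral>x. u x \<partial>\<pi>)\<^sup>2)"
  by (simp add: form_def algebra_simps)

lemma integral_centred_sq: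
  assumes "u \<in> bmeas"
  shows "(\<integral>x. (u x - expectation u)\<^sup>2 \<partial>\<pi>) = (\<integral>x. (u x)\<^sup>2 \<partial>\<pi>) - (expectation u)\<^sup>2"
  using assms by (intro variance_eq bmeas_integrable bmeas_square)

lemma expectation_sq_le_form:
  assumes "u \<in> bmeas" "0 \<le> l"
  shows "(\<integral>x. u x \<partial>\<pi>)\<^sup>2 \<le> form l u"
  using variance_positive[of u] integral_centred_sq[OF assms(1)] assms(2) by (simp add: form_eq)

text \<open>Split off the means \<open>a\<close> and \<open>b\<close>. Stationarity kills the cross
  terms, and the gap bounds the centred part by \<open>l * sqrt A * sqrt B\<close>. What remains is
  Cauchy-Schwarz in the plane for \<open>(a, sqrt (l * A))\<close> and
  \<open>(b, sqrt (l * B))\<close>.\<close>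

lemma kernel_op_pow_form_bound:
  assumes u: "u \<in> bmeas" and v: "v \<in> bmeas"
    and gap: "gap_pow \<pi> P k > 0" and l: "0 \<le> l" "1 - gap_pow \<pi> P k \<le> l\<^sup>2"
  shows "(\<integral>x. u x * (kernel_op ^^ k) v x \<partial>\<pi>) \<le> sqrt (form l u) * sqrt (form l v)"
proof -
  define a where "a = expectation u"
  define b where "b = expectation v"
  define u0 where "u0 x = u x - a" for x
  define v0 where "v0 x = v x - b" for x
  have u0: "u0 \<in> bmeas" and v0: "v0 \<in> bmeas"
    unfolding u0_def v0_def using u v by (auto intro: bmeas_intros)
  define w where "w = (kernel_op ^^ k) v0"
  have w: "w \<in> bmeas" unfolding w_def using v0 by (rule kernel_op_pow_bmeas)
  have v_eq: "(kernel_op ^^ k) v x = b + w x" for x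
    unfolding w_def v0_def by (simp add: kernel_op_pow_diff_const[OF v])
  have int_u0: "expectation u0 = 0" unfolding u0_def a_def
    using bmeas_integrable[OF u] prob_space by simp
  have int_v0: "expectation v0 = 0" unfolding v0_def b_def
    using bmeas_integrable[OF v] prob_space by simp
  have int_w: "expectation w = 0"
    unfolding w_def using integral_kernel_op_pow[OF v0] int_v0 by simp
  define s where "s = (\<integral>x. u0 x * w x \<partial>\<pi>)"
  have "u x * (kernel_op ^^ k) v x = a * b + a * w x + b * u0 x + u0 x * w x" for x
    by (simp add: v_eq u0_def algebra_simps)
  then have split: "(\<integral>x. u x * (kernel_op ^^ k) v x \<partial>\<pi>) = a * b + s"
    using bmeas_integrable[OF w] bmeas_integrable[OF u0] bmeas_integrable[OF bmeas_mult[OF u0 w]]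
      int_w int_u0 prob_space by (simp add: s_def)
  define A where "A = (\<integral>x. (u0 x)\<^sup>2 \<partial>\<pi>)"
  define B where "B = (\<integral>x. (v0 x)\<^sup>2 \<partial>\<pi>)"
  have AB: "A \<ge> 0" "B \<ge> 0" unfolding A_def B_def by simp_all
  have "(\<lambda>x. complex_of_real (v0 x)) \<in> centred"
    using bmeas_L2[OF v0] int_v0 L2_inner_of_real[of v0 "\<lambda>_. 1"] by (simp add: centred_def)
  from markov_op_pow_gap[OF gap this]
  have "(\<integral>x. (w x)\<^sup>2 \<partial>\<pi>) \<le> (1 - gap_pow \<pi> P k) * B"
    by (simp add: markov_op_pow_of_real L2_inner_of_real w_def B_def power2_eq_square)
  also have "\<dots> \<le> l\<^sup>2 * B" using l AB by (intro mult_right_mono)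
  finally have wB: "(\<integral>x. (w x)\<^sup>2 \<partial>\<pi>) \<le> l\<^sup>2 * B" .
  have "s\<^sup>2 \<le> A * (\<integral>x. (w x)\<^sup>2 \<partial>\<pi>)"
    unfolding s_def A_def by (rule integral_Cauchy_Schwarz[OF u0 w])
  also have "\<dots> \<le> A * (l\<^sup>2 * B)" using wB AB by (intro mult_left_mono)
  finally have s2: "s\<^sup>2 \<le> (l * sqrt A * sqrt B)\<^sup>2" using AB by (simp add: power_mult_distrib mult_ac)
  have s_le: "s \<le> (l * sqrt A) * sqrt B"
    by (rule power2_le_imp_le[OF s2]) (use l AB in simp)
  have "a * b + s \<le> sqrt (a\<^sup>2 + l * A) * sqrt (b\<^sup>2 + l * B)"
  proof -
    have "(a * b + l * sqrt A * sqrt B)\<^sup>2 \<le> (a\<^sup>2 + l * A) * (b\<^sup>2 + l * B)"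
    proof -
      have "(a\<^sup>2 + l * A) * (b\<^sup>2 + l * B) - (a * b + l * sqrt A * sqrt B)\<^sup>2
          = l * (a * sqrt B - b * sqrt A)\<^sup>2"
        using AB by (simp add: power2_eq_square algebra_simps)
      then show ?thesis using l(1) by (smt (verit) mult_nonneg_nonneg zero_le_power2)
    qed
    then have "a * b + l * sqrt A * sqrt B \<le> sqrt ((a\<^sup>2 + l * A) * (b\<^sup>2 + l * B))"
      by (rule real_le_rsqrt)
    then show ?thesis using s_le by (simp add: real_sqrt_mult)
  qed
  moreover have "form l u = a\<^sup>2 + l * A" "form l v = b\<^sup>2 + l * B"
    unfolding form_eq A_def B_def u0_def v0_def a_def b_def
    using integral_centred_sq[OF u] integral_centred_sq[OF v] by simp_all
  ultimately show ?thesis using split by simp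
qed

text \<open>
  Multiplication by \<open>e\<close> turns the form into a rank one perturbation of a multiplication operator,
  so that its largest eigenvalue \<open>\<rho>\<close> solves \<open>g E[1 / (\<rho> / e - (1 - g))] = 1\<close>.  It is enough to
  have \<open>\<le>\<close> there, and \<open>exp y \<ge> 1 + y\<close> shows this for \<open>\<rho> = exp h\<close>.
\<close>

lemma form_exp_bound:
  assumes f: "f \<in> bmeas" "expectation f = 0" "\<And>x. \<bar>f x\<bar> \<le> C"
    and t: "0 \<le> t" "t * C < g" "g \<le> 1" and w: "w \<in> bmeas"
  defines "h \<equiv> t\<^sup>2 * (\<integral>x. (f x)\<^sup>2 \<partial>\<pi>) / (g - t * C)"
  shows "form (1 - g) (\<lambda>x. exp (t * f x) * w x) \<le> exp h * (\<integral>x. exp (t * f x) * (w x)\<^sup>2 \<partial>\<pi>)"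
proof -
  define V where "V = (\<integral>x. (f x)\<^sup>2 \<partial>\<pi>)"
  have V: "V \<ge> 0" by (simp add: V_def)
  have C: "C \<ge> 0" using f(3)[of undefined] by linarith
  have g: "g > 0" using t C by (smt (verit) mult_nonneg_nonneg)
  have h: "h \<ge> 0" "h * (g - t * C) = t\<^sup>2 * V" using V t(2) by (simp_all add: h_def V_def)
  \<comment> \<open>The denominator \<open>\<rho> / e - (1 - g)\<close> for
    \<open>\<rho> = exp h\<close>. The constant \<open>c\<close> bounds it from below and is
    positive because \<open>t * C < g\<close>.\<close>
  define D where "D x = exp (h - t * f x) - (1 - g)" for x
  define c where "c = g + h - t * C"
  have c: "c > 0" using h t by (simp add: c_def)
  have tf: "t * f x \<le> t * C" for x using f(3)[of x] t(1) by (intro mult_left_mono) auto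
  have D_ge: "g + h - t * f x \<le> D x" for x
    using exp_ge_add_one_self[of "h - t * f x"] unfolding D_def by linarith
  have D_ge_c: "c \<le> D x" for x using D_ge[of x] tf[of x] by (simp add: c_def)
  have tf_bm: "(\<lambda>x. t * f x) \<in> bmeas" using f(1) by (intro bmeas_intros)
  have D_bm: "D \<in> bmeas" unfolding D_def using f(1) by (intro bmeas_intros)
  have invD_bm: "(\<lambda>x. 1 / sqrt (D x)) \<in> bmeas"
  proof (rule bmeasI[of _ "1 / sqrt c"])
    show "\<bar>1 / sqrt (D x)\<bar> \<le> 1 / sqrt c" for x
      using D_ge_c[of x] c by (simp add: frac_le)
  qed (use bmeas_measurable[OF D_bm] in measurable)
  have sqD_bm: "(\<lambda>x. sqrt (D x)) \<in> bmeas"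
  proof -
    obtain B where B: "\<And>x. \<bar>D x\<bar> \<le> B" using D_bm by (metis bmeasE)
    show ?thesis
    proof (rule bmeasI[of _ "sqrt B"])
      show "\<bar>sqrt (D x)\<bar> \<le> sqrt B" for x using B[of x] D_ge_c[of x] c by simp
    qed (use bmeas_measurable[OF D_bm] in measurable)
  qed
  define u where "u x = exp (t * f x) * w x" for x
  have u_bm: "u \<in> bmeas" unfolding u_def using f(1) w by (intro bmeas_intros)
  have D_pos: "D x > 0" for x using D_ge_c[of x] c by simp
  \<comment> \<open>Cauchy-Schwarz with weight \<open>D\<close>: one factor is the scalar quantity
    to be bounded by \<open>1 / g\<close>, the other unfolds to the claim.\<close>
  have "(\<integral>x. u x \<partial>\<pi>)\<^sup>2 = (\<integral>x. (u x * sqrt (D x)) * (1 / sqrt (D x)) \<partial>\<pi>)\<^sup>2"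
    using D_pos by (simp add: less_imp_neq[THEN not_sym])
  also have "\<dots> \<le> (\<integral>x. (u x * sqrt (D x))\<^sup>2 \<partial>\<pi>) * (\<integral>x. (1 / sqrt (D x))\<^sup>2 \<partial>\<pi>)"
    by (intro integral_Cauchy_Schwarz bmeas_mult u_bm sqD_bm invD_bm)
  also have "\<dots> = (\<integral>x. (u x)\<^sup>2 * D x \<partial>\<pi>) * (\<integral>x. 1 / D x \<partial>\<pi>)"
    using D_pos by (simp add: power_mult_distrib power_divide less_imp_le)
  finally have CS: "(\<integral>x. u x \<partial>\<pi>)\<^sup>2 \<le> (\<integral>x. (u x)\<^sup>2 * D x \<partial>\<pi>) * (\<integral>x. 1 / D x \<partial>\<pi>)" .
  \<comment> \<open>Expansion of \<open>1 / y\<close> around \<open>g\<close> with exact second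
    order remainder, whose denominator is then bounded by means of \<open>y \<ge> c\<close>. On
    integration the terms linear in \<open>f\<close> vanish.\<close>
  have "1 / D x \<le> 1 / g + (t * f x - h) / g\<^sup>2 + (t\<^sup>2 * (f x)\<^sup>2 - 2 * h * t * f x + h\<^sup>2) / (g\<^sup>2 * c)" for x
  proof -
    define y where "y = g + h - t * f x"
    have y: "y \<ge> c" using tf[of x] by (simp add: y_def c_def)
    have "1 / D x \<le> 1 / y" using D_ge[of x] y c by (simp add: y_def frac_le)
    also have "\<dots> = 1 / g + (t * f x - h) / g\<^sup>2 + (t * f x - h)\<^sup>2 / (g\<^sup>2 * y)"
    proof -
      have "t * f x - h = g - y" by (simp add: y_def)
      then show ?thesis using g y c by (simp only:) (simp add: field_simps power2_eq_square)
    qed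
    also have "(t * f x - h)\<^sup>2 / (g\<^sup>2 * y) \<le> (t * f x - h)\<^sup>2 / (g\<^sup>2 * c)"
      using g y c by (intro divide_left_mono mult_left_mono) auto
    also have "(t * f x - h)\<^sup>2 = t\<^sup>2 * (f x)\<^sup>2 - 2 * h * t * f x + h\<^sup>2"
      by (simp add: power2_eq_square algebra_simps)
    finally show ?thesis by simp
  qed
  moreover have "(\<lambda>x. 1 / D x) \<in> bmeas"
    using bmeas_square[OF invD_bm] D_pos by (simp add: power_divide less_imp_le)
  ultimately have "(\<integral>x. 1 / D x \<partial>\<pi>) \<le>
      (\<integral>x. 1 / g + (t * f x - h) / g\<^sup>2 + (t\<^sup>2 * (f x)\<^sup>2 - 2 * h * t * f x + h\<^sup>2) / (g\<^sup>2 * c) \<partial>\<pi>)"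
    using bmeas_integrable[OF f(1)] bmeas_integrable[OF bmeas_square[OF f(1)]]
    by (intro integral_mono) (auto intro: bmeas_integrable)
  also have "\<dots> = 1 / g - h / g\<^sup>2 + (t\<^sup>2 * V + h\<^sup>2) / (g\<^sup>2 * c)"
    using bmeas_integrable[OF f(1)] bmeas_integrable[OF bmeas_square[OF f(1)]] f(2) prob_space
    by (simp add: V_def)
  \<comment> \<open>Here the choice of \<open>h\<close> enters: it solves
    \<open>h * (g - t * C) = t\<^sup>2 * V\<close>, so that the second order term equals
    \<open>h / g\<^sup>2\<close> and cancels the first order one.\<close>
  also have "t\<^sup>2 * V + h\<^sup>2 = h * c" using h(2) by (simp add: c_def power2_eq_square algebra_simps)
  also have "1 / g - h / g\<^sup>2 + h * c / (g\<^sup>2 * c) = 1 / g" using c by simp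
  finally have invD: "(\<integral>x. 1 / D x \<partial>\<pi>) \<le> 1 / g" .
  have "g * (\<integral>x. u x \<partial>\<pi>)\<^sup>2 \<le> g * ((\<integral>x. (u x)\<^sup>2 * D x \<partial>\<pi>) * (1 / g))"
    using g D_pos by (intro mult_left_mono order_trans[OF CS] invD integral_nonneg) (auto simp: less_imp_le)
  also have "\<dots> = (\<integral>x. (u x)\<^sup>2 * D x \<partial>\<pi>)" using g by simp
  also have "\<dots> = (\<integral>x. exp h * (exp (t * f x) * (w x)\<^sup>2) - (1 - g) * (u x)\<^sup>2 \<partial>\<pi>)"
  proof (rule Bochner_Integration.integral_cong[OF refl])
    fix x
    have "(u x)\<^sup>2 * exp (h - t * f x) = exp h * (exp (t * f x) * (w x)\<^sup>2)"
      by (simp add: u_def exp_diff power2_eq_square)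
    then show "(u x)\<^sup>2 * D x = exp h * (exp (t * f x) * (w x)\<^sup>2) - (1 - g) * (u x)\<^sup>2"
      by (simp add: D_def algebra_simps)
  qed
  also have "\<dots> = exp h * (\<integral>x. exp (t * f x) * (w x)\<^sup>2 \<partial>\<pi>) - (1 - g) * (\<integral>x. (u x)\<^sup>2 \<partial>\<pi>)"
    using bmeas_integrable[OF bmeas_mult[OF bmeas_exp[OF tf_bm] bmeas_square[OF w]]]
      bmeas_integrable[OF bmeas_square[OF u_bm]] by simp
  finally show ?thesis by (simp add: form_def flip: u_def)
qed

text \<open>The conditional expectation of the product of \<open>e j (X (i + j * k))\<close> over
  \<open>j \<le> m\<close>, given that the chain is at the argument at time
  \<open>i\<close>.\<close>

primrec skeleton_prod :: "nat \<Rightarrow> nat \<Rightarrow> (nat \<Rightarrow> 'a \<Rightarrow> real) \<Rightarrow> 'a \<Rightarrow> real" where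
  "skeleton_prod k 0 e = e 0"
| "skeleton_prod k (Suc m) e = (\<lambda>x. e 0 x * (kernel_op ^^ k) (skeleton_prod k m (\<lambda>j. e (Suc j))) x)"

lemma skeleton_prod_bmeas: "(\<And>j. j \<le> m \<Longrightarrow> e j \<in> bmeas) \<Longrightarrow> skeleton_prod k m e \<in> bmeas"
  by (induction m arbitrary: e) (auto intro!: bmeas_mult kernel_op_pow_bmeas)

text \<open>Let \<open>e\<close> be the first factor, \<open>w\<close> the \<open>k\<close>-step
  image of the remaining product \<open>V\<close>, and \<open>N\<close> the form of
  \<open>e w\<close>. Then \<open>N\<close> is at most \<rho> times the integral of
  \<open>e w\<^sup>2\<close>, which is the pairing of \<open>e w\<close> with the
  \<open>k\<close>-step image of \<open>V\<close> and hence at most \<surd>N times the root of the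
  form of \<open>V\<close>. Cancelling \<surd>N leaves one factor \<rho> for each time.\<close>

theorem expectation_skeleton_prod_le:
  assumes gap: "gap_pow \<pi> P k > 0"
    and f: "\<And>j. j \<le> m \<Longrightarrow> f j \<in> bmeas" "\<And>j. j \<le> m \<Longrightarrow> expectation (f j) = 0"
      "\<And>j x. j \<le> m \<Longrightarrow> \<bar>f j x\<bar> \<le> C"
    and t: "0 \<le> t" "t * C < gap_pow \<pi> P k / 2"
  shows "expectation (skeleton_prod k m (\<lambda>j x. exp (t * f j x)))
    \<le> exp (t\<^sup>2 * (\<Sum>j\<le>m. \<integral>x. (f j x)\<^sup>2 \<partial>\<pi>) / (gap_pow \<pi> P k / 2 - t * C))"
proof -
  define g where "g = gap_pow \<pi> P k / 2"
  have g: "0 < g" "g \<le> 1" "t * C < g" using gap gap_pow_bounds[of k] t by (simp_all add: g_def)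
  have l: "0 \<le> 1 - g" "1 - gap_pow \<pi> P k \<le> (1 - g)\<^sup>2"
    using g by (simp_all add: power2_eq_square algebra_simps) (simp add: g_def)
  have form_nonneg: "0 \<le> form (1 - g) u" if "u \<in> bmeas" for u
    using expectation_sq_le_form[OF that l(1)] by (smt (verit) zero_le_power2)
  have key: "sqrt (form (1 - g) (skeleton_prod k m (\<lambda>j x. exp (t * f j x))))
      \<le> exp (\<Sum>j\<le>m. t\<^sup>2 * (\<integral>x. (f j x)\<^sup>2 \<partial>\<pi>) / (g - t * C))"
    using f
  proof (induction m arbitrary: f)
    case 0
    define N where "N = form (1 - g) (\<lambda>x. exp (t * f 0 x))"
    define \<rho> where "\<rho> = exp (t\<^sup>2 * (\<integral>x. (f 0 x)\<^sup>2 \<partial>\<pi>) / (g - t * C))"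
    have e: "(\<lambda>x. exp (t * f 0 x)) \<in> bmeas" using 0 by (intro bmeas_intros) simp
    have N: "N \<ge> 0" unfolding N_def by (rule form_nonneg[OF e])
    \<comment> \<open>The last factor has \<open>w = 1\<close>, and its mean is itself at most
      \<surd>N, so the same cancellation applies.\<close>
    have "N \<le> \<rho> * expectation (\<lambda>x. exp (t * f 0 x))"
      using form_exp_bound[of "f 0" C t g "\<lambda>_. 1"] 0 t(1) g bmeas_const by (simp add: N_def \<rho>_def)
    also have "\<dots> \<le> \<rho> * sqrt N"
      unfolding N_def using expectation_sq_le_form[OF e l(1)]
      by (intro mult_left_mono real_le_rsqrt) (auto simp: \<rho>_def)
    finally have "sqrt N * sqrt N \<le> \<rho> * sqrt N" using N by simp
    then have "sqrt N \<le> \<rho>"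
      using N mult_right_le_imp_le[of "sqrt N" "sqrt N" \<rho>] by (cases "N = 0") (simp_all add: \<rho>_def)
    then show ?case by (simp add: N_def \<rho>_def)
  next
    case (Suc m)
    define V where "V = skeleton_prod k m (\<lambda>j x. exp (t * f (Suc j) x))"
    define w where "w = (kernel_op ^^ k) V"
    define \<rho> where "\<rho> = exp (t\<^sup>2 * (\<integral>x. (f 0 x)\<^sup>2 \<partial>\<pi>) / (g - t * C))"
    define N where "N = form (1 - g) (\<lambda>x. exp (t * f 0 x) * w x)"
    have V: "V \<in> bmeas" unfolding V_def using Suc.prems by (intro skeleton_prod_bmeas bmeas_intros) simp
    have w: "w \<in> bmeas" unfolding w_def using V by (rule kernel_op_pow_bmeas)
    have e: "(\<lambda>x. exp (t * f 0 x) * w x) \<in> bmeas" using Suc.prems w by (intro bmeas_intros) simp_all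
    have N: "N \<ge> 0" unfolding N_def by (rule form_nonneg[OF e])
    have "N \<le> \<rho> * (\<integral>x. exp (t * f 0 x) * (w x)\<^sup>2 \<partial>\<pi>)"
      unfolding N_def \<rho>_def using Suc.prems t(1) g w by (intro form_exp_bound) auto
    also have "\<dots> = \<rho> * (\<integral>x. (exp (t * f 0 x) * w x) * (kernel_op ^^ k) V x \<partial>\<pi>)"
      by (simp add: power2_eq_square mult.assoc flip: w_def)
    also have "\<dots> \<le> \<rho> * (sqrt N * sqrt (form (1 - g) V))"
      unfolding N_def using kernel_op_pow_form_bound[OF e V gap l]
      by (intro mult_left_mono) (auto simp: \<rho>_def)
    finally have "sqrt N * sqrt N \<le> (\<rho> * sqrt (form (1 - g) V)) * sqrt N" using N by (simp add: mult_ac)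
    moreover have "sqrt (form (1 - g) V) \<ge> 0" using form_nonneg[OF V] by simp
    ultimately have "sqrt N \<le> \<rho> * sqrt (form (1 - g) V)"
      using N mult_right_le_imp_le[of "sqrt N" "sqrt N" "\<rho> * sqrt (form (1 - g) V)"]
      by (cases "N = 0") (simp_all add: \<rho>_def)
    also have "\<dots> \<le> \<rho> * exp (\<Sum>j\<le>m. t\<^sup>2 * (\<integral>x. (f (Suc j) x)\<^sup>2 \<partial>\<pi>) / (g - t * C))"
      unfolding V_def using Suc.IH[of "\<lambda>j. f (Suc j)"] Suc.prems
      by (intro mult_left_mono) (auto simp: \<rho>_def)
    also have "\<dots> = exp (\<Sum>j\<le>Suc m. t\<^sup>2 * (\<integral>x. (f j x)\<^sup>2 \<partial>\<pi>) / (g - t * C))"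
      unfolding \<rho>_def sum.atMost_Suc_shift by (simp add: exp_add)
    finally show ?case by (simp add: N_def w_def V_def)
  qed
  have bm: "skeleton_prod k m (\<lambda>j x. exp (t * f j x)) \<in> bmeas"
    using f by (intro skeleton_prod_bmeas bmeas_intros) simp
  have "expectation (skeleton_prod k m (\<lambda>j x. exp (t * f j x)))
      \<le> sqrt (form (1 - g) (skeleton_prod k m (\<lambda>j x. exp (t * f j x))))"
    by (intro real_le_rsqrt expectation_sq_le_form bm l)
  also note key
  also have "(\<Sum>j\<le>m. t\<^sup>2 * (\<integral>x. (f j x)\<^sup>2 \<partial>\<pi>) / (g - t * C)) = t\<^sup>2 * (\<Sum>j\<le>m. \<integral>x. (f j x)\<^sup>2 \<partial>\<pi>) / (g - t * C)"
    by (simp add: sum_distrib_left sum_divide_distrib)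
  finally show ?thesis by (simp add: g_def)
qed

end

section \<open>The stationary chain\<close>

locale stationary_chain = stationary_kernel P \<pi>
  for P :: "'a::polish_space \<Rightarrow> 'a measure" and \<pi> :: "'a measure" +
  fixes W :: "'w measure" and X :: "nat \<Rightarrow> 'w \<Rightarrow> 'a" and n :: nat
  assumes n_ge_1: "n \<ge> 1"
    and chain: "markov_chain W X n P"
    and initial: "distr W borel (X 1) = \<pi>"
begin

sublocale W: prob_space W
  using chain by (simp add: markov_chain_def)

lemma X_measurable: "i \<in> {1..n} \<Longrightarrow> X i \<in> W \<rightarrow>\<^sub>M borel"
  using chain by (simp add: markov_chain_def)

lemma space_past [simp]: "space (past W X i) = space W"
  by (simp add: past_def)

section \<open>The past of the chain and the Markov property for bounded functions\<close>

lemma X_past: "j \<in> {1..i} \<Longrightarrow> X j \<in> past W X i \<rightarrow>\<^sub>M borel"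
proof -
  assume j: "j \<in> {1..i}"
  have "(\<lambda>\<omega>. \<lambda>j\<in>{1..i}. X j \<omega>) \<in> past W X i \<rightarrow>\<^sub>M PiM {1..i} (\<lambda>_. borel)"
    unfolding past_def by (rule measurable_vimage_algebra1) (auto simp: space_PiM)
  then have "(\<lambda>\<omega>. (\<lambda>j\<in>{1..i}. X j \<omega>) j) \<in> past W X i \<rightarrow>\<^sub>M borel"
    using j by (rule measurable_compose[OF _ measurable_component_singleton])
  then show ?thesis using j by simp
qed

text \<open>Measurability of the identity expresses inclusion of \<sigma>-algebras; it serves both
  for monotonicity of the past and for its being a subalgebra.\<close>

lemma id_measurable_past:
  assumes "space N = space W" "\<And>j. j \<in> {1..i} \<Longrightarrow> X j \<in> N \<rightarrow>\<^sub>M borel"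
  shows "(\<lambda>\<omega>. \<omega>) \<in> N \<rightarrow>\<^sub>M past W X i"
  unfolding past_def using assms by (intro measurable_vimage_algebra2 measurable_restrict) auto

lemma past_mono:
  assumes "Z \<in> borel_measurable (past W X i)" "i \<le> j"
  shows "Z \<in> borel_measurable (past W X j)"
proof -
  have "(\<lambda>\<omega>. \<omega>) \<in> past W X j \<rightarrow>\<^sub>M past W X i"
    using assms(2) by (intro id_measurable_past X_past) auto
  from measurable_compose[OF this assms(1)] show ?thesis by simp
qed

lemma past_subalgebra:
  assumes "i \<le> n"
  shows "subalgebra W (past W X i)"
proof -
  have "(\<lambda>\<omega>. \<omega>) \<in> W \<rightarrow>\<^sub>M past W X i" using assms by (intro id_measurable_past X_measurable) auto
  from measurable_sets[OF this] have "A \<in> sets W" if "A \<in> sets (past W X i)" for A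
  proof -
    have "(\<lambda>\<omega>. \<omega>) -` A \<inter> space W = A" using sets.sets_into_space[OF that] by auto
    then show ?thesis using \<open>\<And>A. A \<in> sets (past W X i) \<Longrightarrow> (\<lambda>\<omega>. \<omega>) -` A \<inter> space W \<in> sets W\<close>[OF that] by simp
  qed
  then show ?thesis by (auto simp: subalgebra_def)
qed

lemma past_measurable:
  "\<lbrakk>Z \<in> borel_measurable (past W X i); i \<le> n\<rbrakk> \<Longrightarrow> Z \<in> borel_measurable W"
  using measurable_from_subalg[OF past_subalgebra] by blast

lemma bounded_integrable_W: "\<lbrakk>Z \<in> borel_measurable W; \<And>\<omega>. \<bar>Z \<omega>\<bar> \<le> B\<rbrakk> \<Longrightarrow> integrable W Z"
  for Z :: "'w \<Rightarrow> real"
  by (intro W.integrable_const_bound[of _ B]) auto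

text \<open>\<open>markov_chain\<close> describes transitions on sets only. Weighting
  \<open>W\<close> by \<open>Z\<close> turns the claim into equality of two measures, the image of
  \<open>X (Suc i)\<close> and the image of \<open>X i\<close> followed by \<open>P\<close>; these
  are compared on sets and then integrate \<open>g\<close>.\<close>

lemma markov_step:
  assumes i: "1 \<le> i" "Suc i \<le> n"
    and Z: "Z \<in> borel_measurable (past W X i)" "\<And>\<omega>. 0 \<le> Z \<omega>" "\<And>\<omega>. Z \<omega> \<le> B"
    and g: "g \<in> bmeas"
  shows "(\<integral>\<omega>. Z \<omega> * g (X (Suc i) \<omega>) \<partial>W) = (\<integral>\<omega>. Z \<omega> * kernel_op g (X i \<omega>) \<partial>W)"
proof -
  have [measurable]: "X i \<in> W \<rightarrow>\<^sub>M borel" "X (Suc i) \<in> W \<rightarrow>\<^sub>M borel"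
    using i by (auto intro: X_measurable)
  have ZW [measurable]: "Z \<in> borel_measurable W" using past_measurable[OF Z(1)] i by simp
  have Zabs: "\<bar>Z \<omega>\<bar> \<le> B" for \<omega> using Z(2,3) by simp
  have B: "B \<ge> 0" using Z(2,3) order_trans by blast
  have [measurable]: "g \<in> borel_measurable borel" using g by (rule bmeas_measurable)
  interpret F: finite_measure_subalgebra W "past W X i"
    using past_subalgebra[of i] i by unfold_locales simp_all
  \<comment> \<open>\<open>Z \<ge> 0\<close> makes the weighted measure represent \<open>Z\<close>,
    and the bound on \<open>Z\<close> makes it finite, as the integral over a bind requires.\<close>
  define D where "D = density W (\<lambda>\<omega>. ennreal (Z \<omega>))"
  have D_meas [simp]: "space D = space W" "sets D = sets W" by (simp_all add: D_def)
  have D_fin: "finite_measure D"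
  proof
    have "emeasure D (space D) = (\<integral>\<^sup>+\<omega>. ennreal (Z \<omega>) \<partial>W)"
      by (simp add: D_def emeasure_density cong: nn_integral_cong)
    also have "\<dots> \<le> (\<integral>\<^sup>+\<omega>. ennreal B \<partial>W)" by (intro nn_integral_mono ennreal_leI Z(3))
    also have "\<dots> < \<infinity>" by (simp add: W.emeasure_space_1)
    finally show "emeasure D (space D) \<noteq> \<infinity>" by simp
  qed
  define D1 where "D1 = distr D borel (X i)"
  have D1_fin: "finite_measure D1"
    unfolding D1_def using D_fin by (rule finite_measure.finite_measure_distr) (simp add: measurable_cong_sets[OF D_meas(2) refl])
  have P_D1: "P \<in> D1 \<rightarrow>\<^sub>M subprob_algebra borel" by (simp add: D1_def)
  have meas_P [measurable]: "(\<lambda>x. measure (P x) A) \<in> borel_measurable borel" if "A \<in> sets borel" for A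
  proof -
    have "(\<lambda>x. measure (P x) A) = kernel_op (indicator A)"
      using that by (simp add: kernel_op_def)
    moreover have "indicator A \<in> bmeas" using that by (intro bmeasI[of _ 1]) (auto simp: indicator_def)
    ultimately show ?thesis using bmeas_measurable[OF kernel_op_bmeas] by simp
  qed
  have eq: "distr D borel (X (Suc i)) = D1 \<bind> P"
  proof (rule measure_eqI)
    show "sets (distr D borel (X (Suc i))) = sets (D1 \<bind> P)"
      by (subst sets_bind[where N = borel]) (simp_all add: D1_def W.not_empty)
    fix A assume "A \<in> sets (distr D borel (X (Suc i)))"
    then have A [measurable]: "A \<in> sets borel" by simp
    have X': "X j \<in> D \<rightarrow>\<^sub>M borel" if "X j \<in> W \<rightarrow>\<^sub>M borel" for j
      using that by (simp add: measurable_cong_sets[OF D_meas(2) refl])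
    have int: "integrable W (\<lambda>\<omega>. Z \<omega> * indicator A (X (Suc i) \<omega>))"
      using Zabs B by (intro bounded_integrable_W[of _ B]) (auto simp: indicator_def)
    have "emeasure (distr D borel (X (Suc i))) A = (\<integral>\<^sup>+\<omega>. indicator A (X (Suc i) \<omega>) \<partial>D)"
      by (subst nn_integral_indicator[symmetric], simp, subst nn_integral_distr) (auto intro!: X')
    also have "\<dots> = (\<integral>\<^sup>+\<omega>. ennreal (Z \<omega>) * indicator A (X (Suc i) \<omega>) \<partial>W)"
      unfolding D_def by (rule nn_integral_density) measurable
    also have "\<dots> = (\<integral>\<^sup>+\<omega>. ennreal (Z \<omega> * indicator A (X (Suc i) \<omega>)) \<partial>W)"
      using Z(2) by (intro nn_integral_cong) (auto simp: indicator_def)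
    also have "\<dots> = ennreal (\<integral>\<omega>. Z \<omega> * indicator A (X (Suc i) \<omega>) \<partial>W)"
      using int Z(2) by (intro nn_integral_eq_integral) auto
    also have "(\<integral>\<omega>. Z \<omega> * indicator A (X (Suc i) \<omega>) \<partial>W)
        = (\<integral>\<omega>. Z \<omega> * real_cond_exp W (past W X i) (\<lambda>\<omega>. indicator A (X (Suc i) \<omega>)) \<omega> \<partial>W)"
      by (rule F.real_cond_exp_intg(2)[symmetric, OF int Z(1)]) measurable
    also have "\<dots> = (\<integral>\<omega>. Z \<omega> * measure (P (X i \<omega>)) A \<partial>W)"
    proof (rule integral_cong_AE)
      have "AE \<omega> in W. real_cond_exp W (past W X i) (\<lambda>\<omega>. indicator A (X (Suc i) \<omega>)) \<omega> = measure (P (X i \<omega>)) A"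
        using chain i A by (auto simp: markov_chain_def)
      then show "AE \<omega> in W. Z \<omega> * real_cond_exp W (past W X i) (\<lambda>\<omega>. indicator A (X (Suc i) \<omega>)) \<omega>
          = Z \<omega> * measure (P (X i \<omega>)) A"
        by eventually_elim simp
    qed measurable
    also have "ennreal (\<integral>\<omega>. Z \<omega> * measure (P (X i \<omega>)) A \<partial>W) = (\<integral>\<^sup>+\<omega>. ennreal (Z \<omega> * measure (P (X i \<omega>)) A) \<partial>W)"
    proof (rule nn_integral_eq_integral[symmetric])
      have "\<bar>Z \<omega> * measure (P (X i \<omega>)) A\<bar> \<le> B * 1" for \<omega>
        unfolding abs_mult using Zabs B prob_space.prob_le_1[OF prob_space_P]
        by (intro mult_mono) auto
      then show "integrable W (\<lambda>\<omega>. Z \<omega> * measure (P (X i \<omega>)) A)"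
        by (intro bounded_integrable_W[of _ "B * 1"]) measurable
    qed (use Z(2) in simp)
    also have "\<dots> = (\<integral>\<^sup>+\<omega>. ennreal (Z \<omega>) * emeasure (P (X i \<omega>)) A \<partial>W)"
      using Z(2) by (intro nn_integral_cong)
        (simp add: ennreal_mult finite_measure.emeasure_eq_measure[OF prob_space.finite_measure[OF prob_space_P]])
    also have "\<dots> = (\<integral>\<^sup>+\<omega>. emeasure (P (X i \<omega>)) A \<partial>D)"
      unfolding D_def by (rule nn_integral_density[symmetric]) measurable
    also have "\<dots> = (\<integral>\<^sup>+x. emeasure (P x) A \<partial>D1)"
      unfolding D1_def by (rule nn_integral_distr[symmetric]) (auto intro!: X')
    also have "\<dots> = emeasure (D1 \<bind> P) A"
      by (rule emeasure_bind[symmetric, OF _ P_D1 A]) (simp add: D1_def W.not_empty)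
    finally show "emeasure (distr D borel (X (Suc i))) A = emeasure (D1 \<bind> P) A" .
  qed
  obtain C where C: "\<And>x. \<bar>g x\<bar> \<le> C" using g by (metis bmeasE)
  have "(\<integral>\<omega>. Z \<omega> * g (X (Suc i) \<omega>) \<partial>W) = (\<integral>\<omega>. g (X (Suc i) \<omega>) \<partial>D)"
    unfolding D_def using Z(2) by (subst integral_real_density) auto
  also have "\<dots> = (\<integral>x. g x \<partial>(D1 \<bind> P))"
    unfolding eq[symmetric] by (subst integral_distr) (simp_all add: measurable_cong_sets[OF D_meas(2) refl])
  also have "\<dots> = (\<integral>x. kernel_op g x \<partial>D1)"
    unfolding kernel_op_def
  proof (rule integral_bind[where K = borel and B = C and B' = 1])
    show "AE x in D1. emeasure (P x) (space (P x)) \<le> ennreal 1"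
      using prob_space.emeasure_space_1[OF prob_space_P] by simp
  qed (use C P_D1 D1_fin in auto)
  also have "\<dots> = (\<integral>\<omega>. kernel_op g (X i \<omega>) \<partial>D)"
    unfolding D1_def using bmeas_measurable[OF kernel_op_bmeas[OF g]]
    by (subst integral_distr) (simp_all add: measurable_cong_sets[OF D_meas(2) refl])
  also have "\<dots> = (\<integral>\<omega>. Z \<omega> * kernel_op g (X i \<omega>) \<partial>W)"
    unfolding D_def using Z(2) bmeas_measurable[OF kernel_op_bmeas[OF g]]
    by (subst integral_real_density) auto
  finally show ?thesis .
qed

lemma markov_steps:
  assumes i: "1 \<le> i" "i + k \<le> n"
    and Z: "Z \<in> borel_measurable (past W X i)" "\<And>\<omega>. 0 \<le> Z \<omega>" "\<And>\<omega>. Z \<omega> \<le> B"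
    and g: "g \<in> bmeas"
  shows "(\<integral>\<omega>. Z \<omega> * g (X (i + k) \<omega>) \<partial>W) = (\<integral>\<omega>. Z \<omega> * (kernel_op ^^ k) g (X i \<omega>) \<partial>W)"
  using i(2) g
proof (induction k arbitrary: g)
  case (Suc k)
  have "(\<integral>\<omega>. Z \<omega> * g (X (i + Suc k) \<omega>) \<partial>W) = (\<integral>\<omega>. Z \<omega> * kernel_op g (X (i + k) \<omega>) \<partial>W)"
    using markov_step[of "i + k" Z B g] past_mono[OF Z(1), of "i + k"] Z i Suc.prems by simp
  also have "\<dots> = (\<integral>\<omega>. Z \<omega> * (kernel_op ^^ k) (kernel_op g) (X i \<omega>) \<partial>W)"
    using Suc.prems by (intro Suc.IH kernel_op_bmeas) auto
  finally show ?case by (simp only: funpow_swap1 funpow.simps comp_def)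
qed simp

text \<open>\<open>Z\<close> collects the factors already passed. The induction moves
  \<open>e 0 (X i \<omega>)\<close> into it, treats the rest from time \<open>i + k\<close>, and
  returns to time \<open>i\<close> by \<open>markov_steps\<close>.\<close>

lemma markov_skeleton:
  assumes "1 \<le> i" "i + m * k \<le> n"
    and "Z \<in> borel_measurable (past W X i)" "\<And>\<omega>. 0 \<le> Z \<omega>" "\<And>\<omega>. Z \<omega> \<le> B"
    and "\<And>j. j \<le> m \<Longrightarrow> e j \<in> bmeas" "\<And>j x. j \<le> m \<Longrightarrow> 0 \<le> e j x"
  shows "(\<integral>\<omega>. Z \<omega> * (\<Prod>j\<le>m. e j (X (i + j * k) \<omega>)) \<partial>W) = (\<integral>\<omega>. Z \<omega> * skeleton_prod k m e (X i \<omega>) \<partial>W)"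
  using assms
proof (induction m arbitrary: i Z B e)
  case (Suc m)
  have e0: "e 0 \<in> bmeas" using Suc.prems by simp
  obtain C where C: "\<And>x. \<bar>e 0 x\<bar> \<le> C" using e0 by (metis bmeasE)
  define Z' where "Z' \<omega> = Z \<omega> * e 0 (X i \<omega>)" for \<omega>
  define V where "V = skeleton_prod k m (\<lambda>j. e (Suc j))"
  have V: "V \<in> bmeas" unfolding V_def using Suc.prems by (intro skeleton_prod_bmeas) simp
  have Z'_past: "Z' \<in> borel_measurable (past W X i)"
    unfolding Z'_def using Suc.prems(1)
    by (intro borel_measurable_times Suc.prems(3) measurable_compose[OF X_past bmeas_measurable[OF e0]]) simp
  have Z'_nonneg: "0 \<le> Z' \<omega>" for \<omega> using Suc.prems(4,7) by (simp add: Z'_def)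
  have Z'_le: "Z' \<omega> \<le> B * C" for \<omega>
    unfolding Z'_def using C[of "X i \<omega>"] Suc.prems(4,5)[of \<omega>] Suc.prems(7)[of 0 "X i \<omega>"]
    by (intro mult_mono) auto
  have "(\<integral>\<omega>. Z \<omega> * (\<Prod>j\<le>Suc m. e j (X (i + j * k) \<omega>)) \<partial>W)
      = (\<integral>\<omega>. Z' \<omega> * (\<Prod>j\<le>m. e (Suc j) (X ((i + k) + j * k) \<omega>)) \<partial>W)"
    unfolding prod.atMost_Suc_shift by (simp add: Z'_def mult.assoc add.assoc)
  also have "\<dots> = (\<integral>\<omega>. Z' \<omega> * V (X (i + k) \<omega>) \<partial>W)"
    unfolding V_def
  proof (rule Suc.IH)
    show "Z' \<omega> \<le> B * C" for \<omega> by (rule Z'_le)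
  qed (use Suc.prems past_mono[OF Z'_past, of "i + k"] Z'_nonneg in auto)
  also have "\<dots> = (\<integral>\<omega>. Z' \<omega> * (kernel_op ^^ k) V (X i \<omega>) \<partial>W)"
    using Suc.prems Z'_past Z'_nonneg Z'_le V by (intro markov_steps[where B = "B * C"]) auto
  also have "\<dots> = (\<integral>\<omega>. Z \<omega> * skeleton_prod k (Suc m) e (X i \<omega>) \<partial>W)"
    by (simp add: Z'_def V_def mult.assoc)
  finally show ?case .
qed simp

lemma expectation_X:
  assumes i: "i \<in> {1..n}" and g: "g \<in> bmeas"
  shows "W.expectation (\<lambda>\<omega>. g (X i \<omega>)) = expectation g"
proof -
  have "W.expectation (\<lambda>\<omega>. g (X i \<omega>)) = W.expectation (\<lambda>\<omega>. (kernel_op ^^ (i - 1)) g (X 1 \<omega>))"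
    using markov_steps[of 1 "i - 1" "\<lambda>_. 1" 1 g] i g by simp
  also have "\<dots> = (\<integral>x. (kernel_op ^^ (i - 1)) g x \<partial>distr W borel (X 1))"
    using X_measurable[of 1] n_ge_1 bmeas_measurable[OF kernel_op_pow_bmeas[OF g]]
    by (intro integral_distr[symmetric]) auto
  also have "\<dots> = expectation g" using initial by (simp add: integral_kernel_op_pow g)
  finally show ?thesis .
qed

theorem mgf_skeleton:
  assumes gap: "gap_pow \<pi> P k > 0" and i: "1 \<le> i" "i + m * k \<le> n"
    and f: "\<And>j. j \<le> m \<Longrightarrow> f j \<in> bmeas" "\<And>j. j \<le> m \<Longrightarrow> expectation (f j) = 0"
      "\<And>j x. j \<le> m \<Longrightarrow> \<bar>f j x\<bar> \<le> C"
    and t: "0 \<le> t" "t * C < gap_pow \<pi> P k / 2"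
  shows "W.expectation (\<lambda>\<omega>. exp (t * (\<Sum>j\<le>m. f j (X (i + j * k) \<omega>))))
    \<le> exp (t\<^sup>2 * (\<Sum>j\<le>m. \<integral>x. (f j x)\<^sup>2 \<partial>\<pi>) / (gap_pow \<pi> P k / 2 - t * C))"
proof -
  have bm: "(\<lambda>x. exp (t * f j x)) \<in> bmeas" if "j \<le> m" for j
    using f(1)[OF that] by (intro bmeas_intros)
  have "W.expectation (\<lambda>\<omega>. exp (t * (\<Sum>j\<le>m. f j (X (i + j * k) \<omega>))))
      = W.expectation (\<lambda>\<omega>. 1 * (\<Prod>j\<le>m. exp (t * f j (X (i + j * k) \<omega>))))"
    by (simp add: sum_distrib_left exp_sum)
  also have "\<dots> = W.expectation (\<lambda>\<omega>. 1 * skeleton_prod k m (\<lambda>j x. exp (t * f j x)) (X i \<omega>))"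
    using i bm by (intro markov_skeleton[where B = 1]) auto
  also have "\<dots> = expectation (skeleton_prod k m (\<lambda>j x. exp (t * f j x)))"
    unfolding mult_1 using i bm by (intro expectation_X skeleton_prod_bmeas) auto
  also have "\<dots> \<le> exp (t\<^sup>2 * (\<Sum>j\<le>m. \<integral>x. (f j x)\<^sup>2 \<partial>\<pi>) / (gap_pow \<pi> P k / 2 - t * C))"
    using gap f t by (intro expectation_skeleton_prod_le) auto
  finally show ?thesis .
qed

end

section \<open>Residue classes of times\<close>

lemma finite_block: "k \<ge> 1 \<Longrightarrow> finite {j. i + j * k \<le> (n::nat)}"
proof (rule finite_subset)
  assume "k \<ge> 1"
  show "{j. i + j * k \<le> n} \<subseteq> {..n}"
  proof
    fix j assume "j \<in> {j. i + j * k \<le> n}"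
    moreover have "j * 1 \<le> j * k" using \<open>k \<ge> 1\<close> by (rule mult_le_mono2)
    ultimately show "j \<in> {..n}" unfolding mem_Collect_eq atMost_iff by linarith
  qed
qed simp

lemma block_eq:
  fixes i k n :: nat
  assumes "k \<ge> 1" "i \<le> n"
  shows "{j. i + j * k \<le> n} = {..(n - i) div k}"
proof -
  have "i + j * k \<le> n \<longleftrightarrow> j \<le> (n - i) div k" for j
    using assms less_eq_div_iff_mult_less_eq[of k j "n - i"] by linarith
  then show ?thesis by auto
qed

text \<open>Times and classes both start at 1, so \<open>l\<close> belongs to the class
  \<open>(l - 1) mod k + 1\<close> at position \<open>(l - 1) div k\<close>.\<close>

lemma sum_residue_classes:
  fixes F :: "nat \<Rightarrow> 'b::comm_monoid_add"
  assumes k: "k \<ge> 1"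
  shows "(\<Sum>l=1..n. F l) = (\<Sum>i=1..k. \<Sum>j | i + j * k \<le> n. F (i + j * k))"
proof -
  have "(\<Sum>i=1..k. \<Sum>j | i + j * k \<le> n. F (i + j * k))
      = (\<Sum>(i, j)\<in>(SIGMA i:{1..k}. {j. i + j * k \<le> n}). F (i + j * k))"
    by (rule sum.Sigma) (simp_all add: finite_block k)
  also have "\<dots> = (\<Sum>l=1..n. F l)"
  proof (rule sum.reindex_bij_witness)
    fix l assume l: "l \<in> {1..n}"
    have "(l - 1) mod k + (l - 1) div k * k = l - 1" by (rule mod_div_mult_eq)
    then have eq: "(l - 1) mod k + 1 + (l - 1) div k * k = l" using l by simp
    then show "(case ((l - 1) mod k + 1, (l - 1) div k) of (i, j) \<Rightarrow> i + j * k) = l" by simp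
    show "((l - 1) mod k + 1, (l - 1) div k) \<in> (SIGMA i:{1..k}. {j. i + j * k \<le> n})"
      using eq l k by (auto simp: Suc_le_eq)
  next
    fix a assume a: "a \<in> (SIGMA i:{1..k}. {j. i + j * k \<le> n})"
    obtain i j where ij: "a = (i, j)" "1 \<le> i" "i \<le> k" "i + j * k \<le> n" using a by auto
    have eq: "i + j * k - 1 = (i - 1) + j * k" using ij by simp
    have "i - 1 < k" using ij by simp
    then have "(i + j * k - 1) mod k = i - 1" "(i + j * k - 1) div k = j" unfolding eq by simp_all
    then show "(((case a of (i, j) \<Rightarrow> i + j * k) - 1) mod k + 1, ((case a of (i, j) \<Rightarrow> i + j * k) - 1) div k) = a"
      using ij by simp
    show "(case a of (i, j) \<Rightarrow> i + j * k) \<in> {1..n}" using ij by simp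
  qed auto
  finally show ?thesis by simp
qed

lemma block_variance_eq:
  assumes "k \<ge> 1"
  shows "block_variance \<pi> f n k i = (\<Sum>j | i + j * k \<le> n. prob_space.variance \<pi> (f (i + j * k)))"
proof -
  have "int j \<le> \<lfloor>(real n - real i) / real k\<rfloor> \<longleftrightarrow> i + j * k \<le> n" for j
  proof -
    have "int j \<le> \<lfloor>(real n - real i) / real k\<rfloor> \<longleftrightarrow> real j \<le> (real n - real i) / real k"
      by (simp add: le_floor_iff)
    also have "\<dots> \<longleftrightarrow> real j * real k \<le> real n - real i"
      using assms by (simp add: le_divide_eq)
    also have "\<dots> \<longleftrightarrow> real (i + j * k) \<le> real n" by auto
    also have "\<dots> \<longleftrightarrow> i + j * k \<le> n" by (rule of_nat_le_iff)
    finally show ?thesis .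
  qed
  then show ?thesis by (simp add: block_variance_def)
qed

section \<open>Concentration\<close>

context stationary_chain
begin

text \<open>Jensen's inequality: the exponent is the average, with weights \<open>p i\<close>, of
  \<open>t / p i * S i \<omega>\<close>. \<open>L\<close> limits how far the parameter grows on a
  skeleton, and \<open>K\<close> bounds the correspondingly inflated variances.\<close>

lemma mgf_sum:
  assumes k: "k \<ge> 1" and gap: "gap_pow \<pi> P k > 0"
    and f: "\<And>i. i \<in> {1..n} \<Longrightarrow> f i \<in> bmeas" "\<And>i. i \<in> {1..n} \<Longrightarrow> expectation (f i) = 0"
      "\<And>i x. i \<in> {1..n} \<Longrightarrow> \<bar>f i x\<bar> \<le> C" and C: "C > 0"
    and p: "\<And>i. i \<in> {1..k} \<Longrightarrow> p i > 0" "(\<Sum>i=1..k. p i) = 1" "\<And>i. i \<in> {1..k} \<Longrightarrow> 1 / p i \<le> L"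
    and K: "\<And>i. i \<in> {1..k} \<Longrightarrow> (\<Sum>j | i + j * k \<le> n. \<integral>x. (f (i + j * k) x)\<^sup>2 \<partial>\<pi>) / (p i)\<^sup>2 \<le> K" "K \<ge> 0"
    and t: "0 \<le> t" "t * L * C < gap_pow \<pi> P k / 2"
  shows "integrable W (\<lambda>\<omega>. exp (t * (\<Sum>i=1..n. f i (X i \<omega>))))" (is ?int)
    and "W.expectation (\<lambda>\<omega>. exp (t * (\<Sum>i=1..n. f i (X i \<omega>))))
      \<le> exp (t\<^sup>2 * K / (gap_pow \<pi> P k / 2 - t * L * C))" (is ?bound)
proof -
  have [measurable]: "f i \<in> borel_measurable borel" "X i \<in> W \<rightarrow>\<^sub>M borel" if "i \<in> {1..n}" for i
    using f(1) that by (auto intro: bmeas_measurable X_measurable)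
  have fX [measurable]: "(\<lambda>\<omega>. f i (X i \<omega>)) \<in> borel_measurable W" if "i \<in> {1..n}" for i
    using that by measurable
  have exp_int: "integrable W (\<lambda>\<omega>. exp (s * (\<Sum>i\<in>A. f i (X i \<omega>))))"
    if A: "A \<subseteq> {1..n}" and s: "0 \<le> s" for s A
  proof (rule bounded_integrable_W)
    show "(\<lambda>\<omega>. exp (s * (\<Sum>i\<in>A. f i (X i \<omega>)))) \<in> borel_measurable W"
    proof -
      have [measurable]: "(\<lambda>\<omega>. \<Sum>i\<in>A. f i (X i \<omega>)) \<in> borel_measurable W"
        using A by (intro borel_measurable_sum fX) auto
      show ?thesis by measurable
    qed
    fix \<omega>
    have "(\<Sum>i\<in>A. f i (X i \<omega>)) \<le> (\<Sum>i\<in>A. C)"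
    proof (rule sum_mono)
      fix i assume "i \<in> A"
      with A f(3)[of i "X i \<omega>"] show "f i (X i \<omega>) \<le> C" by auto
    qed
    then show "\<bar>exp (s * (\<Sum>i\<in>A. f i (X i \<omega>)))\<bar> \<le> exp (s * (\<Sum>i\<in>A. C))"
      using s by (simp add: mult_left_mono)
  qed
  show ?int by (rule exp_int) (use t in auto)
  define g where "g = gap_pow \<pi> P k / 2"
  define S where "S i \<omega> = (\<Sum>j | i + j * k \<le> n. f (i + j * k) (X (i + j * k) \<omega>))" for i \<omega>
  have S_reindex: "S i \<omega> = (\<Sum>l\<in>(\<lambda>j. i + j * k) ` {j. i + j * k \<le> n}. f l (X l \<omega>))" for i \<omega>
    unfolding S_def using k by (subst sum.reindex) (auto simp: inj_on_def)
  have block: "integrable W (\<lambda>\<omega>. exp (t / p i * S i \<omega>))"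
    "W.expectation (\<lambda>\<omega>. exp (t / p i * S i \<omega>)) \<le> exp (t\<^sup>2 * K / (g - t * L * C))"
    if i: "i \<in> {1..k}" for i
  proof -
    show "integrable W (\<lambda>\<omega>. exp (t / p i * S i \<omega>))"
      unfolding S_reindex using i t p(1)[OF i] by (intro exp_int) auto
    have tL: "t / p i * C \<le> t * L * C"
      using mult_right_mono[OF mult_left_mono[OF p(3)[OF i] t(1)], of C] C by simp
    show "W.expectation (\<lambda>\<omega>. exp (t / p i * S i \<omega>)) \<le> exp (t\<^sup>2 * K / (g - t * L * C))"
    \<comment> \<open>The step \<open>k\<close> may exceed \<open>n\<close>; the skeleton is then
      empty and its exponential moment is 1.\<close>
    proof (cases "i \<le> n")
      case False
      then have "S i \<omega> = 0" for \<omega> by (auto simp: S_def)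
      then show ?thesis using t K(2) W.prob_space by (simp add: g_def)
    next
      case True
      define m where "m = (n - i) div k"
      have set_eq: "{j. i + j * k \<le> n} = {..m}" unfolding m_def by (rule block_eq[OF k True])
      then have m: "i + j * k \<le> n" if "j \<le> m" for j using that by auto
      define V where "V = (\<Sum>j\<le>m. \<integral>x. (f (i + j * k) x)\<^sup>2 \<partial>\<pi>)"
      have "W.expectation (\<lambda>\<omega>. exp (t / p i * S i \<omega>))
          \<le> exp ((t / p i)\<^sup>2 * V / (gap_pow \<pi> P k / 2 - t / p i * C))"
        unfolding S_def set_eq V_def
      proof (rule mgf_skeleton[OF gap])
        have idx: "i + j * k \<in> {1..n}" if "j \<le> m" for j using m[OF that] i by simp
        show "f (i + j * k) \<in> bmeas" if "j \<le> m" for j by (rule f(1)[OF idx[OF that]])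
        show "expectation (f (i + j * k)) = 0" if "j \<le> m" for j by (rule f(2)[OF idx[OF that]])
        show "\<bar>f (i + j * k) x\<bar> \<le> C" if "j \<le> m" for j x by (rule f(3)[OF idx[OF that]])
        show "1 \<le> i" "i + m * k \<le> n" using i m[of m] by simp_all
        show "t / p i * C < gap_pow \<pi> P k / 2" using tL t(2) by (rule order_le_less_trans)
        show "0 \<le> t / p i" using t(1) p(1)[OF i] by simp
      qed
      also have "\<dots> \<le> exp (t\<^sup>2 * K / (g - t * L * C))"
      proof -
        have "(t / p i)\<^sup>2 * V = t\<^sup>2 * (V / (p i)\<^sup>2)" by (simp add: power_divide)
        also have "\<dots> \<le> t\<^sup>2 * K" using K(1)[OF i] by (intro mult_left_mono) (simp_all add: V_def set_eq)
        finally have "(t / p i)\<^sup>2 * V \<le> t\<^sup>2 * K" .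
        then have "(t / p i)\<^sup>2 * V / (g - t / p i * C) \<le> t\<^sup>2 * K / (g - t * L * C)"
          using tL t(2) K(2) by (intro frac_le) (auto simp: g_def)
        then show ?thesis by (simp add: g_def)
      qed
      finally show ?thesis .
    qed
  qed
  have convex: "exp (t * (\<Sum>l=1..n. f l (X l \<omega>))) \<le> (\<Sum>i=1..k. p i * exp (t / p i * S i \<omega>))" for \<omega>
  proof -
    have "t * (\<Sum>l=1..n. f l (X l \<omega>)) = (\<Sum>i=1..k. t * S i \<omega>)"
      using sum_residue_classes[OF k, of "\<lambda>l. f l (X l \<omega>)" n] by (simp add: S_def sum_distrib_left)
    also have "\<dots> = (\<Sum>i=1..k. p i *\<^sub>R (t / p i * S i \<omega>))"
    proof (rule sum.cong[OF refl])
      fix i assume "i \<in> {1..k}"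
      from p(1)[OF this] show "t * S i \<omega> = p i *\<^sub>R (t / p i * S i \<omega>)" by simp
    qed
    also have "exp \<dots> \<le> (\<Sum>i=1..k. p i * exp (t / p i * S i \<omega>))"
      using k p(1) by (intro convex_on_sum[OF _ _ exp_convex p(2)]) (auto simp: less_imp_le)
    finally show ?thesis .
  qed
  have int_p: "integrable W (\<lambda>\<omega>. p i * exp (t / p i * S i \<omega>))" if "i \<in> {1..k}" for i
    using block(1)[OF that] by simp
  have "W.expectation (\<lambda>\<omega>. exp (t * (\<Sum>i=1..n. f i (X i \<omega>))))
      \<le> W.expectation (\<lambda>\<omega>. \<Sum>i=1..k. p i * exp (t / p i * S i \<omega>))"
    using \<open>?int\<close> Bochner_Integration.integrable_sum[OF int_p] convex by (rule integral_mono)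
  also have "\<dots> = (\<Sum>i=1..k. W.expectation (\<lambda>\<omega>. p i * exp (t / p i * S i \<omega>)))"
    using int_p by (rule Bochner_Integration.integral_sum)
  also have "\<dots> \<le> (\<Sum>i=1..k. p i * exp (t\<^sup>2 * K / (g - t * L * C)))"
  proof (rule sum_mono)
    fix i assume i: "i \<in> {1..k}"
    have "p i * W.expectation (\<lambda>\<omega>. exp (t / p i * S i \<omega>)) \<le> p i * exp (t\<^sup>2 * K / (g - t * L * C))"
      using block(2)[OF i] p(1)[OF i] by (intro mult_left_mono) simp_all
    then show "W.expectation (\<lambda>\<omega>. p i * exp (t / p i * S i \<omega>)) \<le> p i * exp (t\<^sup>2 * K / (g - t * L * C))"
      by simp
  qed
  also have "\<dots> = exp (t\<^sup>2 * K / (g - t * L * C))"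
    unfolding sum_distrib_right[symmetric] p(2) by simp
  finally show ?bound by (simp add: g_def)
qed

text \<open>Enlarging \<open>K\<close> by \<open>s * L * C\<close> keeps the optimal \<open>t\<close> admissible when all variances vanish.\<close>

lemma tail_sum:
  assumes k: "k \<ge> 1" and gap: "gap_pow \<pi> P k > 0"
    and f: "\<And>i. i \<in> {1..n} \<Longrightarrow> f i \<in> bmeas" "\<And>i. i \<in> {1..n} \<Longrightarrow> expectation (f i) = 0"
      "\<And>i x. i \<in> {1..n} \<Longrightarrow> \<bar>f i x\<bar> \<le> C" and C: "C > 0"
    and p: "\<And>i. i \<in> {1..k} \<Longrightarrow> p i > 0" "(\<Sum>i=1..k. p i) = 1" "\<And>i. i \<in> {1..k} \<Longrightarrow> 1 / p i \<le> L"
    and K: "\<And>i. i \<in> {1..k} \<Longrightarrow> (\<Sum>j | i + j * k \<le> n. \<integral>x. (f (i + j * k) x)\<^sup>2 \<partial>\<pi>) / (p i)\<^sup>2 \<le> K" "K \<ge> 0"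
    and s: "s > 0"
  shows "W.prob {\<omega> \<in> space W. (\<Sum>i=1..n. f i (X i \<omega>)) \<ge> s}
    \<le> exp (- (s\<^sup>2 * gap_pow \<pi> P k / (8 * K + 12 * L * C * s)))"
proof -
  define g where "g = gap_pow \<pi> P k / 2"
  have g: "g > 0" using gap by (simp add: g_def)
  have "1 / p 1 \<le> L" "0 < 1 / p 1" using p(3)[of 1] p(1)[of 1] k by auto
  then have L: "L > 0" by linarith
  define u where "u = s * L * C"
  have u: "u > 0" using s L C by (simp add: u_def)
  \<comment> \<open>Chosen so that at \<open>t = s * g / D\<close> the quadratic term is exactly
    half of \<open>t * s\<close>, which leaves the exponent \<open>- (t * s / 2)\<close>. As
    \<open>4 * D = 8 * K + 12 * u\<close>, this fixes both constants: of the 12, the enlargement of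
    \<open>K\<close> accounts for 8.\<close>
  define D where "D = 2 * (K + u) + u"
  have D: "D > 0" using K(2) u by (simp add: D_def)
  define t where "t = s * g / D"
  have t: "t > 0" using s g D by (simp add: t_def)
  have tLC: "g - t * L * C = g * (2 * (K + u)) / D"
  proof -
    have "t * L * C = g * u / D" by (simp add: t_def u_def)
    then show ?thesis using D by (simp add: D_def field_simps)
  qed
  then have adm: "t * L * C < g" using g D K(2) u by (smt (verit) divide_pos_pos mult_pos_pos)
  have K': "(\<Sum>j | i + j * k \<le> n. \<integral>x. (f (i + j * k) x)\<^sup>2 \<partial>\<pi>) / (p i)\<^sup>2 \<le> K + u" if "i \<in> {1..k}" for i
    using K(1)[OF that] u by linarith
  have K'0: "K + u \<ge> 0" using K(2) u by simp
  note mgf = mgf_sum[OF k gap f C p K' K'0 less_imp_le[OF t] adm[unfolded g_def]]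
  have "W.prob {\<omega> \<in> space W. (\<Sum>i=1..n. f i (X i \<omega>)) \<ge> s}
      \<le> exp (- t * s) * (\<integral>\<omega>\<in>space W. exp (t * (\<Sum>i=1..n. f i (X i \<omega>))) \<partial>W)"
    using integrable_mult_indicator[OF sets.top mgf(1)]
    by (intro W.Chernoff_ineq_ge t) (simp_all add: set_integrable_def)
  also have "(\<integral>\<omega>\<in>space W. exp (t * (\<Sum>i=1..n. f i (X i \<omega>))) \<partial>W)
      = W.expectation (\<lambda>\<omega>. exp (t * (\<Sum>i=1..n. f i (X i \<omega>))))"
    by (rule set_integral_space) (rule mgf(1))
  also have "exp (- t * s) * \<dots> \<le> exp (- t * s) * exp (t\<^sup>2 * (K + u) / (g - t * L * C))"
    using mgf(2) by (intro mult_left_mono) (simp_all add: g_def)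
  also have "\<dots> = exp (- (t * s / 2))"
  proof -
    have "t\<^sup>2 * (K + u) / (g - t * L * C) = t\<^sup>2 * D / (2 * g)"
      unfolding tLC using K(2) u D g by (simp add: divide_simps)
    also have "\<dots> = t * s / 2"
      using D g by (simp add: t_def power2_eq_square)
    finally have "- t * s + t\<^sup>2 * (K + u) / (g - t * L * C) = - (t * s / 2)" by argo
    then show ?thesis by (simp only: exp_add[symmetric])
  qed
  also have "t * s / 2 = s\<^sup>2 * gap_pow \<pi> P k / (8 * K + 12 * L * C * s)"
  proof -
    have "8 * K + 12 * L * C * s = 4 * D" by (simp add: D_def u_def)
    then show ?thesis by (simp add: t_def g_def power2_eq_square)
  qed
  finally show ?thesis .
qed

lemma deviation_eq:
  fixes f :: "nat \<Rightarrow> 'a \<Rightarrow> real"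
  assumes f: "\<And>i. i \<in> {1..n} \<Longrightarrow> f i \<in> L2 \<pi>"
    and bound: "\<And>i x. i \<in> {1..n} \<Longrightarrow> \<bar>f i x - expectation (f i)\<bar> \<le> C"
  shows "(\<Sum>i=1..n. f i (X i \<omega>)) - W.expectation (\<lambda>\<omega>. \<Sum>i=1..n. f i (X i \<omega>))
    = (\<Sum>i=1..n. f i (X i \<omega>) - expectation (f i))"
proof -
  have bm: "f i \<in> bmeas" if i: "i \<in> {1..n}" for i
  proof (rule bmeasI[of _ "C + \<bar>expectation (f i)\<bar>"])
    show "f i \<in> borel_measurable borel"
      using f[OF i] by (simp add: L2_def cong: measurable_cong_sets)
    show "\<bar>f i x\<bar> \<le> C + \<bar>expectation (f i)\<bar>" for x
      using bound[OF i, of x] by linarith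
  qed
  have int: "integrable W (\<lambda>\<omega>. f i (X i \<omega>))" if i: "i \<in> {1..n}" for i
  proof -
    obtain B where "\<And>x. \<bar>f i x\<bar> \<le> B" using bm[OF i] by (metis bmeasE)
    with measurable_compose[OF X_measurable[OF i] bmeas_measurable[OF bm[OF i]]] show ?thesis
      by (rule bounded_integrable_W)
  qed
  have "W.expectation (\<lambda>\<omega>. \<Sum>i=1..n. f i (X i \<omega>)) = (\<Sum>i=1..n. expectation (f i))"
  proof -
    have "W.expectation (\<lambda>\<omega>. \<Sum>i=1..n. f i (X i \<omega>)) = (\<Sum>i=1..n. W.expectation (\<lambda>\<omega>. f i (X i \<omega>)))"
      using int by (rule Bochner_Integration.integral_sum)
    also have "\<dots> = (\<Sum>i=1..n. expectation (f i))"
    proof (rule sum.cong[OF refl])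
      fix i assume "i \<in> {1..n}"
      then show "W.expectation (\<lambda>\<omega>. f i (X i \<omega>)) = expectation (f i)"
        using bm by (intro expectation_X)
    qed
    finally show ?thesis .
  qed
  then show ?thesis by (simp add: sum_subtractf)
qed

lemma two_sided_tail:
  assumes k: "k \<ge> 1" and gap: "gap_pow \<pi> P k > 0"
    and f: "\<And>i. i \<in> {1..n} \<Longrightarrow> f i \<in> L2 \<pi>"
    and bound: "\<And>i x. i \<in> {1..n} \<Longrightarrow> \<bar>f i x - expectation (f i)\<bar> \<le> C" and C: "C > 0"
    and p: "\<And>i. i \<in> {1..k} \<Longrightarrow> p i > 0" "(\<Sum>i=1..k. p i) = 1" "\<And>i. i \<in> {1..k} \<Longrightarrow> 1 / p i \<le> L"
    and K: "\<And>i. i \<in> {1..k} \<Longrightarrow> block_variance \<pi> f n k i / (p i)\<^sup>2 \<le> K" "K \<ge> 0"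
    and s: "s > 0"
  defines "S \<equiv> \<lambda>\<omega>. \<Sum>i=1..n. f i (X i \<omega>)"
  shows "W.prob {\<omega> \<in> space W. \<bar>S \<omega> - W.expectation S\<bar> \<ge> s}
    \<le> 2 * exp (- (s\<^sup>2 * gap_pow \<pi> P k / (8 * K + 12 * L * C * s)))"
proof -
  \<comment> \<open>The sign \<open>c\<close> covers both tails; it changes neither the bound
    \<open>C\<close> nor the variances.\<close>
  define F where "F c i x = c * (f i x - expectation (f i))" for c :: real and i x
  define Y where "Y c \<omega> = (\<Sum>i=1..n. F c i (X i \<omega>))" for c \<omega>
  have meas [measurable]: "f i \<in> borel_measurable borel" if "i \<in> {1..n}" for i
    using f[OF that] by (simp add: L2_def cong: measurable_cong_sets)
  have Fm: "F c i \<in> borel_measurable borel" if "i \<in> {1..n}" for c i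
    unfolding F_def using meas[OF that] by measurable
  have Y_meas [measurable]: "Y c \<in> borel_measurable W" for c
    unfolding Y_def by (intro borel_measurable_sum measurable_compose[OF X_measurable Fm])
  have tail: "W.prob {\<omega> \<in> space W. Y c \<omega> \<ge> s} \<le> exp (- (s\<^sup>2 * gap_pow \<pi> P k / (8 * K + 12 * L * C * s)))"
    if c: "\<bar>c\<bar> = 1" for c
    unfolding Y_def
  proof (rule tail_sum[OF k gap _ _ _ C p _ K(2) s])
    fix i assume i: "i \<in> {1..n}"
    show bd: "\<bar>F c i x\<bar> \<le> C" for x using bound[OF i, of x] c by (simp add: F_def abs_mult)
    show "F c i \<in> bmeas" using Fm[OF i] bd by (rule bmeasI)
    have fb: "f i \<in> bmeas"
    proof (rule bmeasI[of _ "C + \<bar>expectation (f i)\<bar>"])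
      show "\<bar>f i x\<bar> \<le> C + \<bar>expectation (f i)\<bar>" for x using bound[OF i, of x] by linarith
    qed (rule meas[OF i])
    show "expectation (F c i) = 0"
      using bmeas_integrable[OF fb] prob_space by (simp add: F_def [abs_def])
  next
    fix i assume "i \<in> {1..k}"
    have "c\<^sup>2 = 1" using c by (metis power2_abs one_power2)
    then show "(\<Sum>j | i + j * k \<le> n. \<integral>x. (F c (i + j * k) x)\<^sup>2 \<partial>\<pi>) / (p i)\<^sup>2 \<le> K"
      using K(1)[OF \<open>i \<in> {1..k}\<close>] k by (simp add: block_variance_eq F_def power_mult_distrib)
  qed
  have ev: "{\<omega> \<in> space W. Y c \<omega> \<ge> s} \<in> sets W" for c
    by measurable
  have dev: "S \<omega> - W.expectation S = Y 1 \<omega>" "- (S \<omega> - W.expectation S) = Y (-1) \<omega>" for \<omega>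
    using deviation_eq[of f C \<omega>, OF f bound] by (simp_all add: S_def Y_def F_def flip: sum_negf)
  have "{\<omega> \<in> space W. \<bar>S \<omega> - W.expectation S\<bar> \<ge> s}
      = {\<omega> \<in> space W. Y 1 \<omega> \<ge> s} \<union> {\<omega> \<in> space W. Y (-1) \<omega> \<ge> s}"
    unfolding dev[symmetric] by (auto simp: abs_real_def)
  also have "W.prob \<dots> \<le> W.prob {\<omega> \<in> space W. Y 1 \<omega> \<ge> s} + W.prob {\<omega> \<in> space W. Y (-1) \<omega> \<ge> s}"
    by (rule measure_Un_le; rule ev)
  also have "\<dots> \<le> 2 * exp (- (s\<^sup>2 * gap_pow \<pi> P k / (8 * K + 12 * L * C * s)))"
    unfolding mult_2 by (intro add_mono tail) simp_all
  finally show ?thesis .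
qed

text \<open>Dividing the denominator by \<open>k\<close> replaces the gap of the power by \<gamma>.
  The case \<open>C = 0\<close> stands apart because \<open>exp_bound\<close> may then be 0: the sum
  equals its mean and the event is empty. If \<open>t\<close> and \<open>C\<close> are positive, so
  is the denominator.\<close>

lemma tail_le_exp_bound:
  assumes k: "k \<ge> 1" and gap: "gap_pow \<pi> P k = \<gamma> * real k" "\<gamma> > 0"
    and f: "\<And>i. i \<in> {1..n} \<Longrightarrow> f i \<in> L2 \<pi>"
    and bound: "\<And>i x. i \<in> {1..n} \<Longrightarrow> \<bar>f i x - expectation (f i)\<bar> \<le> C"
    and p: "\<And>i. i \<in> {1..k} \<Longrightarrow> p i > 0" "(\<Sum>i=1..k. p i) = 1" "\<And>i. i \<in> {1..k} \<Longrightarrow> 1 / p i \<le> L"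
    and K: "\<And>i. i \<in> {1..k} \<Longrightarrow> block_variance \<pi> f n k i / (p i)\<^sup>2 \<le> K" "K \<ge> 0"
    and t: "t \<ge> 0" and b: "(8 * K + 12 * L * C * t) / real k \<le> b"
  defines "S \<equiv> \<lambda>\<omega>. \<Sum>i=1..n. f i (X i \<omega>)"
  shows "W.prob {\<omega> \<in> space W. \<bar>S \<omega> - W.expectation S\<bar> \<ge> t} \<le> exp_bound (t\<^sup>2 * \<gamma>) b"
proof -
  have C: "C \<ge> 0" using bound[of 1 undefined] n_ge_1 by simp
  have nonneg: "0 \<le> exp_bound (t\<^sup>2 * \<gamma>) b" by (simp add: exp_bound_def)
  consider "t = 0" | "t > 0" "C = 0" | "t > 0" "C > 0" using t C by linarith
  then show ?thesis
  proof cases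
    case 1
    then have "exp_bound (t\<^sup>2 * \<gamma>) b = 2" by (simp add: exp_bound_def)
    then show ?thesis using W.prob_le_1 by (metis one_le_numeral order_trans)
  next
    case 2
    have "S \<omega> - W.expectation S = 0" for \<omega>
    proof -
      have "S \<omega> - W.expectation S = (\<Sum>i=1..n. f i (X i \<omega>) - expectation (f i))"
        unfolding S_def by (rule deviation_eq[of f C, OF f bound])
      also have "\<dots> = 0"
      proof (rule sum.neutral, rule ballI)
        fix i assume "i \<in> {1..n}"
        then show "f i (X i \<omega>) - expectation (f i) = 0" using bound[of i "X i \<omega>"] 2 by simp
      qed
      finally show ?thesis .
    qed
    then have "{\<omega> \<in> space W. \<bar>S \<omega> - W.expectation S\<bar> \<ge> t} = {}" using 2 by simp
    then show ?thesis using nonneg by (simp only: measure_empty)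
  next
    case 3
    have "1 / p 1 \<le> L" "0 < 1 / p 1" using p(3)[of 1] p(1)[of 1] k by auto
    then have L: "L > 0" by linarith
    define D where "D = 8 * K + 12 * L * C * t"
    have D: "D > 0" using K(2) L 3 by (simp add: D_def add_nonneg_pos)
    have Dk: "0 < D / real k" "D / real k \<le> b" using D k b by (simp_all add: D_def)
    have gap': "gap_pow \<pi> P k > 0" using gap k by simp
    have "W.prob {\<omega> \<in> space W. \<bar>S \<omega> - W.expectation S\<bar> \<ge> t}
        \<le> 2 * exp (- (t\<^sup>2 * gap_pow \<pi> P k / D))"
      unfolding S_def D_def by (rule two_sided_tail[OF k gap' f bound 3(2) p K 3(1)])
    also have "t\<^sup>2 * gap_pow \<pi> P k / D = t\<^sup>2 * \<gamma> / (D / real k)" using gap by simp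
    also have "2 * exp (- (t\<^sup>2 * \<gamma> / (D / real k))) \<le> 2 * exp (- (t\<^sup>2 * \<gamma> / b))"
    proof -
      have "t\<^sup>2 * \<gamma> / b \<le> t\<^sup>2 * \<gamma> / (D / real k)"
        by (rule frac_le) (use Dk gap in auto)
      then show ?thesis by simp
    qed
    also have "\<dots> = exp_bound (t\<^sup>2 * \<gamma>) b"
    proof -
      have "b \<noteq> 0" using Dk by argo
      then show ?thesis by (simp add: exp_bound_def)
    qed
    finally show ?thesis .
  qed
qed

section \<open>The two Bernstein inequalities\<close>

lemma pseudo_gap:
  assumes "pseudo_spectral_gap \<pi> P \<noteq> 0"
  shows "pseudo_spectral_gap \<pi> P > 0"
    and "gap_pow \<pi> P (k_ps \<pi> P) = pseudo_spectral_gap \<pi> P * real (k_ps \<pi> P)"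
    and "real (k_ps \<pi> P) \<le> 1 / pseudo_spectral_gap \<pi> P"
proof -
  have k: "real (k_ps \<pi> P) > 0" using k_ps(1) by simp
  show eq: "gap_pow \<pi> P (k_ps \<pi> P) = pseudo_spectral_gap \<pi> P * real (k_ps \<pi> P)"
    using k by (simp add: k_ps(2))
  have "0 \<le> pseudo_spectral_gap \<pi> P"
    unfolding k_ps(2) using gap_pow_bounds(1) by (rule divide_nonneg_nonneg) simp
  with assms show pos: "pseudo_spectral_gap \<pi> P > 0" by simp
  have "real (k_ps \<pi> P) * pseudo_spectral_gap \<pi> P \<le> 1"
    using gap_pow_bounds(2)[of "k_ps \<pi> P"] unfolding eq by (simp only: mult.commute)
  then show "real (k_ps \<pi> P) \<le> 1 / pseudo_spectral_gap \<pi> P"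
    using pos by (simp only: pos_le_divide_eq)
qed

text \<open>A skeleton has at most \<open>n / k + 1\<close> times, so weights \<open>1 / k\<close>
  give \<open>K = k * (n + k) * variance f\<close>. One factor \<open>k\<close> cancels against the
  gap \<open>\<gamma> * k\<close>, and \<open>k \<le> 1 / \<gamma>\<close>, which holds because a
  gap is at most 1, produces \<open>n + 1 / \<gamma>\<close>.\<close>

theorem bernstein_equal:
  assumes f: "f \<in> L2 \<pi>" "\<And>x. \<bar>f x - expectation f\<bar> \<le> C" and t: "t \<ge> 0"
    and gap: "pseudo_spectral_gap \<pi> P \<noteq> 0"
  defines "\<gamma> \<equiv> pseudo_spectral_gap \<pi> P" and "S \<equiv> \<lambda>\<omega>. \<Sum>i=1..n. f (X i \<omega>)"
  shows "W.prob {\<omega> \<in> space W. \<bar>S \<omega> - W.expectation S\<bar> \<ge> t}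
    \<le> exp_bound (t\<^sup>2 * \<gamma>) (8 * (real n + 1 / \<gamma>) * variance f + 20 * t * C)"
proof -
  define k where "k = k_ps \<pi> P"
  have k: "k \<ge> 1" unfolding k_def by (rule k_ps(1))
  have pg: "\<gamma> > 0" "gap_pow \<pi> P k = \<gamma> * real k" "real k \<le> 1 / \<gamma>"
    unfolding \<gamma>_def k_def by (rule pseudo_gap[OF gap])+
  have C: "C \<ge> 0" using f(2)[of undefined] by linarith
  have V: "variance f \<ge> 0" by (rule variance_positive)
  show ?thesis
    unfolding S_def
  proof (rule tail_le_exp_bound[OF k pg(2) pg(1), where f = "\<lambda>_. f" and p = "\<lambda>_. 1 / real k" and L = "real k"
        and K = "real k * (real n + real k) * variance f"])
    fix i assume i: "i \<in> {1..k}"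
    have "{j. i + j * k \<le> n} \<subseteq> {..n div k}"
    proof
      fix j assume "j \<in> {j. i + j * k \<le> n}"
      then have "j * k \<le> n" by simp
      then show "j \<in> {..n div k}" using k by (simp add: less_eq_div_iff_mult_less_eq)
    qed
    then have "card {j. i + j * k \<le> n} \<le> card {..n div k}" by (intro card_mono) auto
    then have "real (card {j. i + j * k \<le> n}) \<le> real (n div k) + 1" by simp
    also have "real (n div k) \<le> real n / real k" by (rule of_nat_div_le_of_nat)
    finally have "real k * real (card {j. i + j * k \<le> n}) \<le> real k * (real n / real k + 1)"
      using k by (intro mult_left_mono) auto
    also have "\<dots> = real n + real k" using k by (simp add: field_simps)
    finally have "real k * (real k * real (card {j. i + j * k \<le> n})) * variance f \<le> real k * (real n + real k) * variance f"
      using V by (intro mult_right_mono mult_left_mono) auto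
    then show "block_variance \<pi> (\<lambda>_. f) n k i / (1 / real k)\<^sup>2 \<le> real k * (real n + real k) * variance f"
      using k by (simp add: block_variance_eq power2_eq_square mult_ac)
  next
    have "8 * ((real n + real k) * variance f) \<le> 8 * ((real n + 1 / \<gamma>) * variance f)"
      using pg(3) V by (intro mult_left_mono mult_right_mono) auto
    moreover have "12 * (C * t) \<le> 20 * (C * t)" using C t by (intro mult_right_mono) auto
    moreover have "(8 * (real k * (real n + real k) * variance f) + 12 * real k * C * t) / real k
        = 8 * ((real n + real k) * variance f) + 12 * (C * t)"
      using k by (simp add: field_simps)
    moreover have "8 * (real n + 1 / \<gamma>) * variance f + 20 * t * C
        = 8 * ((real n + 1 / \<gamma>) * variance f) + 20 * (C * t)"
      by (simp only: mult.assoc mult.commute[of t C])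
    ultimately show "(8 * (real k * (real n + real k) * variance f) + 12 * real k * C * t) / real k
        \<le> 8 * (real n + 1 / \<gamma>) * variance f + 20 * t * C"
      by linarith
  next
    show "0 \<le> real k * (real n + real k) * variance f" using V by (intro mult_nonneg_nonneg) auto
    show "(\<Sum>i=1..k. 1 / real k) = 1" using k by simp
    show "0 < 1 / real k" using k by simp
    show "t \<ge> 0" by (rule t)
    show "f \<in> L2 \<pi>" by (rule f(1))
    show "\<bar>f x - expectation f\<bar> \<le> C" for x by (rule f(2))
  qed simp
qed

text \<open>With \<open>p i = sqrt (V i) / s\<close> every quotient
  \<open>V i / (p i)\<^sup>2\<close> equals \<open>s\<^sup>2\<close>, and Cauchy-Schwarz bounds
  \<open>s\<^sup>2\<close> by \<open>k\<close> times the total variance. The smallest weight gives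
  \<open>1 / p i \<le> s / m\<close>, which is \<open>M\<close>; \<open>m \<noteq> 0\<close> makes
  all weights positive.\<close>

theorem bernstein_general:
  assumes f: "\<And>i. i \<in> {1..n} \<Longrightarrow> f i \<in> L2 \<pi>"
    "\<And>i x. i \<in> {1..n} \<Longrightarrow> \<bar>f i x - expectation (f i)\<bar> \<le> C"
    and t: "t \<ge> 0" and gap: "pseudo_spectral_gap \<pi> P \<noteq> 0"
  defines "\<gamma> \<equiv> pseudo_spectral_gap \<pi> P" and "S \<equiv> \<lambda>\<omega>. \<Sum>i=1..n. f i (X i \<omega>)"
    and "k \<equiv> k_ps \<pi> P"
  defines "V \<equiv> block_variance \<pi> f n k"
  defines "m \<equiv> Min ((\<lambda>i. sqrt (V i)) ` {1..k})"
  assumes m: "m \<noteq> 0"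
  shows "W.prob {\<omega> \<in> space W. \<bar>S \<omega> - W.expectation S\<bar> \<ge> t}
    \<le> exp_bound (t\<^sup>2 * \<gamma>) (8 * (\<Sum>i=1..n. variance (f i)) + 20 * t * C * ((\<Sum>i=1..k. sqrt (V i)) / m) / real k)"
proof -
  have k: "k \<ge> 1" unfolding k_def by (rule k_ps(1))
  have pg: "\<gamma> > 0" "gap_pow \<pi> P k = \<gamma> * real k" "real k \<le> 1 / \<gamma>"
    unfolding \<gamma>_def k_def by (rule pseudo_gap[OF gap])+
  have C: "C \<ge> 0" using f(2)[of 1 undefined] n_ge_1 by simp
  have V_nonneg: "V i \<ge> 0" for i
    unfolding V_def block_variance_eq[OF k] by (intro sum_nonneg variance_positive)
  have m_le: "m \<le> sqrt (V i)" if "i \<in> {1..k}" for i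
    unfolding m_def using that by (intro Min_le) auto
  have "m \<in> (\<lambda>i. sqrt (V i)) ` {1..k}" unfolding m_def using k by (intro Min_in) auto
  then have m_pos: "m > 0" using m V_nonneg by (auto simp: order_less_le)
  define s where "s = (\<Sum>i=1..k. sqrt (V i))"
  have sV: "sqrt (V i) > 0" if "i \<in> {1..k}" for i
    using m_pos m_le[OF that] by (rule order_less_le_trans)
  have s: "s > 0" unfolding s_def using k sV by (intro sum_pos) auto
  have "s\<^sup>2 \<le> (\<Sum>i=1..k. (sqrt (V i))\<^sup>2) * real (card {1..k})"
    unfolding s_def by (rule sum_squared_le_sum_of_squares)
  also have "(\<Sum>i=1..k. (sqrt (V i))\<^sup>2) = (\<Sum>i=1..k. V i)" using V_nonneg by simp
  also have "\<dots> = (\<Sum>i=1..n. variance (f i))"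
    unfolding V_def block_variance_eq[OF k]
    by (rule sum_residue_classes[OF k, of "\<lambda>i. variance (f i)" n, symmetric])
  finally have s2: "s\<^sup>2 \<le> real k * (\<Sum>i=1..n. variance (f i))" by (simp add: mult.commute)
  show ?thesis
    unfolding S_def
  proof (rule tail_le_exp_bound[OF k pg(2) pg(1), where f = f and p = "\<lambda>i. sqrt (V i) / s" and L = "s / m" and K = "s\<^sup>2"])
    fix i assume i: "i \<in> {1..k}"
    show "sqrt (V i) / s > 0" using sV[OF i] s by simp
    show "1 / (sqrt (V i) / s) \<le> s / m"
      using m_le[OF i] m_pos s sV[OF i] by (simp add: frac_le)
    show "block_variance \<pi> f n k i / (sqrt (V i) / s)\<^sup>2 \<le> s\<^sup>2"
      using sV[OF i] V_nonneg[of i] by (simp add: power_divide flip: V_def)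
  next
    show "(\<Sum>i=1..k. sqrt (V i) / s) = 1"
      using s by (simp add: s_def flip: sum_divide_distrib)
  next
    have "8 * s\<^sup>2 / real k \<le> 8 * (\<Sum>i=1..n. variance (f i))"
      using s2 k by (simp add: field_simps)
    moreover have "12 * (s / m * C * t / real k) \<le> 20 * (s / m * C * t / real k)"
      using s m_pos C t by (intro mult_right_mono) auto
    moreover have "(8 * s\<^sup>2 + 12 * (s / m) * C * t) / real k = 8 * s\<^sup>2 / real k + 12 * (s / m * C * t / real k)"
      by (simp add: add_divide_distrib mult.assoc)
    moreover have "20 * t * C * (s / m) / real k = 20 * (s / m * C * t / real k)" by simp
    ultimately show "(8 * s\<^sup>2 + 12 * (s / m) * C * t) / real k
        \<le> 8 * (\<Sum>i=1..n. variance (f i)) + 20 * t * C * ((\<Sum>i=1..k. sqrt (V i)) / m) / real k"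
      unfolding s_def[symmetric] by argo
  qed (use t f in auto)
qed

end

theorem theorem3p11:
  fixes P :: "'a::polish_space \<Rightarrow> 'a measure"
    and \<pi> :: "'a measure"
    and W :: "'w measure"
    and X :: "nat \<Rightarrow> 'w \<Rightarrow> 'a"
    and n :: nat
  assumes "n \<ge> 1"
    and "P \<in> borel \<rightarrow>\<^sub>M prob_algebra borel"
    and "markov_chain W X n P"
    and "stationary_distribution P \<pi>"
    and "\<And>\<nu>. stationary_distribution P \<nu> \<Longrightarrow> \<nu> = \<pi>"
    and "distr W borel (X 1) = \<pi>"
    and "phi_irreducible P"
    and "aperiodic P \<pi>"
  shows
    "(\<forall>(f :: 'a \<Rightarrow> real) C t.
        f \<in> L2 \<pi> \<longrightarrow> (\<forall>x. \<bar>f x - (\<integral>y. f y \<partial>\<pi>)\<bar> \<le> C) \<longrightarrow> t \<ge> 0 \<longrightarrow>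
        (let \<gamma> = pseudo_spectral_gap \<pi> P;
             V = prob_space.variance \<pi> f;
             S = (\<lambda>\<omega>. \<Sum>i=1..n. f (X i \<omega>))
         in measure W {\<omega> \<in> space W. \<bar>S \<omega> - (\<integral>\<omega>. S \<omega> \<partial>W)\<bar> \<ge> t}
              \<le> (if \<gamma> = 0 then 2
                 else exp_bound (t\<^sup>2 * \<gamma>) (8 * (real n + 1 / \<gamma>) * V + 20 * t * C))))
     \<and>
     (\<forall>(f :: nat \<Rightarrow> 'a \<Rightarrow> real) C t.
        (\<forall>i\<in>{1..n}. f i \<in> L2 \<pi> \<and> (\<forall>x. \<bar>f i x - (\<integral>y. f i y \<partial>\<pi>)\<bar> \<le> C)) \<longrightarrow> t \<ge> 0 \<longrightarrow>
        (let \<gamma> = pseudo_spectral_gap \<pi> P;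
             k = k_ps \<pi> P;
             S = (\<lambda>\<omega>. \<Sum>i=1..n. f i (X i \<omega>));
             VS = (\<Sum>i=1..n. prob_space.variance \<pi> (f i));
             V = block_variance \<pi> f n k;
             m = Min ((\<lambda>i. sqrt (V i)) ` {1..k});
             M = (\<Sum>i=1..k. sqrt (V i)) / m
         in measure W {\<omega> \<in> space W. \<bar>S \<omega> - (\<integral>\<omega>. S \<omega> \<partial>W)\<bar> \<ge> t}
              \<le> (if \<gamma> = 0 \<or> m = 0 then 2
                 else exp_bound (t\<^sup>2 * \<gamma>) (8 * VS + 20 * t * C * M / real k))))"
proof -
  interpret stationary_chain P \<pi> W X n
    using assms(1-4,6) by unfold_locales
  have le2: "measure W A \<le> 2" for A
    using W.prob_le_1[of A] by linarith
  show ?thesis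
  proof (intro conjI allI impI)
    fix f :: "'a \<Rightarrow> real" and C t :: real
    assume f: "f \<in> L2 \<pi>" and "\<forall>x. \<bar>f x - (\<integral>y. f y \<partial>\<pi>)\<bar> \<le> C" and t: "t \<ge> 0"
    then have bound: "\<bar>f x - (\<integral>y. f y \<partial>\<pi>)\<bar> \<le> C" for x by blast
    show "let \<gamma> = pseudo_spectral_gap \<pi> P;
             V = prob_space.variance \<pi> f;
             S = (\<lambda>\<omega>. \<Sum>i=1..n. f (X i \<omega>))
         in measure W {\<omega> \<in> space W. \<bar>S \<omega> - (\<integral>\<omega>. S \<omega> \<partial>W)\<bar> \<ge> t}
              \<le> (if \<gamma> = 0 then 2
                 else exp_bound (t\<^sup>2 * \<gamma>) (8 * (real n + 1 / \<gamma>) * V + 20 * t * C))"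
    proof (cases "pseudo_spectral_gap \<pi> P = 0")
      case True
      show ?thesis unfolding Let_def if_P[OF True] by (rule le2)
    next
      case False
      show ?thesis unfolding Let_def if_not_P[OF False] by (rule bernstein_equal[OF f bound t False])
    qed
  next
    fix f :: "nat \<Rightarrow> 'a \<Rightarrow> real" and C t :: real
    assume "\<forall>i\<in>{1..n}. f i \<in> L2 \<pi> \<and> (\<forall>x. \<bar>f i x - (\<integral>y. f i y \<partial>\<pi>)\<bar> \<le> C)" and t: "t \<ge> 0"
    then have f: "f i \<in> L2 \<pi>" and bound: "\<bar>f i x - (\<integral>y. f i y \<partial>\<pi>)\<bar> \<le> C" if "i \<in> {1..n}" for i x
      using that by blast+
    show "let \<gamma> = pseudo_spectral_gap \<pi> P;
             k = k_ps \<pi> P;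
             S = (\<lambda>\<omega>. \<Sum>i=1..n. f i (X i \<omega>));
             VS = (\<Sum>i=1..n. prob_space.variance \<pi> (f i));
             V = block_variance \<pi> f n k;
             m = Min ((\<lambda>i. sqrt (V i)) ` {1..k});
             M = (\<Sum>i=1..k. sqrt (V i)) / m
         in measure W {\<omega> \<in> space W. \<bar>S \<omega> - (\<integral>\<omega>. S \<omega> \<partial>W)\<bar> \<ge> t}
              \<le> (if \<gamma> = 0 \<or> m = 0 then 2
                 else exp_bound (t\<^sup>2 * \<gamma>) (8 * VS + 20 * t * C * M / real k))"
    proof (cases "pseudo_spectral_gap \<pi> P = 0 \<or>
        Min ((\<lambda>i. sqrt (block_variance \<pi> f n (k_ps \<pi> P) i)) ` {1..k_ps \<pi> P}) = 0")
      case True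
      show ?thesis unfolding Let_def if_P[OF True] by (rule le2)
    next
      case False
      then have nz: "pseudo_spectral_gap \<pi> P \<noteq> 0"
        "Min ((\<lambda>i. sqrt (block_variance \<pi> f n (k_ps \<pi> P) i)) ` {1..k_ps \<pi> P}) \<noteq> 0" by blast+
      show ?thesis unfolding Let_def if_not_P[OF False] by (rule bernstein_general[OF f bound t nz])
    qed
  qed
qed

end
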